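(* (i) Let $m\in(0,4)$. Then, for any $a>0$, there exists a weak solution $h$ of the thin-film equation $h_t+(h^mh_{xxx})_x=0$ in $\{(x,t): h(x,t)>0\}$ with initial data $h_{\rm in}(x)=a|x|$ of the self-similar form $$h(x,t)=t^{\frac{1}{4-m}}f(y),\qquad y=\frac{|x|}{t^{\frac{1}{4-m}}},$$ for $x\in\mathbb{R}$ and for some $f:[0,\infty)\to\mathbb{R}$. (ii) Let $m=4$. Then, for any $a>0$, there exist $b>0$ and a self-similar weak solution $h$ of the thin-film equation $h_t+(h^4h_{xxx})_x=0$ in $\{(x,t): h(x,t)>0\}$ of the form $$h(x,t)=e^{bt}f(y),\qquad y=\frac{|x|}{e^{bt}},$$ defined for all $t\in\mathbb{R}$, and such that $$h(x,t)=a|x|+\mathrm{Re}\Big[K\Big(\frac{|x|}{e^{bt}}\Big)^{1+z_0}\Big]+o\Big(\Big(\frac{|x|}{e^{bt}}\Big)^{1+\mathrm{Re}(z_0)}\Big)$$ uniformly as $t\to-\infty$ for $x\in[-R,R]$ for any fixed $R>0$. Here $K,z_0\in\mathbb{C}$ are the constants in the large-$y$ expansion of the profile $f$ described in the context.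
   Context: Weak solution: let $t_0\ge-\infty$ and let $I=[t_0,\infty)$. A function $h\in C^0(I\times\mathbb{R})\cap L^\infty(I,H^1_{\rm loc}(\mathbb{R}))$ such that $h^{m/2}h_{xxx}$ exists in the distributional sense and $$\int_{\mathbb{R}}|h^{m/2}h_{xxx}|^2\,dx<\infty\quad\text{for a.e. }t>t_0$$ is called a weak solution of the thin-film equation $h_t+(h^mh_{xxx})_x=0$ in $\{h>0\}$ if $h\ge0$ and, for all $\psi\in C_c^\infty(I\times\mathbb{R})$, $$\int_I\int_{\mathbb{R}}h\,\psi_t\,dx\,ds+\int_I\int_{\{h>0\}}h^mh_{xxx}\psi_x\,dx\,ds=0.$$ The function $h_{\rm in}\in C^0(\mathbb{R})$ is called initial data if $h(x,t)\to h_{\rm in}(x)$ as $t\to t_0$. In (i) the initial time is $t_0=0$. Constants in (ii): for $m=4$ the self-similar profile $f$ solves $b(f-yf_y)+(f^4f_{yyy})_y=0$ for $y\in(0,\infty)$, with $f(0)=1$, $f_y(0)=0$, $f_{yy}(0)=\kappa$, $f_{yyy}(0)=0$ for some $\kappa>0$, and $f(y)/y\to a$ as $y\to\infty$; it satisfies $$f(y)=ay+\mathrm{Re}[Ky^{1+z_0}]+o(y^{1+\mathrm{Re}(z_0)})\quad\text{as }y\to\infty$$ for $z_0,K\in\mathbb{C}$ with $\mathrm{Re}(z_0)<-1$. Here $z_0$ is the root of $(1-z^2)(2+z)+\frac{b}{a^4}$ with the largest negative real part and, for definiteness, with $\mathrm{Im}(z_0)\ge0$.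
   Formalization: The K-term gets the missing factor e^{bt} (else K=0); x=0 is excluded, error e^{bt}o(y^{1+Re z0}) also given for |x|≥δ; the L^∞(I,H^1_loc) bound is for t≤T only, as h(0,t)=e^{bt} is unbounded; ψ is supported in t>t_0, since otherwise h_in=0. *)

theory Defs
  imports "HOL-Analysis.Analysis" "HOL-Library.Landau_Symbols"
begin

primrec Ck :: "nat \<Rightarrow> ('a::euclidean_space \<Rightarrow> real) \<Rightarrow> bool" where
  "Ck 0 f \<longleftrightarrow> continuous_on UNIV f"
| "Ck (Suc k) f \<longleftrightarrow> (\<forall>x. f differentiable (at x)) \<and>
     (\<forall>e\<in>Basis. Ck k (\<lambda>x. frechet_derivative f (at x) e))"

text \<open>\<open>\<phi>\<close> belongs to \<open>C_c^\<infinity>(U)\<close>, extended by zero to the whole space.\<close>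
definition test_function :: "'a::euclidean_space set \<Rightarrow> ('a \<Rightarrow> real) \<Rightarrow> bool" where
  "test_function U \<phi> \<longleftrightarrow>
     (\<forall>k. Ck k \<phi>) \<and> compact (closure {x. \<phi> x \<noteq> 0}) \<and> closure {x. \<phi> x \<noteq> 0} \<subseteq> U"

definition loc_integrable :: "(real \<Rightarrow> real) \<Rightarrow> bool" where
  "loc_integrable u \<longleftrightarrow> (\<forall>R>0. set_integrable lborel {-R..R} u)"

text \<open>The \<open>k\<close>-th distributional derivative of \<open>u\<close> on the real line is the function \<open>v\<close>.\<close>
definition weak_deriv :: "nat \<Rightarrow> (real \<Rightarrow> real) \<Rightarrow> (real \<Rightarrow> real) \<Rightarrow> bool" where
  "weak_deriv k u v \<longleftrightarrow> loc_integrable u \<and> loc_integrable v \<and>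
     (\<forall>\<phi>. test_function UNIV \<phi> \<longrightarrow>
        (LINT x|lborel. u x * (deriv ^^ k) \<phi> x) = (-1) ^ k * (LINT x|lborel. v x * \<phi> x))"

text \<open>Functions of \<open>(x,t)\<close> are written \<open>h t x\<close>, so that \<open>h t\<close> is the profile at time \<open>t\<close>.
  The next definition is membership in \<open>L^\<infinity>(J, H^1_loc(\<real>))\<close>. Measurability of
  \<open>t \<mapsto> h t\<close> with values in \<open>H^1(-R,R)\<close> is not listed: it follows from the continuity of
  \<open>h\<close> that accompanies every use below.\<close>
definition Linf_H1loc :: "real set \<Rightarrow> (real \<Rightarrow> real \<Rightarrow> real) \<Rightarrow> bool" where
  "Linf_H1loc J h \<longleftrightarrow>
     (\<exists>hx. (AE t in lborel. t \<in> J \<longrightarrow> weak_deriv 1 (h t) (hx t)) \<and>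
       (\<forall>R>0. \<exists>C. AE t in lborel. t \<in> J \<longrightarrow>
          set_integrable lborel {-R..R} (\<lambda>x. (h t x)\<^sup>2 + (hx t x)\<^sup>2) \<and>
          (LINT x:{-R..R}|lborel. (h t x)\<^sup>2 + (hx t x)\<^sup>2) \<le> C))"

text \<open>Weak solutions of \<open>h_t + (h^m h_xxx)_x = 0\<close> in \<open>{h > 0}\<close> on the time interval
  \<open>I = [t0,\<infinity>)\<close>, where \<open>t0 = -\<infinity>\<close> means \<open>I = \<real>\<close>.

  \<^item> The bound in \<open>H^1_loc\<close> is required on \<open>{t \<in> I. t \<le> T}\<close> for every \<open>T\<close>, that is, uniformly down
    to the initial time but not as \<open>t \<rightarrow> \<infinity>\<close>: the solutions of interest lift off,
    with \<open>h(0,t) \<rightarrow> \<infinity>\<close>.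

  \<^item> Test functions are supported in the open set \<open>(t0,\<infinity>) \<times> \<real>\<close>. Since the identity has no term
    at the initial time, admitting \<open>\<psi>(\<cdot>,t0) \<noteq> 0\<close> would force \<open>h(\<cdot>,t0) = 0\<close>.

  \<^item> \<open>h3\<close> is the distributional derivative \<open>h_xxx\<close> on all of \<open>\<real>\<close>; a wedge \<open>a|x|\<close>
    does not possess one in the class of functions.

  \<^item> The Bochner integral of a non-integrable function is \<open>0\<close>, hence the explicit integrability
    of the flux term; that of \<open>h \<psi>_t\<close> follows from continuity.\<close>
definition weak_solution :: "ereal \<Rightarrow> real \<Rightarrow> (real \<Rightarrow> real \<Rightarrow> real) \<Rightarrow> bool" where
  "weak_solution t0 m h \<longleftrightarrow>
     continuous_on ({t. t0 \<le> ereal t} \<times> UNIV) (\<lambda>(t, x). h t x) \<and>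
     (\<forall>T. Linf_H1loc {t. t0 \<le> ereal t \<and> t \<le> T} h) \<and>
     (\<forall>t x. t0 \<le> ereal t \<longrightarrow> 0 \<le> h t x) \<and>
     (\<exists>h3.
        (AE t in lborel. t0 < ereal t \<longrightarrow>
           weak_deriv 3 (h t) (h3 t) \<and>
           integrable lborel (\<lambda>x. \<bar>h t x powr (m/2) * h3 t x\<bar>\<^sup>2)) \<and>
        (\<forall>\<psi>. test_function ({t. t0 < ereal t} \<times> UNIV) \<psi> \<longrightarrow>
           set_integrable (lborel :: (real \<times> real) measure) {(t, x). t0 \<le> ereal t \<and> 0 < h t x}
             (\<lambda>(t, x). h t x powr m * h3 t x * deriv (\<lambda>\<xi>. \<psi> (t, \<xi>)) x) \<and>
           (LINT t:{t. t0 \<le> ereal t}|lborel. LINT x|lborel.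
               h t x * deriv (\<lambda>s. \<psi> (s, x)) t) +
           (LINT t:{t. t0 \<le> ereal t}|lborel. LINT x:{x. 0 < h t x}|lborel.
               h t x powr m * h3 t x * deriv (\<lambda>\<xi>. \<psi> (t, \<xi>)) x) = 0))"

definition has_initial_data ::
    "ereal \<Rightarrow> (real \<Rightarrow> real \<Rightarrow> real) \<Rightarrow> (real \<Rightarrow> real) \<Rightarrow> bool" where
  "has_initial_data t0 h h_in \<longleftrightarrow> continuous_on UNIV h_in \<and>
     (\<forall>x. ((\<lambda>t. h (real_of_ereal t) x) \<longlongrightarrow> h_in x) (at_right t0))"

text \<open>The self-similar profile for \<open>m = 4\<close>; \<open>f1\<close>, \<open>f2\<close>, \<open>f3\<close> are \<open>f_y\<close>, \<open>f_yy\<close>, \<open>f_yyy\<close>,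
  one-sided at \<open>y = 0\<close>.\<close>
definition profile :: "real \<Rightarrow> real \<Rightarrow> real \<Rightarrow> (real \<Rightarrow> real) \<Rightarrow> bool" where
  "profile a b \<kappa> f \<longleftrightarrow>
     (\<exists>f1 f2 f3.
        (\<forall>y\<ge>0. (f has_real_derivative f1 y) (at y within {0..}) \<and>
                (f1 has_real_derivative f2 y) (at y within {0..}) \<and>
                (f2 has_real_derivative f3 y) (at y within {0..})) \<and>
        (\<forall>y>0. \<exists>D. ((\<lambda>y. f y ^ 4 * f3 y) has_real_derivative D) (at y) \<and>
                   b * (f y - y * f1 y) + D = 0) \<and>
        f 0 = 1 \<and> f1 0 = 0 \<and> f2 0 = \<kappa> \<and> f3 0 = 0) \<and>
     ((\<lambda>y. f y / y) \<longlongrightarrow> a) at_top"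

definition decay_root :: "real \<Rightarrow> real \<Rightarrow> complex \<Rightarrow> bool" where
  "decay_root a b z \<longleftrightarrow> (1 - z\<^sup>2) * (2 + z) + of_real (b / a ^ 4) = 0"

text \<open>The root with the largest negative real part: among the roots in the left half plane, the one
  closest to the imaginary axis, which governs the slowest decay.\<close>
definition leading_root :: "real \<Rightarrow> real \<Rightarrow> complex \<Rightarrow> bool" where
  "leading_root a b z0 \<longleftrightarrow> decay_root a b z0 \<and> Re z0 < 0 \<and> 0 \<le> Im z0 \<and>
     (\<forall>z. decay_root a b z \<and> Re z < 0 \<longrightarrow> Re z \<le> Re z0)"

text \<open>\<open>h - a|x| - e^(bt) Re[K y^(1+z0)]\<close> with \<open>y = |x|/e^(bt)\<close>. The factor \<open>e^(bt)\<close> comes from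
  inserting the expansion of \<open>f\<close> into \<open>h = e^(bt) f(y)\<close>.\<close>
definition expansion_error ::
    "real \<Rightarrow> real \<Rightarrow> complex \<Rightarrow> complex \<Rightarrow> (real \<Rightarrow> real \<Rightarrow> real) \<Rightarrow> real \<Rightarrow> real \<Rightarrow> real" where
  "expansion_error a b K z0 h t x =
     h t x - a * \<bar>x\<bar> -
       exp (b * t) * Re (K * complex_of_real (\<bar>x\<bar> / exp (b * t)) powr (1 + z0))"

end

theory Submission
  imports Defs
begin

text \<open>
  Write \<open>v = f'\<close>, \<open>g = f''\<close>, \<open>J = f\<^sup>m f'''\<close> and \<open>w = y f' - f\<close>. After scaling, the profile equation is the
  system \<open>g' = f\<^sup>-\<^sup>m J\<close>, \<open>J' = w\<close>, \<open>w' = y g\<close> with \<open>f(0) = 1\<close>, \<open>f'(0) = J(0) = 0\<close> and a shooting parameter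
  \<open>f''(0)\<close>. The energy \<open>E = g J - w\<^sup>2 / (2 y)\<close> is nondecreasing, so the parameters with \<open>E(n) \<le> 0\<close> form a
  nested sequence of compact sets. They are nonempty because \<open>J(n)\<close> changes sign between a small and
  a large parameter: the system is cooperative and preserves both octants of constant sign. A common
  parameter has \<open>E \<le> 0\<close> everywhere, and this single inequality gives everything else. Since
  \<open>Q = E + (f - 1/2) / y\<close> is nondecreasing with \<open>Q(0+) = 0\<close>, it yields \<open>f \<ge> 1/2\<close> and \<open>f / y \<ge> Q(1) > 0\<close>; since
  \<open>(f / y)' = w / y\<^sup>2\<close> and \<open>E' = f\<^sup>-\<^sup>m J\<^sup>2 + w\<^sup>2 / (2 y\<^sup>2)\<close> is integrable, \<open>f / y\<close> converges and the dissipation is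
  finite.

  For \<open>m = 4\<close> the vector \<open>(w, y\<^sup>2 g, J / y)\<close> solves, in the variable \<open>ln y\<close>, an exponentially small
  perturbation of a linear system with characteristic equation \<open>\<mu> (\<mu> - 2) (\<mu> + 1) = 1 / a\<^sup>4\<close>. Finite
  dissipation excludes the growing mode, and the decay rate improves by iteration until the leading
  modes appear. The expansion would contain a logarithm if the cubic had a double root; an estimate of
  the slope, \<open>a \<le> 28/25\<close>, rules this out, and the remaining two roots are complex conjugate.
\<close>

section \<open>Ordinary differential equations\<close>

text \<open>The obstacle is the singularity of \<open>f^-m\<close> at \<open>f = 0\<close>: nothing
  known before the shooting keeps the film away from zero. The identities for \<open>E\<close> and
  \<open>Q\<close> hold with any positive coefficient in place of \<open>f^-m\<close>, so the
  shooting uses \<open>max f (1/2) powr (-m)\<close>, which is bounded and Lipschitz. The lower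
  bound 1/2 that \<open>Q\<close> delivers is exactly the truncation level, so the truncation is
  never active.

  \<open>E\<close> comes from multiplying \<open>J' = w\<close> by \<open>g\<close>: the equation
  \<open>w' = y g\<close> turns \<open>w g\<close> into \<open>w w' / y\<close>, a total derivative
  up to a square. Linear growth at infinity does not obviously pass to limits of parameters, whereas
  \<open>E(n) \<le> 0\<close> is a closed condition inherited by smaller \<open>n\<close>; no
  estimate uniform in the parameter is needed.

  The shooting does not prescribe the slope. It is adjusted afterwards by the scaling
  \<open>l f(y / \<mu>)\<close>, whose remaining freedom fits the time exponent if
  \<open>m < 4\<close> and keeps \<open>f(0) = 1\<close> if \<open>m = 4\<close>; in the latter case
  \<open>b\<close> results. The quotient \<open>b / a^4\<close> is invariant under this scaling, so
  the bound on the unscaled slope decides about the double root.\<close>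

lemma mono_from_deriv:
  fixes F :: "real \<Rightarrow> real"
  assumes ab: "a \<le> b"
    and d: "\<And>y. a \<le> y \<Longrightarrow> y \<le> b \<Longrightarrow> (F has_real_derivative F' y) (at y within T)"
    and T: "{a..b} \<subseteq> T"
    and nn: "\<And>y. a < y \<Longrightarrow> y < b \<Longrightarrow> 0 \<le> F' y"
  shows "F a \<le> F b"
proof (rule DERIV_nonneg_imp_increasing_open[OF ab])
  fix y assume y: "a < y" "y < b"
  have "(F has_real_derivative F' y) (at y within {a<..<b})"
    by (rule DERIV_subset[OF d]) (use y T in auto)
  then have "(F has_real_derivative F' y) (at y)"
    using y by (simp add: at_within_open[of y "{a<..<b}"])
  then show "\<exists>z. DERIV F y :> z \<and> z \<ge> 0" using nn[OF y] by blast
next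
  show "continuous_on {a..b} F"
    by (rule DERIV_continuous_on[where D=F'], rule DERIV_subset[OF d T]) auto
qed

lemma at_within_pos: "0 < (x::real) \<Longrightarrow> at x within {0..} = at x"
  by (rule at_within_open_subset[of _ "{0<..}"]) auto

text \<open>By Cauchy-Schwarz the derivative of \<open>(X y \<bullet> X y) * exp (- 2 * B y)\<close>
  is nonpositive. The integrated rate \<open>B\<close> is a parameter, so the same lemma serves the
  growth of one solution and the distance of two.\<close>

lemma gronwall_norm:
  fixes X :: "real \<Rightarrow> 'a::real_inner"
  assumes d: "\<And>y. 0 \<le> y \<Longrightarrow> (X has_vector_derivative X' y) (at y within {0..})"
    and B: "\<And>y. 0 \<le> y \<Longrightarrow> (B has_real_derivative L y) (at y within {0..})"
    and le: "\<And>y. 0 \<le> y \<Longrightarrow> norm (X' y) \<le> L y * norm (X y)"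
    and "B 0 = 0" "0 \<le> y"
  shows "norm (X y) \<le> norm (X 0) * exp (B y)"
proof -
  let ?F = "\<lambda>y. (X y \<bullet> X y) * exp (- 2 * B y)"
  have D: "(?F has_real_derivative
      - (2 * L y * (X y \<bullet> X y) - 2 * (X y \<bullet> X' y)) * exp (- 2 * B y)) (at y within {0..})"
    if "0 \<le> y" for y
  proof -
    have "((\<lambda>y. X y \<bullet> X y) has_vector_derivative (X y \<bullet> X' y + X' y \<bullet> X y)) (at y within {0..})"
      using bounded_bilinear.has_vector_derivative[OF bounded_bilinear_inner d[OF that] d[OF that]] .
    then have "((\<lambda>y. X y \<bullet> X y) has_real_derivative (2 * (X y \<bullet> X' y))) (at y within {0..})"
      by (simp add: has_real_derivative_iff_has_vector_derivative inner_commute)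
    then show ?thesis
      by (auto intro!: derivative_eq_intros B that simp: algebra_simps)
  qed
  have nn: "0 \<le> (2 * L y * (X y \<bullet> X y) - 2 * (X y \<bullet> X' y))" if "0 \<le> y" for y
  proof -
    have "X y \<bullet> X' y \<le> norm (X y) * norm (X' y)" by (rule norm_cauchy_schwarz)
    also have "\<dots> \<le> norm (X y) * (L y * norm (X y))"
      by (intro mult_left_mono le that) auto
    also have "\<dots> = L y * (X y \<bullet> X y)" by (simp add: dot_square_norm power2_eq_square)
    finally show ?thesis by simp
  qed
  have "- ?F 0 \<le> - ?F y"
  proof (rule mono_from_deriv[OF \<open>0 \<le> y\<close> DERIV_minus[OF D]])
    fix z :: real assume "0 < z" "z < y"
    then have "0 \<le> (2 * L z * (X z \<bullet> X z) - 2 * (X z \<bullet> X' z)) * exp (- 2 * B z)"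
      by (intro mult_nonneg_nonneg nn) auto
    then show "0 \<le> - (- (2 * L z * (X z \<bullet> X z) - 2 * (X z \<bullet> X' z)) * exp (- 2 * B z))"
      by (metis minus_mult_left minus_minus)
  qed auto
  then have "X y \<bullet> X y \<le> (X 0 \<bullet> X 0) * exp (2 * B y)"
    using \<open>B 0 = 0\<close> by (simp add: exp_minus divide_simps)
  then have "(norm (X y))\<^sup>2 \<le> (norm (X 0) * exp (B y))\<^sup>2"
    by (simp add: dot_square_norm power_mult_distrib exp_double)
  then show ?thesis by (rule power2_le_imp_le) simp
qed

text \<open>Picard iteration in the norm with weight \<open>exp (-2 B)\<close>, in which it is a contraction by \<open>1/2\<close> on
  the whole half line.\<close>
lemma global_ode:
  fixes V :: "real \<Rightarrow> 'a \<Rightarrow> 'a::banach" and L :: "real \<Rightarrow> real"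
  assumes cont: "continuous_on ({0..} \<times> UNIV) (\<lambda>(s, x). V s x)"
    and lip: "\<And>s x y. 0 \<le> s \<Longrightarrow> norm (V s x - V s y) \<le> L s * norm (x - y)"
    and B: "\<And>y. 0 \<le> y \<Longrightarrow> (B has_real_derivative L y) (at y within {0..})"
    and B0: "B 0 = 0" and L: "continuous_on {0..} L" "\<And>s. 0 \<le> s \<Longrightarrow> 0 \<le> L s"
    and V0: "\<And>s. 0 \<le> s \<Longrightarrow> V s 0 = 0"
  shows "\<exists>X. X 0 = x0 \<and> (\<forall>y\<ge>0. (X has_vector_derivative V y (X y)) (at y within {0..}))"
proof -
  \<comment> \<open>The unknown of the fixed point problem is \<open>X / W\<close>. The argument
    \<open>max 0 y\<close> extends the weight to the whole line, on which the bounded continuous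
    functions live.\<close>
  define W where "W y = exp (2 * B (max 0 y))" for y
  have contB: "continuous_on {0..} B"
    by (rule DERIV_continuous_on[where D=L]) (use B in auto)
  have contW: "continuous_on A W" for A
  proof -
    have "continuous_on UNIV (\<lambda>y. B (max 0 y))"
      by (rule continuous_on_compose2[OF contB]) (auto intro!: continuous_intros)
    then show ?thesis unfolding W_def
      by (auto intro!: continuous_intros intro: continuous_on_subset)
  qed
  have Wpos: "0 < W y" for y by (simp add: W_def)
  have B_nonneg: "0 \<le> B y" if "0 \<le> y" for y
    using mono_from_deriv[OF that B] B0 that L(2) by auto
  have Wne: "W y \<noteq> 0" for y using Wpos[of y] by simp
  have W1: "1 \<le> W y" for y using B_nonneg[of "max 0 y"] by (simp add: W_def)
  have dW: "(W has_real_derivative 2 * L y * W y) (at y within {0..})" if "0 \<le> y" for y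
  proof -
    have "((\<lambda>y. exp (2 * B y)) has_real_derivative 2 * L y * exp (2 * B y)) (at y within {0..})"
      by (auto intro!: derivative_eq_intros B that)
    then show ?thesis using that
      by (subst (asm) has_field_derivative_cong_eventually[where g=W])
         (auto simp: W_def eventually_at_filter max_def intro!: always_eventually)
  qed
  define N where "N Z s = V s (W s *\<^sub>R Z s)" for Z s
  have contN: "continuous_on {0..y} (N (apply_bcontfun Z))" for y Z
  proof -
    have "continuous_on {0..y} (\<lambda>s. (\<lambda>(s, x). V s x) (s, W s *\<^sub>R apply_bcontfun Z s))"
      by (rule continuous_on_compose2[OF cont])
         (auto intro!: continuous_intros contW)
    then show ?thesis by (simp add: N_def[abs_def])
  qed
  define I where "I Z y = integral {0..y} (N (apply_bcontfun Z))" for Z y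
  have dI: "(I Z has_vector_derivative N (apply_bcontfun Z) y) (at y within {0..})"
    if "0 \<le> y" for y Z
  proof -
    have "(I Z has_vector_derivative N (apply_bcontfun Z) y) (at y within {0..y+1})"
      unfolding I_def[abs_def]
      by (rule integral_has_vector_derivative[OF contN]) (use that in auto)
    moreover have "at y within {0..y+1} = at y within {0..}"
      by (rule at_within_nhd[of _ "{..<y+1}"]) (use that in auto)
    ultimately show ?thesis by simp
  qed
  have I0: "I Z 0 = 0" for Z by (simp add: I_def)
  \<comment> \<open>Origin of the contraction constant: the integrands differ by at most
    \<open>L * W * dist Z1 Z2\<close>, which is the derivative of \<open>W * dist Z1 Z2 / 2\<close>,
    because \<open>W' = 2 * L * W\<close>.\<close>
  have Idiff: "norm (I Z1 y - I Z2 y) \<le> W y * (dist Z1 Z2 / 2)" if "0 \<le> y" for y Z1 Z2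
  proof (cases "y = 0")
    case True then show ?thesis using I0 Wpos by (simp add: less_imp_le)
  next
    case False
    then have y: "0 < y" using that by simp
    have "norm ((I Z1 y - I Z2 y) - (I Z1 0 - I Z2 0)) \<le> (dist Z1 Z2 / 2) * W y - (dist Z1 Z2 / 2) * W 0"
    proof (rule differentiable_bound_general[OF y])
      have cI: "continuous_on {0..} (I Z)" for Z
        using dI by (auto intro!: continuous_on_vector_derivative)
      show "continuous_on {0..y} (\<lambda>y. I Z1 y - I Z2 y)"
        by (intro continuous_intros continuous_on_subset[OF cI]) auto
      show "continuous_on {0..y} (\<lambda>y. (dist Z1 Z2 / 2) * W y)"
        by (intro continuous_intros contW)
      fix x assume x: "0 < x" "x < y"
      have at: "at x = at x within {0..}"
        using at_within_pos x by simp
      show "((\<lambda>y. I Z1 y - I Z2 y) has_vector_derivative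
          (N (apply_bcontfun Z1) x - N (apply_bcontfun Z2) x)) (at x)"
        unfolding at by (intro has_vector_derivative_diff dI) (use x in auto)
      show "((\<lambda>y. (dist Z1 Z2 / 2) * W y) has_vector_derivative
          ((dist Z1 Z2 / 2) * (2 * L x * W x))) (at x)"
        unfolding at has_real_derivative_iff_has_vector_derivative[symmetric]
        by (intro DERIV_cmult dW) (use x in auto)
      have "norm (N (apply_bcontfun Z1) x - N (apply_bcontfun Z2) x)
          \<le> L x * norm (W x *\<^sub>R apply_bcontfun Z1 x - W x *\<^sub>R apply_bcontfun Z2 x)"
        unfolding N_def by (rule lip) (use x in auto)
      also have "\<dots> = L x * (W x * dist (apply_bcontfun Z1 x) (apply_bcontfun Z2 x))"
        using Wpos[of x] by (simp add: dist_norm scaleR_diff_right[symmetric])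
      also have "\<dots> \<le> L x * (W x * dist Z1 Z2)"
        using L(2)[of x] Wpos[of x] x dist_bounded[of Z1 x Z2]
        by (intro mult_left_mono) auto
      finally show "norm (N (apply_bcontfun Z1) x - N (apply_bcontfun Z2) x) \<le>
          (dist Z1 Z2 / 2) * (2 * L x * W x)"
        by (simp add: algebra_simps)
    qed
    moreover have "0 \<le> (dist Z1 Z2 / 2) * W 0" using Wpos[of 0] by simp
    ultimately show ?thesis by (simp add: I0 algebra_simps)
  qed
  \<comment> \<open>Since \<open>V\<close> vanishes at 0, the zero function serves as a reference:
    \<open>Idiff\<close> against it bounds \<open>I Z\<close> by a multiple of \<open>W\<close>, so
    the iterates are bounded after division by \<open>W\<close>.\<close>
  have Izero: "I 0 y = 0" if "0 \<le> y" for y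
    unfolding I_def N_def
    by (rule integral_eq_0_iff[THEN iffD2, OF _] | rule trans[OF integral_cong integral_0])
       (use V0 in \<open>auto\<close>)
  define T where "T Z = Bcontfun (\<lambda>y. (1 / W y) *\<^sub>R (x0 + I Z (max 0 y)))" for Z
  have bc: "(\<lambda>y. (1 / W y) *\<^sub>R (x0 + I Z (max 0 y))) \<in> bcontfun" for Z
  proof (rule bcontfun_normI)
    have cI: "continuous_on {0..} (I Z)"
      using dI by (auto intro!: continuous_on_vector_derivative)
    have "continuous_on UNIV (\<lambda>y. I Z (max 0 y))"
      by (rule continuous_on_compose2[OF cI]) (auto intro!: continuous_intros)
    then show "continuous_on UNIV (\<lambda>y. (1 / W y) *\<^sub>R (x0 + I Z (max 0 y)))"
      using Wne by (intro continuous_intros contW) auto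
    fix y :: real
    have "norm (I Z (max 0 y)) \<le> W (max 0 y) * (dist Z 0 / 2)"
      using Idiff[of "max 0 y" Z 0] Izero[of "max 0 y"] by simp
    moreover have "W (max 0 y) = W y" by (simp add: W_def)
    ultimately have "norm (x0 + I Z (max 0 y)) \<le> W y * norm x0 + W y * (dist Z 0 / 2)"
      using W1[of y] mult_right_mono[of 1 "W y" "norm x0"] norm_triangle_ineq[of x0 "I Z (max 0 y)"]
      by auto
    then show "norm ((1 / W y) *\<^sub>R (x0 + I Z (max 0 y))) \<le> norm x0 + dist Z 0 / 2"
      using Wpos[of y] by (simp add: pos_divide_le_eq algebra_simps del: scaleR_add_right)
  qed
  have T_apply: "apply_bcontfun (T Z) y = (1 / W y) *\<^sub>R (x0 + I Z (max 0 y))" for Z y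
    unfolding T_def by (simp add: Bcontfun_inverse[OF bc])
  have "\<exists>!Z. T Z = Z"
  proof (rule banach_fix_type[of "1/2"])
    show "\<forall>Z1 Z2. dist (T Z1) (T Z2) \<le> 1 / 2 * dist Z1 Z2"
    proof (intro allI dist_bound)
      fix Z1 Z2 y
      have W: "W (max 0 y) = W y" by (simp add: W_def)
      have "dist (apply_bcontfun (T Z1) y) (apply_bcontfun (T Z2) y)
          = (1 / W y) * norm (I Z1 (max 0 y) - I Z2 (max 0 y))"
        unfolding T_apply dist_norm scaleR_diff_right[symmetric] using Wpos[of y] by simp
      also have "\<dots> \<le> (1 / W y) * (W y * (dist Z1 Z2 / 2))"
        using Idiff[of "max 0 y" Z1 Z2] Wpos[of y] W by (intro mult_left_mono) auto
      finally show "dist (apply_bcontfun (T Z1) y) (apply_bcontfun (T Z2) y) \<le> 1 / 2 * dist Z1 Z2"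
        using Wpos[of y] by simp
    qed
  qed auto
  then obtain Z where Z: "T Z = Z" by blast
  define X where "X y = x0 + I Z y" for y
  have ZX: "W y *\<^sub>R apply_bcontfun Z y = X y" if "0 \<le> y" for y
    using T_apply[of Z y] Wpos[of y] that unfolding Z X_def by simp
  have "(X has_vector_derivative V y (X y)) (at y within {0..})" if "0 \<le> y" for y
    using dI[OF that, of Z] unfolding N_def ZX[OF that] X_def[abs_def]
    by (auto intro!: derivative_eq_intros)
  moreover have "X 0 = x0" by (simp add: X_def I0)
  ultimately show ?thesis by blast
qed

lemma integral_half_line_deriv:
  fixes L :: "real \<Rightarrow> real"
  assumes "continuous_on {0..} L" "0 \<le> y"
  shows "((\<lambda>y. integral {0..y} L) has_real_derivative L y) (at y within {0..})"
proof -
  have "((\<lambda>y. integral {0..y} L) has_vector_derivative L y) (at y within {0..y+1})"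
    by (rule integral_has_vector_derivative[OF continuous_on_subset[OF assms(1)]]) (use assms in auto)
  moreover have "at y within {0..y+1} = at y within {0..}"
    by (rule at_within_nhd[of _ "{..<y+1}"]) (use assms in auto)
  ultimately show ?thesis
    by (simp add: has_real_derivative_iff_has_vector_derivative)
qed

section \<open>The shooting family with a clamped vector field\<close>

definition clamp_abs :: "real \<Rightarrow> real \<Rightarrow> real" where
  "clamp_abs c x = max (- c) (min c x)"

lemma clamp_abs_bounds:
  assumes "0 \<le> c"
  shows "\<bar>clamp_abs c x - clamp_abs c y\<bar> \<le> \<bar>x - y\<bar>" "\<bar>clamp_abs c x\<bar> \<le> c"
    "\<bar>clamp_abs c x\<bar> \<le> \<bar>x\<bar>" "\<bar>x\<bar> \<le> c \<Longrightarrow> clamp_abs c x = x"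
  using assms by (auto simp: clamp_abs_def max_def min_def)

text \<open>The unknown is the quadruple \<open>(f, v, g, J)\<close>; \<open>P\<close> is the
  mobility factor as a function of the height, \<open>M\<close> the clamping level as a function of
  \<open>y\<close>.\<close>

definition flow_field :: "(real \<Rightarrow> real) \<Rightarrow> (real \<Rightarrow> real) \<Rightarrow> real \<Rightarrow>
    real \<times> real \<times> real \<times> real \<Rightarrow> real \<times> real \<times> real \<times> real" where
  "flow_field P M y X = (case X of (f, v, g, J) \<Rightarrow> (v, g, P f * clamp_abs (M y) J, y * v - f))"

lemma norm_quad_le:
  "norm (a, b, c, d) \<le> \<bar>a\<bar> + \<bar>b\<bar> + \<bar>c\<bar> + \<bar>d\<bar>" for a b c d :: real
proof -
  have "norm (a, b, c, d) \<le> norm a + norm (b, c, d)" by (rule norm_Pair_le)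
  also have "norm (b, c, d) \<le> norm b + norm (c, d)" by (rule norm_Pair_le)
  also have "norm (c, d) \<le> norm c + norm d" by (rule norm_Pair_le)
  finally show ?thesis by simp
qed

lemma norm_quad_ge:
  fixes a b c d :: real
  shows "\<bar>a\<bar> \<le> norm (a, b, c, d)" "\<bar>b\<bar> \<le> norm (a, b, c, d)"
    "\<bar>c\<bar> \<le> norm (a, b, c, d)" "\<bar>d\<bar> \<le> norm (a, b, c, d)"
proof -
  have *: "norm (b, c, d) \<le> norm (a, b, c, d)" by (rule norm_snd_le)
  have **: "norm (c, d) \<le> norm (b, c, d)" by (rule norm_snd_le)
  show "\<bar>a\<bar> \<le> norm (a, b, c, d)" using norm_fst_le[of a "(b, c, d)"] by simp
  show "\<bar>b\<bar> \<le> norm (a, b, c, d)" using norm_fst_le[of b "(c, d)"] * by simp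
  show "\<bar>c\<bar> \<le> norm (a, b, c, d)" using norm_fst_le[of c d] * ** by simp
  show "\<bar>d\<bar> \<le> norm (a, b, c, d)" using norm_snd_le[of d c] * ** by simp
qed

lemma quad_vector_derivD:
  fixes f v g J :: "real \<Rightarrow> real"
  assumes "((\<lambda>y. (f y, v y, g y, J y)) has_vector_derivative (a, b, c, d)) F"
  shows "(f has_real_derivative a) F" "(v has_real_derivative b) F"
    "(g has_real_derivative c) F" "(J has_real_derivative d) F"
proof -
  note s = bounded_linear.has_vector_derivative[OF bounded_linear_snd]
    and p = bounded_linear.has_vector_derivative[OF bounded_linear_fst]
  show "(f has_real_derivative a) F"
    using p[OF assms] by (simp add: has_real_derivative_iff_has_vector_derivative)
  show "(v has_real_derivative b) F"
    using p[OF s[OF assms]] by (simp add: has_real_derivative_iff_has_vector_derivative)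
  show "(g has_real_derivative c) F"
    using p[OF s[OF s[OF assms]]] by (simp add: has_real_derivative_iff_has_vector_derivative)
  show "(J has_real_derivative d) F"
    using s[OF s[OF s[OF assms]]] by (simp add: has_real_derivative_iff_has_vector_derivative)
qed

text \<open>Clamping \<open>J\<close> makes the vector field globally Lipschitz; by Gronwall's inequality the clamp is
  never active for parameters in \<open>{-1..40}\<close>.\<close>
lemma flow_family:
  fixes P :: "real \<Rightarrow> real"
  assumes P: "\<And>x. 0 < P x" "\<And>x. P x \<le> 16" "\<And>x y. \<bar>P x - P y\<bar> \<le> 128 * \<bar>x - y\<bar>"
  shows "\<exists>f v g J :: real \<Rightarrow> real \<Rightarrow> real. \<forall>k\<in>{-1..40}.
     f k 0 = 1 \<and> v k 0 = 0 \<and> g k 0 = k \<and> J k 0 = 0 \<and>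
     (\<forall>y\<ge>0. (f k has_real_derivative v k y) (at y within {0..}) \<and>
        (v k has_real_derivative g k y) (at y within {0..}) \<and>
        (g k has_real_derivative P (f k y) * J k y) (at y within {0..}) \<and>
        (J k has_real_derivative y * v k y - f k y) (at y within {0..}) \<and>
        continuous_on {-1..40} (\<lambda>k. f k y) \<and> continuous_on {-1..40} (\<lambda>k. v k y) \<and>
        continuous_on {-1..40} (\<lambda>k. g k y) \<and> continuous_on {-1..40} (\<lambda>k. J k y))"
proof -
  \<comment> \<open>The exponent is the primitive of the growth rate \<open>19 + y\<close> found in
    \<open>bound\<close>, to which \<open>f\<close>, \<open>v\<close>, \<open>g\<close> contribute 1
    each, the mobility 16, and the product \<open>y * v\<close> the summand \<open>y\<close>. The
    factor 50 exceeds the norm of every initial value \<open>(1, 0, k, 0)\<close>.\<close>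
  define M where "M y = 50 * exp (19 * y + y\<^sup>2 / 2)" for y :: real
  define L where "L y = 19 + y + 128 * M y" for y :: real
  define V where "V = flow_field P M"
  have M: "0 \<le> M y" for y by (simp add: M_def)
  have contM: "continuous_on A M" for A unfolding M_def by (intro continuous_intros) auto
  have contP: "continuous_on A P" for A
  proof -
    have "128-lipschitz_on A P"
      by (rule lipschitz_onI) (use P(3) in \<open>auto simp: dist_real_def\<close>)
    then show ?thesis by (rule lipschitz_on_continuous_on)
  qed
  have contV: "continuous_on ({0..} \<times> UNIV) (\<lambda>(s, x). V s x)"
  proof -
    have eq: "(\<lambda>(s, x). V s x) = (\<lambda>z. (fst (snd (snd z)), fst (snd (snd (snd z))),
        P (fst (snd z)) * max (- M (fst z)) (min (M (fst z)) (snd (snd (snd (snd z))))),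
        fst z * fst (snd (snd z)) - fst (snd z)))"
      by (auto simp: fun_eq_iff V_def flow_field_def clamp_abs_def split: prod.splits)
    show ?thesis unfolding eq
      by (intro continuous_intros continuous_on_compose2[OF contP[of UNIV]]
          continuous_on_compose2[OF contM[of UNIV]]) auto
  qed
  \<comment> \<open>Clamping can only decrease \<open>\<bar>J\<bar>\<close>, so this rate does not
    contain \<open>M\<close>. Hence the bound it implies for solutions can itself be taken as the
    clamping level, without circularity.\<close>
  have bound: "norm (V s X) \<le> (19 + s) * norm X" if "0 \<le> s" for s X
  proof -
    obtain f v g J where X: "X = (f, v, g, J)" by (metis prod.exhaust)
    have "\<bar>P f * clamp_abs (M s) J\<bar> \<le> 16 * \<bar>J\<bar>"
      unfolding abs_mult using P(1)[of f] P(2)[of f] clamp_abs_bounds(3)[OF M]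
      by (intro mult_mono) auto
    moreover have "\<bar>s * v - f\<bar> \<le> s * \<bar>v\<bar> + \<bar>f\<bar>"
      using abs_triangle_ineq4[of "s * v" f] that by (simp add: abs_mult)
    moreover have "s * \<bar>v\<bar> \<le> s * norm X"
      unfolding X by (intro mult_left_mono norm_quad_ge that)
    moreover have "norm (V s X) \<le> \<bar>v\<bar> + \<bar>g\<bar> + \<bar>P f * clamp_abs (M s) J\<bar> + \<bar>s * v - f\<bar>"
      unfolding X V_def flow_field_def using norm_quad_le by auto
    ultimately show ?thesis
      using norm_quad_ge[where a=f and b=v and c=g and d=J] unfolding X[symmetric] by (simp add: algebra_simps)
  qed
  \<comment> \<open>The Lipschitz rate, in contrast, contains \<open>M\<close>: the variation of
    \<open>P\<close> is multiplied by the clamped \<open>J\<close>.\<close>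
  have lip: "norm (V s X - V s X') \<le> L s * norm (X - X')" if "0 \<le> s" for s X X'
  proof -
    obtain f v g J where X: "X = (f, v, g, J)" by (metis prod.exhaust)
    obtain f' v' g' J' where X': "X' = (f', v', g', J')" by (metis prod.exhaust)
    let ?c = "clamp_abs (M s)"
    have D: "X - X' = (f - f', v - v', g - g', J - J')" by (simp add: X X')
    have "P f * ?c J - P f' * ?c J' = P f * (?c J - ?c J') + (P f - P f') * ?c J'"
      by (simp add: algebra_simps)
    then have "\<bar>P f * ?c J - P f' * ?c J'\<bar> \<le> \<bar>P f\<bar> * \<bar>?c J - ?c J'\<bar> + \<bar>P f - P f'\<bar> * \<bar>?c J'\<bar>"
      by (metis abs_mult abs_triangle_ineq)
    also have "\<dots> \<le> 16 * \<bar>J - J'\<bar> + (128 * \<bar>f - f'\<bar>) * M s"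
      using P(1)[of f] P(2)[of f] clamp_abs_bounds[OF M] P(3)[of f f']
      by (intro add_mono mult_mono) auto
    also have "\<dots> \<le> 16 * norm (X - X') + 128 * M s * norm (X - X')"
      using mult_left_mono[OF norm_quad_ge(1)[of "f - f'" "v - v'" "g - g'" "J - J'"], of "128 * M s"]
        M[of s] norm_quad_ge(4)[of "J - J'" "f - f'" "v - v'" "g - g'"] unfolding D
      by (simp add: algebra_simps)
    finally have 1: "\<bar>P f * ?c J - P f' * ?c J'\<bar> \<le> 16 * norm (X - X') + 128 * M s * norm (X - X')" .
    have "(s * v - f) - (s * v' - f') = s * (v - v') - (f - f')" by (simp add: algebra_simps)
    then have "\<bar>(s * v - f) - (s * v' - f')\<bar> \<le> s * \<bar>v - v'\<bar> + \<bar>f - f'\<bar>"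
      using abs_triangle_ineq4[of "s * (v - v')" "f - f'"] that by (simp add: abs_mult)
    moreover have "s * \<bar>v - v'\<bar> \<le> s * norm (X - X')"
      unfolding D by (intro mult_left_mono norm_quad_ge that)
    ultimately have 2: "\<bar>(s * v - f) - (s * v' - f')\<bar> \<le> s * norm (X - X') + norm (X - X')"
      using norm_quad_ge(1)[of "f - f'" "v - v'" "g - g'" "J - J'"] unfolding D by linarith
    have "norm (V s X - V s X') \<le> \<bar>v - v'\<bar> + \<bar>g - g'\<bar> + \<bar>P f * ?c J - P f' * ?c J'\<bar>
        + \<bar>(s * v - f) - (s * v' - f')\<bar>"
      unfolding X X' V_def flow_field_def using norm_quad_le by auto
    then show ?thesis
      using 1 2 norm_quad_ge[where a="f - f'" and b="v - v'" and c="g - g'" and d="J - J'"]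
      unfolding D[symmetric]
      by (simp add: algebra_simps L_def)
  qed
  have contL: "continuous_on {0..} L"
    unfolding L_def by (intro continuous_intros contM)
  obtain B where B: "B 0 = 0" "\<And>y. 0 \<le> y \<Longrightarrow> (B has_real_derivative L y) (at y within {0..})"
    using that[of "\<lambda>y. integral {0..y} L"] integral_half_line_deriv[OF contL] by simp
  have L0: "0 \<le> L s" if "0 \<le> s" for s using that M[of s] by (simp add: L_def)
  have V0: "V s 0 = 0" if "0 \<le> s" for s
    using bound[OF that, of 0] by simp
  have "\<exists>X. X 0 = (1, 0, k, 0) \<and> (\<forall>y\<ge>0. (X has_vector_derivative V y (X y)) (at y within {0..}))"
    for k :: real
    by (rule global_ode[OF contV lip B(2) B(1) contL L0 V0]) auto
  then obtain X where X: "\<And>k. X k 0 = (1, 0, k, 0)"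
    "\<And>k y. 0 \<le> y \<Longrightarrow> (X k has_vector_derivative V y (X k y)) (at y within {0..})"
    by metis
  define f where "f k y = fst (X k y)" for k y
  define v where "v k y = fst (snd (X k y))" for k y
  define g where "g k y = fst (snd (snd (X k y)))" for k y
  define J where "J k y = snd (snd (snd (X k y)))" for k y
  have X_eq: "X k = (\<lambda>y. (f k y, v k y, g k y, J k y))" for k
    by (simp add: f_def v_def g_def J_def)
  have dep: "norm (X k y - X k' y) \<le> \<bar>k - k'\<bar> * exp (B y)" if "0 \<le> y" for k k' y
  proof -
    have "norm (X k y - X k' y) \<le> norm (X k 0 - X k' 0) * exp (B y)"
      by (rule gronwall_norm[where X = "\<lambda>y. X k y - X k' y", OF _ B(2) _ B(1) that])
         (auto intro: lip has_vector_derivative_diff X)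
    moreover have "norm (X k 0 - X k' 0) \<le> \<bar>k - k'\<bar>"
      using norm_quad_le[of 0 0 "k - k'" 0] by (simp add: X)
    ultimately show ?thesis
      by (meson exp_ge_zero mult_right_mono order_trans)
  qed
  have contX: "continuous_on {-1..40} (\<lambda>k. X k y)" if "0 \<le> y" for y
  proof -
    have "(exp (B y))-lipschitz_on {-1..40} (\<lambda>k. X k y)"
      by (rule lipschitz_onI) (use dep[OF that] in \<open>auto simp: dist_norm mult.commute\<close>)
    then show ?thesis by (rule lipschitz_on_continuous_on)
  qed
  have apriori: "\<bar>J k y\<bar> \<le> M y" if "0 \<le> y" "k \<in> {-1..40}" for k y
  proof -
    have "norm (X k y) \<le> norm (X k 0) * exp (19 * y + y\<^sup>2 / 2)"
      by (rule gronwall_norm[OF X(2) _ bound])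
         (use that in \<open>auto intro!: derivative_eq_intros\<close>)
    also have "norm (X k 0) \<le> 50"
      using norm_quad_le[of 1 0 k 0] that by (auto simp: X)
    finally have "norm (X k y) \<le> M y" by (simp add: M_def)
    then show ?thesis using norm_quad_ge(4)[of "J k y" "f k y" "v k y" "g k y"] by (simp add: X_eq)
  qed
  show ?thesis
  proof (intro exI ballI conjI allI impI)
    fix k :: real assume k: "k \<in> {-1..40}"
    show "f k 0 = 1" "v k 0 = 0" "g k 0 = k" "J k 0 = 0"
      by (simp_all add: f_def v_def g_def J_def X)
    fix y :: real assume y: "0 \<le> y"
    have "V y (X k y) = (v k y, g k y, P (f k y) * J k y, y * v k y - f k y)"
      unfolding V_def flow_field_def X_eq by (simp add: clamp_abs_bounds(4)[OF M apriori[OF y k]])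
    then have "((\<lambda>y. (f k y, v k y, g k y, J k y)) has_vector_derivative
        (v k y, g k y, P (f k y) * J k y, y * v k y - f k y)) (at y within {0..})"
      using X(2)[OF y, of k] by (simp add: X_eq)
    note D = quad_vector_derivD[OF this]
    show "(f k has_real_derivative v k y) (at y within {0..})"
      "(v k has_real_derivative g k y) (at y within {0..})"
      "(g k has_real_derivative P (f k y) * J k y) (at y within {0..})"
      "(J k has_real_derivative y * v k y - f k y) (at y within {0..})"
      by (rule D)+
    show "continuous_on {-1..40} (\<lambda>k. f k y)" "continuous_on {-1..40} (\<lambda>k. v k y)"
      "continuous_on {-1..40} (\<lambda>k. g k y)" "continuous_on {-1..40} (\<lambda>k. J k y)"
      unfolding f_def v_def g_def J_def by (intro continuous_intros contX[OF y])+
  qed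
qed

section \<open>Shooting\<close>

text \<open>Serves two purposes: the shooting sets are compact, and the continuity arguments below
  find the first point at which a positive quantity ceases to be positive.\<close>

lemma compact_sublevel:
  fixes h :: "real \<Rightarrow> real"
  assumes "continuous_on {a..b} h"
  shows "compact ({a..b} \<inter> h -` {..c})"
proof -
  have "closed ({a..b} \<inter> h -` {..c})"
    using assms by (intro continuous_closed_preimage) auto
  moreover have "bounded ({a..b} \<inter> h -` {..c})"
    by (rule bounded_subset[OF bounded_closed_interval[of a b]]) auto
  ultimately show ?thesis by (simp add: compact_eq_bounded_closed)
qed

text \<open>While \<open>g\<close> and \<open>w\<close> are positive, \<open>J\<close> increases
  because \<open>J' = w\<close>, and then \<open>g' = p J\<close> and \<open>w' = y g\<close> are
  nonnegative too. Positivity is assumed strictly before \<open>s\<close>, so that \<open>s\<close>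
  may be a first exit point.\<close>

lemma cone_step:
  fixes g J w p :: "real \<Rightarrow> real"
  assumes g: "\<And>y. 0 \<le> y \<Longrightarrow> (g has_real_derivative p y * J y) (at y within {0..})"
    and J: "\<And>y. 0 \<le> y \<Longrightarrow> (J has_real_derivative w y) (at y within {0..})"
    and w: "\<And>y. 0 \<le> y \<Longrightarrow> (w has_real_derivative y * g y) (at y within {0..})"
    and p: "\<And>y. 0 \<le> y \<Longrightarrow> 0 \<le> p y"
    and s: "0 \<le> y0" "y0 \<le> s" "0 \<le> J y0" "\<And>z. y0 \<le> z \<Longrightarrow> z < s \<Longrightarrow> 0 < g z \<and> 0 < w z"
  shows "g y0 \<le> g s \<and> w y0 \<le> w s \<and> J y0 \<le> J s"
proof -
  have Jm: "J y0 \<le> J z" if "y0 \<le> z" "z \<le> s" for z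
    by (rule mono_from_deriv[OF that(1) J]) (use s that in \<open>auto intro: less_imp_le\<close>)
  have Jn: "0 \<le> J z" if "y0 < z" "z < s" for z using Jm[of z] s(3) that by simp
  have "g y0 \<le> g s"
    by (rule mono_from_deriv[OF s(2) g])
       (use s in \<open>auto intro!: mult_nonneg_nonneg p Jn\<close>)
  moreover have "w y0 \<le> w s"
    by (rule mono_from_deriv[OF s(2) w])
       (use s in \<open>auto intro!: mult_nonneg_nonneg intro: less_imp_le\<close>)
  ultimately show ?thesis using Jm[of s] s by auto
qed

text \<open>At a first point where \<open>g\<close> or \<open>w\<close> fails to be positive,
  \<open>cone_step\<close> would still bound both from below by their positive initial
  values.\<close>

lemma positive_cone:
  fixes g J w p :: "real \<Rightarrow> real"
  assumes g: "\<And>y. 0 \<le> y \<Longrightarrow> (g has_real_derivative p y * J y) (at y within {0..})"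
    and J: "\<And>y. 0 \<le> y \<Longrightarrow> (J has_real_derivative w y) (at y within {0..})"
    and w: "\<And>y. 0 \<le> y \<Longrightarrow> (w has_real_derivative y * g y) (at y within {0..})"
    and p: "\<And>y. 0 \<le> y \<Longrightarrow> 0 \<le> p y"
    and y0: "0 \<le> y0" "0 < g y0" "0 \<le> J y0" "0 < w y0" "y0 \<le> y"
  shows "g y0 \<le> g y \<and> w y0 \<le> w y \<and> J y0 \<le> J y"
proof -
  note step = cone_step[OF g J w p y0(1) _ y0(3)]
  define S where "S = {y0..y} \<inter> (\<lambda>z. min (g z) (w z)) -` {..0}"
  have cg: "continuous_on {0..} g" and cw: "continuous_on {0..} w"
    by (rule DERIV_continuous_on, (rule g w, simp))+
  have "compact S"
    unfolding S_def
    by (intro compact_sublevel continuous_intros continuous_on_subset[OF cg]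
        continuous_on_subset[OF cw]) (use y0 in auto)
  have "S = {}"
  proof (rule ccontr)
    assume "S \<noteq> {}"
    then obtain s where s: "s \<in> S" "\<And>t. t \<in> S \<Longrightarrow> s \<le> t"
      using compact_attains_inf[OF \<open>compact S\<close>] by blast
    have "0 < g z \<and> 0 < w z" if "y0 \<le> z" "z < s" for z
    proof (rule ccontr)
      assume "\<not> ?thesis"
      then have "z \<in> S" using that s(1) by (auto simp: S_def min_def)
      then show False using s(2) that by fastforce
    qed
    then have "g y0 \<le> g s \<and> w y0 \<le> w s"
      using step[of s] s(1) by (auto simp: S_def)
    then show False using s(1) y0 by (auto simp: S_def min_def split: if_splits)
  qed
  then have "0 < g z \<and> 0 < w z" if "y0 \<le> z" "z \<le> y" for z
    using that by (auto simp: S_def min_def not_le split: if_splits)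
  then show ?thesis using step[of y] y0 by auto
qed

text \<open>The mobility factor \<open>p\<close> stands for \<open>f\<^sup>-\<^sup>m\<close>; it is left open because \<open>f\<close> is truncated from
  below until its positivity is known.\<close>
locale flow =
  fixes f v g J p :: "real \<Rightarrow> real" and k :: real
  assumes df: "\<And>y. 0 \<le> y \<Longrightarrow> (f has_real_derivative v y) (at y within {0..})"
    and dv: "\<And>y. 0 \<le> y \<Longrightarrow> (v has_real_derivative g y) (at y within {0..})"
    and dg: "\<And>y. 0 \<le> y \<Longrightarrow> (g has_real_derivative p y * J y) (at y within {0..})"
    and dJ: "\<And>y. 0 \<le> y \<Longrightarrow> (J has_real_derivative y * v y - f y) (at y within {0..})"
    and p_pos: "\<And>y. 0 \<le> y \<Longrightarrow> 0 < p y"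
    and init: "f 0 = 1" "v 0 = 0" "g 0 = k" "J 0 = 0"
begin

definition w where "w y = y * v y - f y"
definition E where "E y = g y * J y - (w y)\<^sup>2 / (2 * y)"
definition u where "u y = f y / y"

lemma dJw: "0 \<le> y \<Longrightarrow> (J has_real_derivative w y) (at y within {0..})"
  using dJ by (simp add: w_def)

lemma dw: "0 \<le> y \<Longrightarrow> (w has_real_derivative y * g y) (at y within {0..})"
  unfolding w_def[abs_def] by (auto intro!: derivative_eq_intros df dv)

lemma w0: "w 0 = -1" by (simp add: w_def init)

text \<open>The term \<open>g J' = w g\<close> cancels against the derivative of
  \<open>w^2 / (2 y)\<close>, because \<open>w' = y g\<close>; what remains is a sum of squares,
  whatever positive coefficient \<open>p\<close> is.\<close>

lemma dE:
  assumes "0 < y"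
  shows "(E has_real_derivative p y * (J y)\<^sup>2 + (w y)\<^sup>2 / (2 * y\<^sup>2)) (at y within {0..})"
proof -
  have "(E has_real_derivative (p y * J y * J y + w y * g y)
      - ((2 * w y * (y * g y)) * (2 * y) - (w y)\<^sup>2 * 2) / (2 * y)\<^sup>2) (at y within {0..})"
    unfolding E_def[abs_def] using assms
    by (auto intro!: derivative_eq_intros dg dJw dw simp: power2_eq_square)
  moreover have "(p y * J y * J y + w y * g y) - ((2 * w y * (y * g y)) * (2 * y) - (w y)\<^sup>2 * 2) / (2 * y)\<^sup>2
      = p y * (J y)\<^sup>2 + (w y)\<^sup>2 / (2 * y\<^sup>2)"
    using assms by (simp add: divide_simps) (simp add: algebra_simps power2_eq_square)
  ultimately show ?thesis by simp
qed

lemma du: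
  assumes "0 < y"
  shows "(u has_real_derivative w y / y\<^sup>2) (at y within {0..})"
proof -
  have "(u has_real_derivative (v y * y - f y) / (y * y)) (at y within {0..})"
    unfolding u_def[abs_def] using assms
    by (auto intro!: derivative_eq_intros df)
  then show ?thesis by (simp add: w_def power2_eq_square mult.commute)
qed

lemma E_mono:
  assumes "0 < x" "x \<le> y"
  shows "E x \<le> E y"
  by (rule mono_from_deriv[OF assms(2) dE])
     (use assms in \<open>auto simp: less_imp_le[OF p_pos]\<close>)

text \<open>For a given coefficient \<open>p\<close> the equations for \<open>(g, J, w)\<close> are
  linear, so \<open>positive_cone\<close> applies to the negated triple.\<close>

lemma neg_cone:
  assumes "0 \<le> y0" "g y0 < 0" "J y0 \<le> 0" "w y0 < 0" "y0 \<le> y"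
  shows "g y \<le> g y0 \<and> w y \<le> w y0 \<and> J y \<le> J y0"
proof -
  have 1: "((\<lambda>y. - g y) has_real_derivative p y * (- J y)) (at y within {0..})" if "0 \<le> y" for y
    using DERIV_minus[OF dg[OF that]] by simp
  have 2: "((\<lambda>y. - J y) has_real_derivative - w y) (at y within {0..})" if "0 \<le> y" for y
    using DERIV_minus[OF dJw[OF that]] by simp
  have 3: "((\<lambda>y. - w y) has_real_derivative y * (- g y)) (at y within {0..})" if "0 \<le> y" for y
    using DERIV_minus[OF dw[OF that]] by simp
  show ?thesis
    using positive_cone[OF 1 2 3 less_imp_le[OF p_pos], of y0 y] assms by simp
qed

lemma pos_cone:
  assumes "0 \<le> y0" "0 < g y0" "0 \<le> J y0" "0 < w y0" "y0 \<le> y"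
  shows "g y0 \<le> g y \<and> w y0 \<le> w y \<and> J y0 \<le> J y"
  by (rule positive_cone[OF dg dJw dw less_imp_le[OF p_pos] assms])

lemma cont: "continuous_on {0..} f" "continuous_on {0..} v" "continuous_on {0..} g"
  "continuous_on {0..} J" "continuous_on {0..} w"
  by (rule DERIV_continuous_on, (rule df dv dg dJw dw, simp))+

text \<open>A bootstrap on \<open>[0, 1]\<close>: as long as \<open>g > 20\<close>, two integrations
  give \<open>w \<ge> -1 + 10 y^2\<close> and \<open>J \<ge> -y + 3 y^3 \<ge> -1\<close>. With
  \<open>p \<le> 16\<close> the curvature then loses at most 16 and stays above
  \<open>40 - 16 = 24\<close>, so it never comes down to 20. At \<open>y = 1\<close> all of
  \<open>g\<close>, \<open>J\<close>, \<open>w\<close> are positive and the cone takes over.\<close>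

lemma large_curvature:
  assumes p16: "\<And>y. 0 \<le> y \<Longrightarrow> p y \<le> 16" and k: "k = 40" and y: "1 \<le> y"
  shows "0 < J y"
proof -
  have step: "24 \<le> g s \<and> -1 + 10 * s\<^sup>2 \<le> w s \<and> - s + 3 * s ^ 3 \<le> J s"
    if s: "0 \<le> s" "s \<le> 1" "\<And>z. 0 \<le> z \<Longrightarrow> z < s \<Longrightarrow> 20 < g z" for s
  proof -
    have wz: "-1 + 10 * z\<^sup>2 \<le> w z" if "0 \<le> z" "z \<le> s" for z
    proof -
      have "w 0 - 10 * 0\<^sup>2 \<le> w z - 10 * z\<^sup>2"
        by (rule mono_from_deriv[OF that(1), where F' = "\<lambda>x. x * g x - 20 * x" and T = "{0..}"])
           (use s that in \<open>auto intro!: derivative_eq_intros dw mult_left_mono intro: less_imp_le simp: mult.commute\<close>)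
      then show ?thesis by (simp add: w0)
    qed
    have Jz: "- z + 3 * z ^ 3 \<le> J z" if "0 \<le> z" "z \<le> s" for z
    proof -
      have "J 0 + 0 - 3 * 0 ^ 3 \<le> J z + z - 3 * z ^ 3"
      proof (rule mono_from_deriv[OF that(1), where F' = "\<lambda>x. w x + 1 - 9 * x\<^sup>2" and T = "{0..}"])
        fix x assume "0 < x" "x < z"
        then show "0 \<le> w x + 1 - 9 * x\<^sup>2" using wz[of x] that zero_le_power2[of x] by (smt (verit))
      qed (auto intro!: derivative_eq_intros dJw)
      then show ?thesis by (simp add: init)
    qed
    have "g 0 + 16 * 0 \<le> g s + 16 * s"
    proof (rule mono_from_deriv[OF s(1), where F' = "\<lambda>x. p x * J x + 16" and T = "{0..}"])
      fix x assume x: "0 < x" "x < s"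
      have "0 \<le> x ^ 3" using x by simp
      then have "-1 \<le> J x" using Jz[of x] x s by linarith
      then have "p x * (-1) \<le> p x * J x" using p_pos[of x] x by (intro mult_left_mono) auto
      then show "0 \<le> p x * J x + 16" using p16[of x] x by simp
    qed (auto intro!: derivative_eq_intros dg)
    then have "24 \<le> g s" using init k s by simp
    then show ?thesis using wz[of s] Jz[of s] s by auto
  qed
  define S where "S = {0..1} \<inter> g -` {..20}"
  have "compact S" unfolding S_def
    by (intro compact_sublevel continuous_on_subset[OF cont(3)]) auto
  have "S = {}"
  proof (rule ccontr)
    assume "S \<noteq> {}"
    then obtain s where s: "s \<in> S" "\<And>t. t \<in> S \<Longrightarrow> s \<le> t"
      using compact_attains_inf[OF \<open>compact S\<close>] by blast
    have "24 \<le> g s"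
    proof (rule conjunct1[OF step])
      fix z assume z: "0 \<le> z" "z < s"
      then have "z \<notin> S" using s(2) by force
      then show "20 < g z" using z s(1) by (auto simp: S_def)
    qed (use s in \<open>auto simp: S_def\<close>)
    then show False using s(1) by (auto simp: S_def)
  qed
  then have "24 \<le> g 1 \<and> -1 + 10 * 1\<^sup>2 \<le> w 1 \<and> - 1 + 3 * 1 ^ 3 \<le> J 1"
    by (intro step) (auto simp: S_def disjoint_iff not_le)
  then show ?thesis using pos_cone[of 1 y] y by auto
qed

end

lemma shooting:
  fixes P :: "real \<Rightarrow> real"
  assumes P: "\<And>x. 0 < P x" "\<And>x. P x \<le> 16" "\<And>x y. \<bar>P x - P y\<bar> \<le> 128 * \<bar>x - y\<bar>"
  shows "\<exists>f v g J k. flow f v g J (\<lambda>y. P (f y)) k \<and> (\<forall>y>0. flow.E f v g J y \<le> 0)"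
proof -
  obtain f v g J :: "real \<Rightarrow> real \<Rightarrow> real" where fam: "\<forall>k\<in>{-1..40}.
     f k 0 = 1 \<and> v k 0 = 0 \<and> g k 0 = k \<and> J k 0 = 0 \<and>
     (\<forall>y\<ge>0. (f k has_real_derivative v k y) (at y within {0..}) \<and>
        (v k has_real_derivative g k y) (at y within {0..}) \<and>
        (g k has_real_derivative P (f k y) * J k y) (at y within {0..}) \<and>
        (J k has_real_derivative y * v k y - f k y) (at y within {0..}) \<and>
        continuous_on {-1..40} (\<lambda>k. f k y) \<and> continuous_on {-1..40} (\<lambda>k. v k y) \<and>
        continuous_on {-1..40} (\<lambda>k. g k y) \<and> continuous_on {-1..40} (\<lambda>k. J k y))"
    using flow_family[OF P] by blast
  have fl: "flow (f k) (v k) (g k) (J k) (\<lambda>y. P (f k y)) k" if "k \<in> {-1..40}" for k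
    using bspec[OF fam that] P by (intro flow.intro) simp_all
  have cn: "continuous_on {-1..40} (\<lambda>k. f k y)" "continuous_on {-1..40} (\<lambda>k. v k y)"
    "continuous_on {-1..40} (\<lambda>k. g k y)" "continuous_on {-1..40} (\<lambda>k. J k y)" if "0 \<le> y" for y
    using bspec[OF fam, of 0] that by simp_all
  define En where "En k y = flow.E (f k) (v k) (g k) (J k) y" for k y
  have En_eq: "En k y = g k y * J k y - (y * v k y - f k y)\<^sup>2 / (2 * y)" if "k \<in> {-1..40}" for k y
    unfolding En_def flow.E_def[OF fl[OF that]] flow.w_def[OF fl[OF that]] ..
  \<comment> \<open>The shift by 1 keeps the evaluation point positive, where \<open>E\<close> is
    defined and monotone.\<close>
  define S where "S n = {-1..40} \<inter> (\<lambda>k. En k (real n + 1)) -` {..0}" for n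
  have "\<Inter> (range S) \<noteq> {}"
  proof (rule compact_nest)
    fix n :: nat
    have "continuous_on {-1..40} (\<lambda>k. En k (real n + 1))"
      by (subst continuous_on_cong[OF refl En_eq])
         (auto intro!: continuous_intros cn simp: add_eq_0_iff)
    then show "compact (S n)"
      unfolding S_def by (rule compact_sublevel)
    \<comment> \<open>At a zero of \<open>J\<close> the energy is \<open>- w^2 / (2 y)\<close>,
      hence nonpositive. The parameter \<open>-1\<close> lies in the negative cone from the start,
      since \<open>w 0 = -1\<close>; the parameter 40 is covered by
      \<open>large_curvature\<close>.\<close>
    have "\<exists>k\<ge>-1. k \<le> 40 \<and> J k (real n + 1) = 0"
    proof (rule IVT')
      interpret flow "f (-1)" "v (-1)" "g (-1)" "J (-1)" "\<lambda>y. P (f (-1) y)" "-1"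
        by (rule fl) simp
      show "J (-1) (real n + 1) \<le> 0" using neg_cone[of 0 "real n + 1"] init w0 by simp
    next
      interpret flow "f 40" "v 40" "g 40" "J 40" "\<lambda>y. P (f 40 y)" "40"
        by (rule fl) simp
      show "0 \<le> J 40 (real n + 1)" using large_curvature[of "real n + 1"] P by auto
    qed (use cn in auto)
    then obtain k where k: "-1 \<le> k" "k \<le> 40" "J k (real n + 1) = 0" by blast
    then have "En k (real n + 1) \<le> 0" by (simp add: En_eq)
    then have "k \<in> S n" using k by (simp add: S_def)
    then show "S n \<noteq> {}" by blast
  next
    fix n m :: nat assume "n \<le> m"
    then show "S m \<subseteq> S n"
    proof (intro subsetI)
      fix k assume k: "k \<in> S m"
      then have "En k (real n + 1) \<le> En k (real m + 1)"
        unfolding En_def using \<open>n \<le> m\<close> by (intro flow.E_mono[OF fl]) (auto simp: S_def)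
      then show "k \<in> S n" using k by (simp add: S_def)
    qed
  qed
  then obtain k where k: "\<And>n. k \<in> S n" by blast
  then have k1: "k \<in> {-1..40}" by (auto simp: S_def)
  have "En k y \<le> 0" if "0 < y" for y
  proof -
    obtain n :: nat where "y \<le> real n" using real_arch_simple by blast
    then have "En k y \<le> En k (real n + 1)"
      unfolding En_def using that by (intro flow.E_mono[OF fl[OF k1]]) auto
    also have "\<dots> \<le> 0" using k[of n] by (simp add: S_def)
    finally show ?thesis .
  qed
  then show ?thesis using fl[OF k1] unfolding En_def by blast
qed

section \<open>Strict monotonicity, limits with a rate, and weighted inequalities\<close>

lemma strict_mono_from_deriv:
  fixes F :: "real \<Rightarrow> real"
  assumes ab: "a < b"
    and d: "\<And>y. a \<le> y \<Longrightarrow> y \<le> b \<Longrightarrow> (F has_real_derivative F' y) (at y within {0..})"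
    and a: "0 \<le> a"
    and nn: "\<And>y. a < y \<Longrightarrow> y < b \<Longrightarrow> 0 < F' y"
  shows "F a < F b"
proof (rule DERIV_pos_imp_increasing_open[OF ab])
  fix y assume y: "a < y" "y < b"
  then have "(F has_real_derivative F' y) (at y)"
    using d[of y] a at_within_pos[of y] by simp
  then show "\<exists>z. DERIV F y :> z \<and> 0 < z" using nn[OF y] by blast
next
  show "continuous_on {a..b} F"
    by (rule DERIV_continuous_on[where D=F'], rule DERIV_subset[OF d]) (use a in auto)
qed

text \<open>Sampling along \<open>x0 + n\<close> gives a Cauchy sequence; letting the larger
  argument run to infinity in the hypothesis turns \<open>\<phi>\<close> into a rate of
  convergence.\<close>

lemma tendsto_at_top_with_rate:
  fixes u :: "real \<Rightarrow> 'a::banach" and \<phi> :: "real \<Rightarrow> real"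
  assumes \<phi>: "(\<phi> \<longlongrightarrow> 0) at_top"
    and le: "\<And>x y. x0 \<le> x \<Longrightarrow> x \<le> y \<Longrightarrow> norm (u y - u x) \<le> \<phi> x"
  shows "\<exists>a. (u \<longlongrightarrow> a) at_top \<and> (\<forall>x\<ge>x0. norm (u x - a) \<le> \<phi> x)"
proof -
  define X where "X n = u (x0 + real n)" for n
  have f: "filterlim (\<lambda>n. x0 + real n) at_top sequentially"
    by (intro filterlim_tendsto_add_at_top[OF tendsto_const] filterlim_real_sequentially)
  have "Cauchy X"
  proof (rule CauchyI')
    fix e :: real assume "0 < e"
    then have "\<forall>\<^sub>F n in sequentially. \<phi> (x0 + real n) < e"
      using order_tendstoD(2)[OF filterlim_compose[OF \<phi> f]] by simp
    then obtain N where N: "\<phi> (x0 + real N) < e" "\<And>n. N \<le> n \<Longrightarrow> \<phi> (x0 + real n) < e"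
      by (auto simp: eventually_sequentially)
    show "\<exists>M. \<forall>m\<ge>M. \<forall>n>m. dist (X m) (X n) < e"
    proof (intro exI[of _ N] allI impI)
      fix m n assume "N \<le> m" "m < n"
      then show "dist (X m) (X n) < e"
        using le[of "x0 + real m" "x0 + real n"] N(2)[of m] unfolding X_def
        by (subst dist_commute) (simp add: dist_norm)
    qed
  qed
  then obtain a where a: "X \<longlonglongrightarrow> a" using Cauchy_convergent_iff convergent_def by blast
  have rate: "norm (u x - a) \<le> \<phi> x" if "x0 \<le> x" for x
  proof (rule tendsto_upperbound)
    show "((\<lambda>n. norm (u x - X n)) \<longlongrightarrow> norm (u x - a)) sequentially"
      by (intro tendsto_intros a)
    have "\<forall>\<^sub>F n in sequentially. x \<le> x0 + real n"
      using f by (simp add: filterlim_at_top)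
    then show "\<forall>\<^sub>F n in sequentially. norm (u x - X n) \<le> \<phi> x"
      by eventually_elim (metis X_def le norm_minus_commute that)
  qed simp
  have "((\<lambda>x. u x - a) \<longlongrightarrow> 0) at_top"
    by (rule Lim_null_comparison[OF _ \<phi>])
       (use rate in \<open>auto simp: eventually_at_top_linorder\<close>)
  then show ?thesis using rate by (auto simp: LIM_zero_iff)
qed

text \<open>Young's inequality. The weight \<open>l\<close> distributes an error between the energy
  \<open>E\<close> and an explicit power of \<open>y\<close>.\<close>

lemma abs_le_weighted:
  fixes x c l :: real
  assumes "0 < l"
  shows "\<bar>x\<bar> * c \<le> l * x\<^sup>2 / 2 + c\<^sup>2 / (2 * l)"
proof -
  have "0 \<le> (l * \<bar>x\<bar> - c)\<^sup>2 / (2 * l)" using assms by simp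
  also have "\<dots> = l * x\<^sup>2 / 2 + c\<^sup>2 / (2 * l) - \<bar>x\<bar> * c"
    using assms by (simp add: field_simps power2_eq_square)
  finally show ?thesis by simp
qed

text \<open>Used with \<open>A = p J^2\<close>, the part of \<open>E'\<close> that is left over when
  the other part has been spent in Young's inequality.\<close>

lemma add_nonneg_absorb:
  fixes x A B C l :: real
  assumes "\<bar>x\<bar> \<le> l * B + C" "0 \<le> l" "0 \<le> A"
  shows "0 \<le> l * (A + B) + C + x"
proof -
  have "0 \<le> l * A" using assms by simp
  then show ?thesis using assms(1) by (simp add: ring_distribs abs_le_iff)
qed

context flow
begin

lemma start:
  obtains d where "0 < d" "\<And>y. 0 \<le> y \<Longrightarrow> y \<le> d \<Longrightarrow> w y < 0" "\<And>y. 0 < y \<Longrightarrow> y \<le> d \<Longrightarrow> J y < 0"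
proof -
  have "continuous (at 0 within {0..}) w" using cont(5) by (simp add: continuous_on_eq_continuous_within)
  then have "(w \<longlongrightarrow> -1) (at 0 within {0..})" by (simp add: continuous_within w0)
  then have "\<forall>\<^sub>F y in at 0 within {0..}. w y < 0" by (rule order_tendstoD) simp
  then obtain e where e: "0 < e" "\<And>y. y \<in> {0..} \<Longrightarrow> y \<noteq> 0 \<Longrightarrow> dist y 0 < e \<Longrightarrow> w y < 0"
    by (auto simp: eventually_at)
  have neg: "w y < 0" if "0 \<le> y" "y \<le> e / 2" for y
    using e(1) e(2)[of y] that w0 by (cases "y = 0") (auto simp: dist_real_def)
  moreover have "J y < 0" if "0 < y" "y \<le> e / 2" for y
  proof -
    have "- J 0 < - J y"
      by (rule strict_mono_from_deriv[OF that(1) DERIV_minus[OF dJw]]) (use neg that in auto)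
    then show ?thesis by (simp add: init)
  qed
  ultimately show ?thesis using that[of "e / 2"] e(1) by auto
qed

text \<open>The constant 1/2 completes the square: \<open>(f - 1/2) / y\<close> has derivative
  \<open>(w + 1/2) / y^2\<close>, which turns the summand \<open>w^2 / (2 y^2)\<close> of
  \<open>E'\<close> into \<open>(w + 1)^2 / (2 y^2)\<close>. It also cancels the singularity of
  \<open>E\<close> at 0, where \<open>w^2 / 2\<close> equals 1/2.\<close>

definition Q where "Q y = E y + (f y - 1 / 2) / y"

lemma dQ:
  assumes "0 < y"
  shows "(Q has_real_derivative p y * (J y)\<^sup>2 + (w y + 1)\<^sup>2 / (2 * y\<^sup>2)) (at y within {0..})"
proof -
  have "(Q has_real_derivative (p y * (J y)\<^sup>2 + (w y)\<^sup>2 / (2 * y\<^sup>2)) +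
      (v y * y - (f y - 1 / 2)) / (y * y)) (at y within {0..})"
    unfolding Q_def[abs_def] using assms
    by (auto intro!: derivative_eq_intros dE df)
  moreover have "(p y * (J y)\<^sup>2 + (w y)\<^sup>2 / (2 * y\<^sup>2)) + (v y * y - (f y - 1 / 2)) / (y * y)
     = p y * (J y)\<^sup>2 + (w y + 1)\<^sup>2 / (2 * y\<^sup>2)"
    using assms by (simp add: divide_simps w_def) (simp add: algebra_simps power2_eq_square)
  ultimately show ?thesis by simp
qed

lemma Q_mono:
  assumes "0 < x" "x \<le> y"
  shows "Q x \<le> Q y"
  by (rule mono_from_deriv[OF assms(2) dQ])
     (use assms in \<open>auto simp: less_imp_le[OF p_pos]\<close>)

text \<open>\<open>Q\<close> is \<open>g J\<close> plus the difference quotient at 0 of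
  \<open>f - w^2 / 2\<close>, a function with derivative 0 there because \<open>v 0 = 0\<close> and
  \<open>w' = y g\<close>.\<close>

lemma Q_tendsto_0: "(Q \<longlongrightarrow> 0) (at_right 0)"
proof -
  have "((\<lambda>y. f y - (w y)\<^sup>2 / 2) has_real_derivative 0) (at 0 within {0..})"
    by (rule derivative_eq_intros df dw refl | simp add: init)+
  then have 1: "((\<lambda>y. (f y - (w y)\<^sup>2 / 2 - 1 / 2) / y) \<longlongrightarrow> 0) (at_right 0)"
    by (auto simp: has_field_derivative_iff init w0 intro: tendsto_within_subset)
  have "((\<lambda>y. g y * J y) \<longlongrightarrow> g 0 * J 0) (at 0 within {0..})"
    using cont(3,4) by (intro tendsto_intros) (auto simp: continuous_on)
  then have 2: "((\<lambda>y. g y * J y) \<longlongrightarrow> 0) (at_right 0)"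
    by (auto simp: init intro: tendsto_within_subset)
  have "\<forall>\<^sub>F y in at_right 0. g y * J y + (f y - (w y)\<^sup>2 / 2 - 1 / 2) / y = Q y"
    by (auto simp: eventually_at_filter Q_def E_def field_simps intro!: always_eventually)
  then show ?thesis
    using tendsto_add[OF 2 1] by (auto intro: Lim_transform_eventually)
qed

lemma Q_nonneg:
  assumes "0 < y" shows "0 \<le> Q y"
proof (rule tendsto_upperbound[OF Q_tendsto_0])
  have "\<forall>\<^sub>F x in at_right 0. x \<in> {0<..<y}" by (rule eventually_at_right_real[OF assms])
  then show "\<forall>\<^sub>F x in at_right 0. Q x \<le> Q y"
    by eventually_elim (auto intro: Q_mono)
qed simp

text \<open>\<open>J\<close> is strictly negative just to the right of 0, so the dissipation
  \<open>p J^2\<close> makes \<open>Q\<close> increase strictly there. This strictness is what later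
  keeps the slope away from 0.\<close>

lemma Q1_pos: "0 < Q 1"
proof -
  obtain d where d: "0 < d" "\<And>y. 0 < y \<Longrightarrow> y \<le> d \<Longrightarrow> J y < 0" using start by metis
  define c where "c = min d 1"
  have c: "0 < c" "c \<le> d" "c \<le> 1" using d(1) by (auto simp: c_def)
  have "Q (c / 2) < Q c"
  proof (rule strict_mono_from_deriv[OF _ dQ])
    fix y assume y: "c / 2 < y" "y < c"
    then have "0 < p y * (J y)\<^sup>2" using d(2)[of y] c p_pos[of y] by simp
    then show "0 < p y * (J y)\<^sup>2 + (w y + 1)\<^sup>2 / (2 * y\<^sup>2)"
      by (intro add_pos_nonneg) auto
  qed (use c in auto)
  then show ?thesis using Q_nonneg[of "c / 2"] Q_mono[of c 1] c by simp
qed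

end

section \<open>Profiles with nonpositive energy\<close>

locale flow_decay = flow +
  assumes E_le: "\<And>y. 0 < y \<Longrightarrow> E y \<le> 0"
    and p_cont: "continuous_on {0..} p"
begin

lemma f_ge_half: assumes "0 \<le> y" shows "1 / 2 \<le> f y"
proof (cases "y = 0")
  case False
  then have "0 \<le> (f y - 1 / 2) / y"
    using Q_nonneg[of y] E_le[of y] assms by (simp add: Q_def)
  then show ?thesis using False assms by (simp add: zero_le_divide_iff)
qed (simp add: init)

lemma u_ge: assumes "1 \<le> y" shows "Q 1 \<le> u y"
proof -
  have "Q 1 \<le> (f y - 1 / 2) / y"
    using Q_mono[of 1 y] E_le[of y] assms by (simp add: Q_def)
  also have "\<dots> \<le> u y" using assms by (simp add: u_def divide_right_mono)
  finally show ?thesis .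
qed

text \<open>If \<open>k \<le> 0\<close>, the initial negativity of \<open>J\<close> makes
  \<open>g\<close> negative at once, and the negative cone keeps it so. Then \<open>f\<close> is
  concave and at most 1, against the linear growth given by \<open>u_ge\<close>.\<close>

lemma k_pos: "0 < k"
proof (rule ccontr)
  assume "\<not> 0 < k"
  then have k: "k \<le> 0" by simp
  obtain d where d: "0 < d" "\<And>y. 0 \<le> y \<Longrightarrow> y \<le> d \<Longrightarrow> w y < 0" "\<And>y. 0 < y \<Longrightarrow> y \<le> d \<Longrightarrow> J y < 0"
    using start by metis
  have gd: "g y < 0" if "0 < y" "y \<le> d" for y
  proof -
    have "- g 0 < - g y"
      by (rule strict_mono_from_deriv[OF that(1) DERIV_minus[OF dg]])
         (use d that p_pos in \<open>auto simp: mult_less_0_iff\<close>)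
    then show ?thesis using k by (simp add: init)
  qed
  have g: "g y \<le> 0" if "0 \<le> y" for y
  proof (cases "y \<le> d")
    case True then show ?thesis using gd[of y] k that by (cases "y = 0") (auto simp: init)
  next
    case False then show ?thesis
      using neg_cone[of d y] gd[of d] d(1) d(2)[of d] d(3)[of d] by auto
  qed
  have v: "v y \<le> 0" if "0 \<le> y" for y
    using mono_from_deriv[OF that DERIV_minus[OF dv]] g by (auto simp: init)
  have f: "f y \<le> 1" if "0 \<le> y" for y
    using mono_from_deriv[OF that DERIV_minus[OF df]] v by (auto simp: init)
  define z where "z = max 1 (2 / Q 1)"
  have z: "1 \<le> z" "2 / Q 1 \<le> z" by (auto simp: z_def)
  then have "2 \<le> Q 1 * z" using Q1_pos by (simp add: field_simps)
  also have "\<dots> \<le> f z" using u_ge[OF z(1)] z(1) by (simp add: u_def field_simps)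
  finally show False using f[of z] z(1) by simp
qed

text \<open>\<open>u' = (w / y) * (1 / y)\<close>, and Young's inequality splits this into
  \<open>l * (w / y)^2 / 2\<close>, a part of \<open>l * E'\<close>, and a multiple of
  \<open>1 / y^2\<close>, which has a primitive. The signs \<open>s = 1\<close> and
  \<open>s = -1\<close> give the two halves of the absolute value.\<close>

lemma u_diff:
  assumes "0 < x" "x \<le> y" "0 < l"
  shows "\<bar>u y - u x\<bar> \<le> l * (E y - E x) + (1 / x - 1 / y) / (2 * l)"
proof -
  have *: "l * E x - 1 / x / (2 * l) + s * u x \<le> l * E y - 1 / y / (2 * l) + s * u y"
    if s: "\<bar>s\<bar> = 1" for s
  proof (rule mono_from_deriv[OF assms(2), where T = "{0..}" and
      F' = "\<lambda>y. l * (p y * (J y)\<^sup>2 + (w y)\<^sup>2 / (2 * y\<^sup>2)) + 1 / y\<^sup>2 / (2 * l) + s * (w y / y\<^sup>2)"])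
    fix z assume "x \<le> z" "z \<le> y"
    then have z: "0 < z" using assms by simp
    then show "((\<lambda>y. l * E y - 1 / y / (2 * l) + s * u y) has_real_derivative
      l * (p z * (J z)\<^sup>2 + (w z)\<^sup>2 / (2 * z\<^sup>2)) + 1 / z\<^sup>2 / (2 * l) + s * (w z / z\<^sup>2)) (at z within {0..})"
      using assms(3) by (auto intro!: derivative_eq_intros dE du simp: power2_eq_square ac_simps)
  next
    fix z assume "x < z" "z < y"
    then have z: "0 < z" using assms by simp
    have "\<bar>s * (w z / z\<^sup>2)\<bar> = \<bar>w z / z\<bar> * (1 / z)"
      using z s by (simp add: abs_mult power2_eq_square)
    also have "\<dots> \<le> l * (w z / z)\<^sup>2 / 2 + (1 / z)\<^sup>2 / (2 * l)" by (rule abs_le_weighted[OF assms(3)])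
    also have "\<dots> = l * ((w z)\<^sup>2 / (2 * z\<^sup>2)) + 1 / z\<^sup>2 / (2 * l)" by (simp add: power_divide)
    finally show "0 \<le> l * (p z * (J z)\<^sup>2 + (w z)\<^sup>2 / (2 * z\<^sup>2)) + 1 / z\<^sup>2 / (2 * l) + s * (w z / z\<^sup>2)"
      by (rule add_nonneg_absorb) (use assms(3) p_pos[of z] z in auto)
  qed (use assms in auto)
  show ?thesis using *[of 1] *[of "-1"] by (simp add: abs_le_iff algebra_simps diff_divide_distrib)
qed

text \<open>The weight \<open>x powr (-1/2)\<close> balances the two terms of \<open>u_diff\<close>:
  both become multiples of it.\<close>

lemma u_rate:
  assumes "1 \<le> x" "x \<le> y"
  shows "\<bar>u y - u x\<bar> \<le> (- E 1 + 1 / 2) * x powr (-1/2)"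
proof -
  let ?l = "x powr (-1/2)"
  have l: "0 < ?l" "?l * ?l = 1 / x" using assms
    by (simp_all add: powr_add[symmetric] powr_minus_divide)
  have "\<bar>u y - u x\<bar> \<le> ?l * (E y - E x) + (1 / x - 1 / y) / (2 * ?l)"
    by (rule u_diff) (use assms l in auto)
  also have "\<dots> \<le> ?l * (- E 1) + (1 / x) / (2 * ?l)"
    using E_mono[of 1 x] E_le[of y] assms l
    by (intro add_mono mult_left_mono divide_right_mono) auto
  also have "(1 / x) / (2 * ?l) = ?l / 2" unfolding l(2)[symmetric] using l(1) by simp
  finally show ?thesis by (simp add: algebra_simps)
qed

lemma slope_exists:
  "\<exists>a. (u \<longlongrightarrow> a) at_top \<and> (\<forall>x\<ge>1. \<bar>u x - a\<bar> \<le> (- E 1 + 1 / 2) * x powr (-1/2))"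
proof -
  have "((\<lambda>x. (- E 1 + 1 / 2) * x powr (-1/2)) \<longlongrightarrow> (- E 1 + 1 / 2) * 0) at_top"
    by (intro tendsto_mult tendsto_const tendsto_neg_powr filterlim_ident) simp
  from tendsto_at_top_with_rate[of _ 1 u, OF this[simplified mult_zero_right]] u_rate
  show ?thesis by simp
qed

definition slope where "slope = (THE a. (u \<longlongrightarrow> a) at_top)"

lemma slope: "(u \<longlongrightarrow> slope) at_top"
  and slope_rate: "1 \<le> x \<Longrightarrow> \<bar>u x - slope\<bar> \<le> (- E 1 + 1 / 2) * x powr (-1/2)"
proof -
  obtain a where a: "(u \<longlongrightarrow> a) at_top" "\<forall>x\<ge>1. \<bar>u x - a\<bar> \<le> (- E 1 + 1 / 2) * x powr (-1/2)"
    using slope_exists by blast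
  have "slope = a" unfolding slope_def
    by (rule the_equality) (use a tendsto_unique[OF trivial_limit_at_top_linorder] in auto)
  with a show "(u \<longlongrightarrow> slope) at_top"
    "1 \<le> x \<Longrightarrow> \<bar>u x - slope\<bar> \<le> (- E 1 + 1 / 2) * x powr (-1/2)" by auto
qed

lemma slope_ge: "Q 1 \<le> slope"
  by (rule tendsto_lowerbound[OF slope]) (auto simp: eventually_at_top_linorder intro: u_ge)

lemma slope_pos: "0 < slope"
  using slope_ge Q1_pos by simp

text \<open>On \<open>[1, \<infinity>)\<close> the dissipation is at most the increase of
  \<open>E\<close>, that is, at most \<open>- E 1\<close>. It will bound the integral of
  \<open>h^m h_xxx^2\<close>.\<close>

lemma dissipation_bound:
  "\<exists>C. \<forall>Y\<ge>0. integral {0..Y} (\<lambda>y. p y * (J y)\<^sup>2) \<le> C"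
proof -
  let ?h = "\<lambda>y. p y * (J y)\<^sup>2"
  define I where "I Y = integral {0..Y} ?h" for Y
  have c: "continuous_on {0..} ?h" by (intro continuous_intros p_cont cont)
  have dI: "(I has_real_derivative ?h y) (at y within {0..})" if "0 \<le> y" for y
    unfolding I_def[abs_def] by (rule integral_half_line_deriv[OF c that])
  have h0: "0 \<le> ?h y" if "0 \<le> y" for y using p_pos[OF that] by simp
  have mono: "I x \<le> I y" if "0 \<le> x" "x \<le> y" for x y
    by (rule mono_from_deriv[OF that(2) dI]) (use that h0 in auto)
  have "I y \<le> I 1 - E 1" if "0 \<le> y" for y
  proof (cases "y \<le> 1")
    case True then show ?thesis using mono[of y 1] that E_le[of 1] by simp
  next
    case False
    have "E 1 - I 1 \<le> E y - I y"
      by (rule mono_from_deriv[OF _ DERIV_diff[OF dE dI]]) (use False in auto)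
    then show ?thesis using E_le[of y] False by simp
  qed
  then show ?thesis unfolding I_def by blast
qed

text \<open>In \<open>v = u + w / y\<close> the first summand is bounded and
  \<open>2 (w / y)^2\<close> is dominated by \<open>4 E'\<close>. It will provide the local
  \<open>H^1\<close> bound; linear growth in \<open>Y\<close> is the natural rate for a profile of
  bounded slope.\<close>

lemma gradient_bound:
  "\<exists>C. \<forall>Y\<ge>0. integral {0..Y} (\<lambda>y. (v y)\<^sup>2) \<le> C * (1 + Y)"
proof -
  define I where "I Y = integral {0..Y} (\<lambda>y. (v y)\<^sup>2)" for Y
  have c: "continuous_on {0..} (\<lambda>y. (v y)\<^sup>2)" by (intro continuous_intros cont)
  have dI: "(I has_real_derivative (v y)\<^sup>2) (at y within {0..})" if "0 \<le> y" for y
    unfolding I_def[abs_def] by (rule integral_half_line_deriv[OF c that])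
  have mono: "I x \<le> I y" if "0 \<le> x" "x \<le> y" for x y
    by (rule mono_from_deriv[OF that(2) dI]) (use that in auto)
  define U where "U = slope + (- E 1 + 1 / 2)"
  have U: "(u y)\<^sup>2 \<le> U\<^sup>2" if "1 \<le> y" for y
  proof -
    have "y powr (-1/2) \<le> 1" using powr_mono[of "-1/2" 0 y] that by simp
    then have "(- E 1 + 1 / 2) * y powr (-1/2) \<le> (- E 1 + 1 / 2) * 1"
      using E_le[of 1] by (intro mult_left_mono) auto
    then have "u y \<le> U" using slope_rate[OF that] by (simp add: U_def)
    then show ?thesis using u_ge[OF that] Q1_pos by (intro power_mono) auto
  qed
  have I0: "0 \<le> I 1" using mono[of 0 1] by (simp add: I_def)
  define C where "C = I 1 - 4 * E 1 + 2 * U\<^sup>2"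
  have "I y \<le> C * (1 + y)" if "0 \<le> y" for y
  proof -
    have "I y \<le> I 1 - 4 * E 1 + 2 * U\<^sup>2 * y"
    proof (cases "y \<le> 1")
      case True then show ?thesis using mono[of y 1] that E_le[of 1]
        mult_nonneg_nonneg[OF zero_le_power2[of U] that] by linarith
    next
      case False
      have "2 * U\<^sup>2 * 1 + 4 * E 1 - I 1 \<le> 2 * U\<^sup>2 * y + 4 * E y - I y"
      proof (rule mono_from_deriv[where T = "{0..}" and a = 1 and b = y and
          F = "\<lambda>y. 2 * U\<^sup>2 * y + 4 * E y - I y" and
          F' = "\<lambda>y. 2 * U\<^sup>2 + 4 * (p y * (J y)\<^sup>2 + (w y)\<^sup>2 / (2 * y\<^sup>2)) - (v y)\<^sup>2"])
        fix z assume "1 \<le> z" "z \<le> y"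
        then show "((\<lambda>y. 2 * U\<^sup>2 * y + 4 * E y - I y) has_real_derivative
           2 * U\<^sup>2 + 4 * (p z * (J z)\<^sup>2 + (w z)\<^sup>2 / (2 * z\<^sup>2)) - (v z)\<^sup>2) (at z within {0..})"
          by (auto intro!: derivative_eq_intros dE dI)
      next
        fix z assume z: "1 < z" "z < y"
        have "v z = u z + w z / z" using z by (simp add: u_def w_def field_simps)
        then have "(v z)\<^sup>2 \<le> 2 * (u z)\<^sup>2 + 2 * (w z / z)\<^sup>2"
          using sum_squares_bound[of "u z" "w z / z"] by (simp add: power2_sum)
        also have "\<dots> \<le> 2 * U\<^sup>2 + 2 * (w z / z)\<^sup>2" using U[of z] z by simp
        finally show "0 \<le> 2 * U\<^sup>2 + 4 * (p z * (J z)\<^sup>2 + (w z)\<^sup>2 / (2 * z\<^sup>2)) - (v z)\<^sup>2"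
          using mult_nonneg_nonneg[OF less_imp_le[OF p_pos[of z]] zero_le_power2[of "J z"]] z
          by (simp add: power_divide)
      qed (use False in auto)
      then show ?thesis using E_le[of y] False zero_le_power2[of U] by linarith
    qed
    also have "\<dots> \<le> C * (1 + y)"
    proof -
      have "0 \<le> (I 1 - 4 * E 1) * y" using I0 E_le[of 1] that by simp
      moreover have "C * (1 + y) = (I 1 - 4 * E 1 + 2 * U\<^sup>2 * y) + ((I 1 - 4 * E 1) * y + 2 * U\<^sup>2)"
        by (simp add: C_def algebra_simps)
      ultimately show ?thesis using zero_le_power2[of U] by linarith
    qed
    finally show ?thesis .
  qed
  then show ?thesis unfolding I_def by blast
qed

text \<open>The same device as in \<open>u_diff\<close>, applied to \<open>J' = (w / y) * y\<close>.
  The weight is frozen at its value at the end point, where \<open>y powr (3/2)\<close> balances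
  \<open>l\<close> against \<open>y^3 / l\<close>. A component with a characteristic root above 2
  would make \<open>J\<close> grow faster than \<open>y^3\<close>.\<close>

lemma J_growth:
  assumes "1 \<le> y"
  shows "\<bar>J y\<bar> \<le> (\<bar>J 1\<bar> - E 1 + 1 / 6) * y powr (3/2)"
proof -
  let ?l = "y powr (3/2)"
  have l: "1 \<le> ?l" "?l * ?l = y ^ 3" using assms
    by (simp_all add: powr_add[symmetric] ge_one_powr_ge_zero powr_numeral[symmetric] del: powr_numeral)
  have *: "?l * E 1 + 1 ^ 3 / (6 * ?l) + s * J 1 \<le> ?l * E y + y ^ 3 / (6 * ?l) + s * J y"
    if s: "\<bar>s\<bar> = 1" for s
  proof (rule mono_from_deriv[OF assms, where T = "{0..}" and
      F' = "\<lambda>y. ?l * (p y * (J y)\<^sup>2 + (w y)\<^sup>2 / (2 * y\<^sup>2)) + y\<^sup>2 / (2 * ?l) + s * w y"])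
    fix z assume "1 \<le> z" "z \<le> y"
    then show "((\<lambda>x. ?l * E x + x ^ 3 / (6 * ?l) + s * J x) has_real_derivative
       ?l * (p z * (J z)\<^sup>2 + (w z)\<^sup>2 / (2 * z\<^sup>2)) + z\<^sup>2 / (2 * ?l) + s * w z) (at z within {0..})"
      using l by (auto intro!: derivative_eq_intros dE dJw simp: field_simps power2_eq_square)
  next
    fix z assume z: "1 < z" "z < y"
    have "\<bar>s * w z\<bar> = \<bar>w z / z\<bar> * z" using z s by (simp add: abs_mult)
    also have "\<dots> \<le> ?l * (w z / z)\<^sup>2 / 2 + z\<^sup>2 / (2 * ?l)" using l by (intro abs_le_weighted) auto
    also have "\<dots> = ?l * ((w z)\<^sup>2 / (2 * z\<^sup>2)) + z\<^sup>2 / (2 * ?l)" by (simp add: power_divide)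
    finally show "0 \<le> ?l * (p z * (J z)\<^sup>2 + (w z)\<^sup>2 / (2 * z\<^sup>2)) + z\<^sup>2 / (2 * ?l) + s * w z"
      by (rule add_nonneg_absorb) (use p_pos[of z] z in auto)
  qed auto
  have "\<bar>J y - J 1\<bar> \<le> ?l * (E y - E 1) + y ^ 3 / (6 * ?l)"
  proof -
    have "0 \<le> 1 ^ 3 / (6 * ?l)" by simp
    then show ?thesis
      using *[of 1, OF abs_one] *[of "-1", OF abs_neg_one] unfolding abs_le_iff right_diff_distrib
      by linarith
  qed
  also have "y ^ 3 / (6 * ?l) = ?l / 6" unfolding l(2)[symmetric] using l(1) by simp
  also have "?l * (E y - E 1) \<le> ?l * (- E 1)" using E_le[of y] assms l by (intro mult_left_mono) auto
  finally have "\<bar>J y\<bar> \<le> \<bar>J 1\<bar> + ?l * (- E 1) + ?l / 6" by linarith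
  also have "\<bar>J 1\<bar> \<le> \<bar>J 1\<bar> * ?l" using l mult_left_mono[of 1 ?l "\<bar>J 1\<bar>"] by simp
  finally show ?thesis by (simp add: algebra_simps)
qed

end

section \<open>An upper bound for the slope\<close>

text \<open>Replaces a passage to the limit: the points of small curvature in the slope estimates
  depend on \<open>e\<close>, and \<open>c * e\<close> collects all that vanishes with it.\<close>

lemma le_of_le_add_eps:
  fixes x y c :: real
  assumes "\<And>e. 0 < e \<Longrightarrow> x \<le> y + c * e"
  shows "x \<le> y"
proof (rule field_le_epsilon)
  fix e :: real assume e: "0 < e"
  have "c * (e / (\<bar>c\<bar> + 1)) \<le> e"
  proof -
    have "c * e \<le> (\<bar>c\<bar> + 1) * e" using e by (intro mult_right_mono) auto
    then have "c * e \<le> e * (\<bar>c\<bar> + 1)" by (simp add: mult.commute)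
    then show ?thesis by (simp add: pos_divide_le_eq add_nonneg_pos)
  qed
  then show "x \<le> y + e" using assms[of "e / (\<bar>c\<bar> + 1)"] e by (smt (verit) divide_pos_pos)
qed

text \<open>Here \<open>x\<close> stands for the value of \<open>f / y\<close> at the zero
  \<open>Y\<close> of \<open>w\<close>, and \<open>t\<close> for \<open>1 / (x Y)\<close>. A large
  slope forces \<open>t\<close> to be large by the third bound, while the first makes
  \<open>x\<close> small when \<open>t\<close> is large; the two are incompatible beyond
  28/25.\<close>

lemma slope_bound_arith:
  fixes a x t :: real
  assumes x: "0 < x" and t: "0 < t" "t \<le> 1 / 2"
    and 1: "x ^ 4 \<le> 4 / 3 - t + 4 / 15 * t\<^sup>2"
    and 2: "a \<le> x + 49 / 30 * x * t"
    and 3: "a \<le> x + 2722 / 10000 * t / x"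
  shows "a \<le> 28 / 25"
proof (rule ccontr)
  assume "\<not> a \<le> 28 / 25"
  then have a: "28 / 25 < a" by simp
  have "x * t \<le> x * (1 / 2)" using x t by (intro mult_left_mono) auto
  then have x6: "6 / 10 \<le> x" using 2 a by simp
  have "(a - x) * x \<le> 2722 / 10000 * t" using 3 x by (simp add: field_simps)
  moreover have "(28 / 25 - x) * x \<le> (a - x) * x" using a x by (intro mult_right_mono) auto
  ultimately have t3: "(28 / 25 - x) * x \<le> 2722 / 10000 * t" by linarith
  \<comment> \<open>On \<open>[0.6, 0.981]\<close> the concave function
    \<open>(28/25 - x) * x\<close> exceeds 0.1361, the largest value that \<open>t \<le> 1/2\<close>
    permits in \<open>t3\<close>. The square is estimated by its chord to keep the argument
    linear.\<close>
  have x9: "981 / 1000 \<le> x"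
  proof (rule ccontr)
    assume n: "\<not> ?thesis"
    then have "0 \<le> (10 * x - 6) * (981 - 1000 * x)" using x6 by simp
    then have "10000 * (x * x) \<le> 15810 * x - 5886" by (simp add: algebra_simps)
    moreover have "(28 / 25 - x) * x = 28 / 25 * x - x * x" by (simp add: algebra_simps)
    ultimately show False using t3 t n by linarith
  qed
  define d where "d = x - 981 / 1000"
  have d: "0 \<le> d" "x = d + 981 / 1000" using x9 by (auto simp: d_def)
  have "t * t \<le> t * (1 / 2)" using t by (intro mult_left_mono) auto
  then have "x ^ 4 \<le> 4 / 3 - 13 / 15 * t" using 1 by (simp add: power2_eq_square)
  then have "2722 / 10000 * x ^ 4 \<le> 2722 / 10000 * (4 / 3) - 13 / 15 * ((28 / 25 - x) * x)"
    using t3 by linarith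
  \<comment> \<open>Eliminating \<open>t\<close> leaves a quartic that would have to be nonpositive.
    Expanded about 981/1000 it has positive coefficients only.\<close>
  moreover have "2722 / 10000 * x ^ 4 - (2722 / 10000 * (4 / 3) - 13 / 15 * ((28 / 25 - x) * x)) > 0"
  proof -
    have "2722 / 10000 * x ^ 4 - (2722 / 10000 * (4 / 3) - 13 / 15 * ((28 / 25 - x) * x))
        = 110091288912643 / 15000000000000000 * d ^ 0 + 1118162883703 / 3750000000000 * d ^ 1 + 5287959889 / 7500000000 * d ^ 2 + 1335141 / 1250000 * d ^ 3 + 1361 / 5000 * d ^ 4"
      unfolding d(2) by algebra
    also have "\<dots> > 0" using d(1) by (intro add_pos_nonneg) auto
    finally show ?thesis .
  qed
  ultimately show False by linarith
qed

section \<open>Signs of the curvature and the flux for the mobility \<open>f^-4\<close>\<close>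

locale flow4 = flow_decay +
  assumes p4: "\<And>y. 0 \<le> y \<Longrightarrow> p y = 1 / (f y) ^ 4"
begin

text \<open>If \<open>\<bar>y g\<bar>\<close> stays above \<open>e\<close> with a fixed sign
  \<open>s\<close>, then \<open>w' = y g\<close> makes \<open>s w\<close> grow linearly and
  \<open>u' = w / y^2\<close> makes \<open>s u\<close> grow logarithmically. Both signs contradict
  the bounds \<open>0 < u < slope + 1\<close> for large \<open>y\<close>.\<close>

lemma no_growth:
  assumes "0 < e" "0 < z0" "\<bar>s\<bar> = 1" and g: "\<And>y. z0 \<le> y \<Longrightarrow> e \<le> s * (y * g y)"
  shows False
proof -
  have w: "s * w z0 + e * (y - z0) \<le> s * w y" if "z0 \<le> y" for y
  proof -
    have "s * w z0 - e * z0 \<le> s * w y - e * y"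
      by (rule mono_from_deriv[OF that, where F' = "\<lambda>y. s * (y * g y) - e" and T = "{0..}"])
         (use assms in \<open>auto intro!: derivative_eq_intros dw\<close>)
    then show ?thesis by (simp add: algebra_simps)
  qed
  \<comment> \<open>Beyond twice the offset of the linear lower bound, half of the linear term
    suffices to absorb it.\<close>
  define z1 where "z1 = max z0 (2 * (\<bar>w z0\<bar> + e * z0) / e)"
  have z1: "z0 \<le> z1" "2 * (\<bar>w z0\<bar> + e * z0) \<le> e * z1"
    using assms by (auto simp: z1_def field_simps max_def)
  have w2: "e / 2 * y \<le> s * w y" if "z1 \<le> y" for y
  proof -
    have "e * z1 \<le> e * y" using that assms by simp
    moreover have "\<bar>s * w z0\<bar> = \<bar>w z0\<bar>" using assms by (simp add: abs_mult)
    ultimately show ?thesis using w[of y] z1 that by (simp add: algebra_simps abs_le_iff)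
  qed
  have u: "s * u z1 + e / 2 * (ln y - ln z1) \<le> s * u y" if "z1 \<le> y" for y
  proof -
    have "s * u z1 - e / 2 * ln z1 \<le> s * u y - e / 2 * ln y"
    proof (rule mono_from_deriv[OF that, where F' = "\<lambda>y. s * (w y / y\<^sup>2) - e / 2 * (1 / y)" and T = "{0..}"])
      fix x assume "z1 \<le> x" "x \<le> y"
      then show "((\<lambda>y. s * u y - e / 2 * ln y) has_real_derivative s * (w x / x\<^sup>2) - e / 2 * (1 / x))
          (at x within {0..})"
        using z1 assms by (auto intro!: derivative_eq_intros du)
    next
      fix x assume x: "z1 < x" "x < y"
      then have "e / 2 * x / x\<^sup>2 \<le> s * w x / x\<^sup>2" using w2[of x] by (intro divide_right_mono) auto
      then show "0 \<le> s * (w x / x\<^sup>2) - e / 2 * (1 / x)"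
        using x z1 assms by (simp add: power2_eq_square)
    qed (use z1 assms in auto)
    then show ?thesis by (simp add: algebra_simps diff_divide_distrib)
  qed
  have "filterlim (\<lambda>y. s * u z1 + e / 2 * (ln y - ln z1)) at_top at_top"
    using assms
    by (intro filterlim_tendsto_add_at_top[OF tendsto_const] filterlim_tendsto_pos_mult_at_top[OF tendsto_const])
       (auto intro!: filterlim_tendsto_add_at_top[where f = "\<lambda>_. - ln z1", OF tendsto_const ln_at_top, simplified])
  then have "\<forall>\<^sub>F y in at_top. slope + 1 \<le> s * u z1 + e / 2 * (ln y - ln z1)"
    by (simp add: filterlim_at_top)
  moreover have "\<forall>\<^sub>F y in at_top. u y < slope + 1" by (rule order_tendstoD(2)[OF slope]) simp
  moreover have "\<forall>\<^sub>F y in at_top. 0 < u y" by (rule order_tendstoD(1)[OF slope slope_pos])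
  ultimately have "\<forall>\<^sub>F y in at_top. y < z1"
  proof eventually_elim
    case (elim y)
    have "s * u y \<le> 1 * u y" using elim(3) \<open>\<bar>s\<bar> = 1\<close> by (intro mult_right_mono) auto
    then show ?case using u[of y] elim by (cases "z1 \<le> y") linarith+
  qed
  moreover have "\<forall>\<^sub>F y in at_top. z1 \<le> y" by (rule eventually_ge_at_top)
  ultimately have "\<forall>\<^sub>F y in (at_top :: real filter). False" by eventually_elim auto
  then show False by simp
qed

text \<open>With \<open>J y \<ge> 0\<close> the point would lie in the positive cone,
  \<open>g\<close> could not decrease, and \<open>y g\<close> would stay above a positive constant,
  which \<open>no_growth\<close> forbids. \<open>J_pos\<close> is the mirror image.\<close>

lemma J_neg:
  assumes "0 < y" "0 < g y" "0 < w y" shows "J y < 0"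
proof (rule ccontr)
  assume "\<not> J y < 0"
  then have mono: "g y \<le> g z" if "y \<le> z" for z using pos_cone[of y z] assms that by auto
  show False
  proof (rule no_growth[of "y * g y" y 1])
    fix z assume "y \<le> z"
    then show "y * g y \<le> 1 * (z * g z)" using mono[of z] assms by (auto intro: mult_mono)
  qed (use assms in auto)
qed

lemma J_pos:
  assumes "0 < y" "g y < 0" "w y < 0" shows "0 < J y"
proof (rule ccontr)
  assume "\<not> 0 < J y"
  then have mono: "- g y \<le> - g z" if "y \<le> z" for z using neg_cone[of y z] assms that by auto
  show False
  proof (rule no_growth[of "y * (- g y)" y "-1"])
    fix z assume "y \<le> z"
    then have "y * (- g y) \<le> z * (- g z)" using mono[of z] assms by (intro mult_mono) auto
    then show "y * (- g y) \<le> -1 * (z * g z)" by simp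
  qed (use assms in \<open>auto simp: mult_pos_neg\<close>)
qed

text \<open>\<open>no_growth\<close> prevents \<open>y g\<close> from staying above
  \<open>e\<close>; \<open>z\<close> is the first point at which it does not exceed
  \<open>e\<close>. There \<open>v\<close> and \<open>v - y g\<close> agree up to \<open>e\<close>,
  while \<open>g\<close> has been positive on the way.\<close>

lemma small_curvature:
  assumes "0 < e" "0 < Y"
  obtains z where "Y \<le> z" "z * g z \<le> e" "\<And>y. Y \<le> y \<Longrightarrow> y < z \<Longrightarrow> 0 < g y"
proof -
  have "\<exists>b\<ge>Y. b * g b < e"
  proof (rule ccontr)
    assume "\<not> ?thesis"
    then have "e \<le> 1 * (y * g y)" if "Y \<le> y" for y using that by (auto simp: not_less)
    then show False by (rule no_growth[of e Y 1, rotated 3]) (use assms in auto)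
  qed
  then obtain b where b: "Y \<le> b" "b * g b < e" by blast
  define S where "S = {Y..b} \<inter> (\<lambda>y. y * g y) -` {..e}"
  have "compact S" unfolding S_def
    by (intro compact_sublevel continuous_intros continuous_on_subset[OF cont(3)]) (use assms in auto)
  moreover have "b \<in> S" using b by (simp add: S_def)
  ultimately obtain z where z: "z \<in> S" "\<And>t. t \<in> S \<Longrightarrow> z \<le> t"
    using compact_attains_inf[of S] by blast
  have "0 < g y" if "Y \<le> y" "y < z" for y
  proof -
    have "y \<notin> S" using z(2) that by force
    then have "e < y * g y" using that z(1) by (auto simp: S_def)
    then have "0 < y * g y" using assms by simp
    then show ?thesis using that assms by (simp add: zero_less_mult_iff)
  qed
  then show ?thesis using that[of z] z(1) by (auto simp: S_def)
qed

text \<open>\<open>J' = w < 0\<close> makes \<open>J\<close> negative. If \<open>g\<close> were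
  nonpositive somewhere, it would be negative slightly later because \<open>g' = p J < 0\<close>,
  and then \<open>J_pos\<close> would require \<open>J > 0\<close>.\<close>

lemma first_phase:
  assumes neg: "\<And>y. 0 \<le> y \<Longrightarrow> y < Y \<Longrightarrow> w y < 0" and y: "0 < y" "y < Y"
  shows "J y < 0" "0 < g y"
proof -
  have J: "J x < 0" if "0 < x" "x < Y" for x
  proof -
    have "- J 0 < - J x"
      by (rule strict_mono_from_deriv[OF that(1) DERIV_minus[OF dJw]]) (use neg that in auto)
    then show ?thesis by (simp add: init)
  qed
  then show "J y < 0" using y .
  show "0 < g y"
  proof (rule ccontr)
    assume n: "\<not> 0 < g y"
    obtain z where z: "y < z" "z < Y" using y dense by blast
    have "- g y < - g z"
      by (rule strict_mono_from_deriv[OF z(1) DERIV_minus[OF dg]])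
         (use J y z p_pos in \<open>auto simp: mult_less_0_iff\<close>)
    then show False using J_pos[of z] J[of z] neg[of z] n y z by auto
  qed
qed

text \<open>The intercept at 0 of the tangent to \<open>v\<close>. Its derivative
  \<open>- y p J\<close> contains no curvature, so upper bounds for \<open>p\<close> and
  \<open>- J\<close> bound \<open>H\<close> from above, and at points of small \<open>y g\<close>
  they bound \<open>v\<close>.\<close>

definition H where "H y = v y - y * g y"

lemma dH: "0 \<le> y \<Longrightarrow> (H has_real_derivative - y * (p y * J y)) (at y within {0..})"
  unfolding H_def[abs_def] by (auto intro!: derivative_eq_intros dv dg)

lemma H0: "H 0 = 0" by (simp add: H_def init)

lemma first_phase_bounds:
  assumes neg: "\<And>y. 0 \<le> y \<Longrightarrow> y < Y \<Longrightarrow> w y < 0" and y: "0 \<le> y" "y \<le> Y"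
  shows "0 \<le> v y" "1 \<le> f y" "-1 \<le> w y" "- y \<le> J y" "p y \<le> 1"
proof -
  note ph = first_phase[OF neg]
  have v: "0 \<le> v x" if "0 \<le> x" "x \<le> Y" for x
  proof -
    have "v 0 \<le> v x"
      by (rule mono_from_deriv[OF that(1) dv]) (use ph(2) that in \<open>auto simp: less_imp_le\<close>)
    then show ?thesis by (simp add: init)
  qed
  then show "0 \<le> v y" using y by blast
  have "f 0 \<le> f y"
    by (rule mono_from_deriv[OF y(1) df]) (use v y in auto)
  then show f: "1 \<le> f y" by (simp add: init)
  have w: "-1 \<le> w x" if "0 \<le> x" "x \<le> Y" for x
  proof -
    have "w 0 \<le> w x"
      by (rule mono_from_deriv[OF that(1) dw]) (use ph(2) that in \<open>auto simp: less_imp_le\<close>)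
    then show ?thesis by (simp add: w0)
  qed
  then show "-1 \<le> w y" using y by blast
  have "J 0 + 0 \<le> J y + y"
  proof (rule mono_from_deriv[OF y(1), where F' = "\<lambda>x. w x + 1" and T = "{0..}"])
    fix x assume "0 < x" "x < y"
    then show "0 \<le> w x + 1" using w[of x] y by simp
  qed (auto intro!: derivative_eq_intros dJw)
  then show "- y \<le> J y" by (simp add: init)
  have "1 \<le> (f y) ^ 4" using f by simp
  moreover from this have "0 < (f y) ^ 4" by linarith
  ultimately show "p y \<le> 1" using y by (simp add: p4 pos_divide_le_eq)
qed

section \<open>The slope estimate, first without and then with a zero of \<open>w\<close>\<close>

lemma p_le:
  assumes "0 < c" "0 < y" "c \<le> u y" shows "p y \<le> 1 / (c * y) ^ 4"
proof -
  have "c * y \<le> f y" using assms by (simp add: u_def field_simps)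
  then have "(c * y) ^ 4 \<le> f y ^ 4" using assms by (intro power_mono) auto
  then show ?thesis using assms by (simp add: p4 frac_le)
qed

text \<open>Here \<open>u\<close> decreases to \<open>a = slope\<close>, so
  \<open>f \<ge> a y\<close>. Since \<open>- J \<le> y\<close>, \<open>H\<close> is at most the
  integral of \<open>p y^2\<close>, with \<open>p \<le> 1\<close> up to \<open>1 / a\<close> and
  \<open>p \<le> (a y)^-4\<close> beyond, the point where the two bounds cross. This gives
  \<open>1 / (3 a^3) + 1 / a^3\<close>. In the limit \<open>v\<close> is at least \<open>a\<close>,
  hence \<open>a \<le> 4 / (3 a^3)\<close>.\<close>

lemma slope_bound_no_zero:
  assumes neg: "\<And>y. 0 \<le> y \<Longrightarrow> w y < 0"
  shows "slope ^ 4 \<le> 4 / 3"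
proof -
  let ?a = slope
  note a = slope_pos
  note fb = first_phase_bounds[of "y + 1" y for y :: real, OF neg]
  note ph = first_phase[of "y + 1" y for y :: real, OF neg]
  have u: "?a \<le> u y" if "0 < y" for y
  proof (rule tendsto_upperbound[OF slope])
    have "u z \<le> u y" if "y \<le> z" for z
    proof -
      have "- u y \<le> - u z"
        by (rule mono_from_deriv[OF that DERIV_minus[OF du]])
           (use \<open>0 < y\<close> neg in \<open>auto simp: less_imp_le divide_nonpos_nonneg\<close>)
      then show ?thesis by simp
    qed
    then show "\<forall>\<^sub>F z in at_top. u z \<le> u y" by (auto simp: eventually_at_top_linorder)
  qed simp
  have H': "- y * (p y * J y) \<le> p y * y\<^sup>2" if "0 < y" for y
  proof -
    have "y * p y * (- J y) \<le> y * p y * y"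
      using fb(4)[of y] p_pos[of y] that by (intro mult_left_mono) auto
    then show ?thesis by (simp add: power2_eq_square mult_ac)
  qed
  have "(1 / ?a) ^ 3 / 3 - H (1 / ?a) \<ge> 0 ^ 3 / 3 - H 0"
  proof (rule mono_from_deriv[where T = "{0..}" and F' = "\<lambda>y. y\<^sup>2 - (- y * (p y * J y))"
        and F = "\<lambda>y. y ^ 3 / 3 - H y" and a = 0 and b = "1 / ?a"])
    fix y :: real assume y: "0 < y"
    have "p y * y\<^sup>2 \<le> 1 * y\<^sup>2" using fb(5)[of y] y by (intro mult_right_mono) auto
    then show "0 \<le> y\<^sup>2 - (- y * (p y * J y))" using H'[OF y] by simp
  qed (use a in \<open>auto intro!: derivative_eq_intros dH\<close>)
  then have H1: "H (1 / ?a) \<le> (1 / ?a) ^ 3 / 3" by (simp add: H0)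
  have H2: "H y \<le> 4 / 3 / ?a ^ 3" if "1 / ?a \<le> y" for y
  proof -
    have "- (1 / ?a ^ 4 / (1 / ?a)) - H (1 / ?a) \<le> - (1 / ?a ^ 4 / y) - H y"
    proof (rule mono_from_deriv[OF that, where T = "{0..}" and
          F' = "\<lambda>y. 1 / ?a ^ 4 / y\<^sup>2 - (- y * (p y * J y))"])
      fix x assume "1 / ?a \<le> x" "x \<le> y"
      moreover have "0 < 1 / ?a" using a by simp
      ultimately have x: "0 < x" by linarith
      then show "((\<lambda>y. - (1 / ?a ^ 4 / y) - H y) has_real_derivative
          1 / ?a ^ 4 / x\<^sup>2 - (- x * (p x * J x))) (at x within {0..})"
        using a by (auto intro!: derivative_eq_intros dH simp: power2_eq_square)
    next
      fix x assume "1 / ?a < x" "x < y"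
      moreover have "0 < 1 / ?a" using a by simp
      ultimately have x: "0 < x" by linarith
      have "p x * x\<^sup>2 \<le> 1 / (?a * x) ^ 4 * x\<^sup>2" using p_le[OF a x u[OF x]] by (intro mult_right_mono) auto
      also have "\<dots> = 1 / ?a ^ 4 / x\<^sup>2" using x a by (simp add: power_mult_distrib power4_eq_xxxx power2_eq_square)
      finally show "0 \<le> 1 / ?a ^ 4 / x\<^sup>2 - (- x * (p x * J x))" using H'[OF x] by simp
    qed (use a in auto)
    moreover have "0 \<le> 1 / ?a ^ 4 / y"
      using a order_trans[OF _ that, of 0] by (intro divide_nonneg_nonneg) auto
    ultimately have "H y \<le> (1 / ?a) ^ 3 / 3 + 1 / ?a ^ 4 / (1 / ?a)" using H1 by linarith
    also have "\<dots> = 4 / 3 / ?a ^ 3" using a by (simp add: field_simps power4_eq_xxxx power3_eq_cube)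
    finally show ?thesis .
  qed
  have "?a \<le> 4 / 3 / ?a ^ 3"
  proof (rule le_of_le_add_eps)
    fix e :: real assume e: "0 < e"
    \<comment> \<open>Starting beyond \<open>1 / e\<close> makes the correction
      \<open>w z / z \<ge> - 1 / z\<close> at least \<open>- e\<close>.\<close>
    obtain z where z: "max (1 / e) (1 / ?a) \<le> z" "z * g z \<le> e"
      using small_curvature[of e "max (1 / e) (1 / ?a)"] e a by (metis divide_pos_pos max.strict_coboundedI1 zero_less_one)
    have z0: "0 < z" "1 / e \<le> z" "1 / ?a \<le> z" using z(1) e by (auto intro: less_le_trans[of 0 "1 / e"])
    have "v z = u z + w z / z" using z0 by (simp add: u_def w_def field_simps)
    moreover have "-1 / z \<le> w z / z" using fb(3)[of z] z0 by (intro divide_right_mono) auto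
    moreover have "1 / z \<le> e" using z0 e by (simp add: field_simps)
    ultimately show "?a \<le> 4 / 3 / ?a ^ 3 + 2 * e"
      using u[OF z0(1)] H2[OF z0(3)] z(2) by (simp add: H_def)
  qed
  then show ?thesis using a by (simp add: field_simps power4_eq_xxxx power3_eq_cube)
qed


text \<open>At the first zero \<open>Y\<close> of \<open>w\<close> the value \<open>c = u Y\<close>
  equals \<open>v Y\<close> and is the minimum of \<open>u\<close> so far; it remains a lower bound
  while \<open>g > 0\<close>. The bound has two halves, both in terms of
  \<open>t = 1 / (c Y)\<close>: \<open>c\<close> is estimated through \<open>H\<close> as in the
  case without a zero, and the excess \<open>slope - c\<close> through the energy.\<close>

lemma slope_bound_zero:
  assumes Y: "0 < Y" "w Y = 0" and neg: "\<And>y. 0 \<le> y \<Longrightarrow> y < Y \<Longrightarrow> w y < 0"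
  shows "slope \<le> 28 / 25"
proof -
  note fb = first_phase_bounds[of Y, OF neg]
  note ph = first_phase[of Y, OF neg]
  define c where "c = u Y"
  define j where "j = - J Y"
  have vY: "v Y = c" using Y by (simp add: c_def u_def w_def field_simps)
  \<comment> \<open>The terms containing \<open>g\<close> cancel in the derivative of
    \<open>2 (w + 1) - y^2 g\<close>; what is left, \<open>- y^2 p J\<close>, is nonnegative in this
    phase.\<close>
  have psi: "y\<^sup>2 * g y \<le> 2 * (w y + 1)" if "0 \<le> y" "y \<le> Y" for y
  proof -
    have "2 * (w 0 + 1) - 0\<^sup>2 * g 0 \<le> 2 * (w y + 1) - y\<^sup>2 * g y"
    proof (rule mono_from_deriv[OF that(1), where T = "{0..}" and F' = "\<lambda>y. - (y\<^sup>2 * (p y * J y))"])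
      fix x assume "0 < x" "x < y"
      then show "0 \<le> - (x\<^sup>2 * (p x * J x))"
        using ph(1)[of x] p_pos[of x] that by (simp add: mult_nonneg_nonpos mult_nonneg_nonpos2 less_imp_le)
    qed (auto intro!: derivative_eq_intros dw dg)
    then show ?thesis by (simp add: w0)
  qed
  \<comment> \<open>By \<open>psi\<close> the quotient \<open>(w + 1) / y^2\<close> is nonincreasing
    up to \<open>Y\<close>, where it is \<open>1 / Y^2\<close>. The gain over
    \<open>w \<ge> -1\<close> sharpens \<open>J \<ge> - y\<close> to the cubic bound below, and so
    \<open>j \<le> Y\<close> to \<open>j \<le> 2 Y / 3\<close>.\<close>
  have w_ge: "-1 + y\<^sup>2 / Y\<^sup>2 \<le> w y" if "0 < y" "y \<le> Y" for y
  proof -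
    have "- ((w y + 1) / y\<^sup>2) \<le> - ((w Y + 1) / Y\<^sup>2)"
    proof (rule mono_from_deriv[OF that(2), where T = "{0..}" and
          F' = "\<lambda>y. (2 * (w y + 1) - y\<^sup>2 * g y) / y ^ 3"])
      fix x assume "y \<le> x" "x \<le> Y"
      then have x: "0 < x" using that by simp
      have "((\<lambda>x. - ((w x + 1) / x\<^sup>2)) has_real_derivative
          - ((x * g x * x\<^sup>2 - (w x + 1) * (2 * x)) / (x\<^sup>2 * x\<^sup>2))) (at x within {0..})"
        using x by (auto intro!: derivative_eq_intros dw)
      moreover have "- ((x * g x * x\<^sup>2 - (w x + 1) * (2 * x)) / (x\<^sup>2 * x\<^sup>2))
          = (2 * (w x + 1) - x\<^sup>2 * g x) / x ^ 3"
        using x by (simp add: field_simps power2_eq_square power3_eq_cube)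
      ultimately show "((\<lambda>x. - ((w x + 1) / x\<^sup>2)) has_real_derivative
          (2 * (w x + 1) - x\<^sup>2 * g x) / x ^ 3) (at x within {0..})" by simp
    next
      fix x assume "y < x" "x < Y"
      then show "0 \<le> (2 * (w x + 1) - x\<^sup>2 * g x) / x ^ 3" using psi[of x] that by simp
    qed (use that in auto)
    then have "1 / Y\<^sup>2 \<le> (w y + 1) / y\<^sup>2" using Y by simp
    then have "1 / Y\<^sup>2 * y\<^sup>2 \<le> w y + 1" using that by (simp add: pos_le_divide_eq)
    then show ?thesis by simp
  qed
  have J_ge: "- y + y ^ 3 / (3 * Y\<^sup>2) \<le> J y" if "0 \<le> y" "y \<le> Y" for y
  proof -
    have "J 0 - (- 0 + 0 ^ 3 / (3 * Y\<^sup>2)) \<le> J y - (- y + y ^ 3 / (3 * Y\<^sup>2))"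
    proof (rule mono_from_deriv[OF that(1), where T = "{0..}" and F' = "\<lambda>y. w y - (-1 + y\<^sup>2 / Y\<^sup>2)"])
      fix x assume "0 < x" "x < y"
      then show "0 \<le> w x - (- 1 + x\<^sup>2 / Y\<^sup>2)" using w_ge[of x] that by simp
    qed (use Y in \<open>auto intro!: derivative_eq_intros dJw simp: field_simps\<close>)
    then show ?thesis by (simp add: init)
  qed
  have j: "0 \<le> j" "j \<le> 2 * Y / 3"
  proof -
    have "- J 0 \<le> - J Y"
      by (rule mono_from_deriv[OF _ DERIV_minus[OF dJw]]) (use neg Y in \<open>auto simp: less_imp_le\<close>)
    then show "0 \<le> j" by (simp add: j_def init)
    have "Y ^ 3 / (3 * Y\<^sup>2) = Y / 3" using Y by (simp add: power2_eq_square power3_eq_cube)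
    then show "j \<le> 2 * Y / 3" using J_ge[of Y] Y by (simp add: j_def)
  qed
  have gY: "g Y \<le> 2 / Y\<^sup>2" using psi[of Y] Y by (simp add: pos_le_divide_eq mult.commute)
  have H_nonneg: "0 \<le> H y" if "0 \<le> y" "y \<le> Y" for y
  proof -
    have "H 0 \<le> H y"
      by (rule mono_from_deriv[OF that(1) dH])
         (use ph(1) p_pos that in \<open>auto simp: mult_nonneg_nonpos mult_nonneg_nonpos2 less_imp_le\<close>)
    then show ?thesis by (simp add: H0)
  qed
  \<comment> \<open>\<open>2 f - y v\<close> has derivative \<open>H \<ge> 0\<close>, starts at 2
    and equals \<open>c Y\<close> at \<open>Y\<close>. This is the source of
    \<open>t \<le> 1/2\<close>.\<close>
  have X2: "2 \<le> c * Y"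
  proof -
    have "2 * f 0 - 0 * v 0 \<le> 2 * f Y - Y * v Y"
      by (rule mono_from_deriv[where T = "{0..}" and F' = H and F = "\<lambda>y. 2 * f y - y * v y"])
         (use Y H_nonneg in \<open>auto intro!: derivative_eq_intros df dv simp: H_def\<close>)
    then show ?thesis using Y vY by (simp add: init w_def mult.commute)
  qed
  have c: "0 < c" using X2 Y by (smt (verit) mult_nonpos_nonneg)
  have cY: "1 / c \<le> Y" using X2 c by (simp add: field_simps)
  have u_low: "c \<le> u y" if "0 < y" "y \<le> Y" for y
  proof -
    have "- u y \<le> - u Y"
      by (rule mono_from_deriv[OF that(2) DERIV_minus[OF du]])
         (use that neg in \<open>auto simp: less_imp_le divide_nonpos_nonneg\<close>)
    then show ?thesis by (simp add: c_def)
  qed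
  have w_pos: "0 \<le> w y" if "Y \<le> y" "\<And>x. Y \<le> x \<Longrightarrow> x < y \<Longrightarrow> 0 < g x" for y
  proof -
    have "w Y \<le> w y"
      by (rule mono_from_deriv[OF that(1) dw]) (use that Y in \<open>auto simp: less_imp_le\<close>)
    then show ?thesis using Y by simp
  qed
  \<comment> \<open>After \<open>Y\<close>, as long as \<open>g > 0\<close>, \<open>w\<close> is
    nonnegative: \<open>u\<close> and \<open>J\<close> increase, and \<open>J_neg\<close> confines
    \<open>J\<close> between \<open>- j\<close> and 0.\<close>
  have second: "c \<le> u y \<and> - j \<le> J y \<and> J y < 0"
    if z: "\<And>x. Y \<le> x \<Longrightarrow> x < z \<Longrightarrow> 0 < g x" and y: "Y < y" "y < z" for y z
  proof -
    have w: "0 \<le> w x" if "Y \<le> x" "x \<le> y" for x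
      by (rule w_pos) (use that z y in auto)
    have "u Y \<le> u y"
      by (rule mono_from_deriv[OF _ du]) (use w y Y in auto)
    moreover have "J Y \<le> J y"
      by (rule mono_from_deriv[OF _ dJw]) (use w y Y in auto)
    moreover have "w Y < w y"
      by (rule strict_mono_from_deriv[OF y(1) dw]) (use z y Y in auto)
    ultimately show ?thesis using J_neg[of y] z[of y] y Y by (auto simp: c_def j_def)
  qed
  have pw: "p y * y\<^sup>2 \<le> 1 / c ^ 4 / y\<^sup>2" "p y \<le> 1 / c ^ 4 / y ^ 4" if "0 < y" "c \<le> u y" for y
  proof -
    have "p y * y\<^sup>2 \<le> 1 / (c * y) ^ 4 * y\<^sup>2" using p_le[OF c that] by (intro mult_right_mono) auto
    also have "\<dots> = 1 / c ^ 4 / y\<^sup>2"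
      using that c by (simp add: power_mult_distrib power4_eq_xxxx power2_eq_square)
    finally show "p y * y\<^sup>2 \<le> 1 / c ^ 4 / y\<^sup>2" .
    show "p y \<le> 1 / c ^ 4 / y ^ 4" using p_le[OF c that] by (simp add: power_mult_distrib)
  qed
  have H': "- y * (p y * J y) \<le> p y * y\<^sup>2 * (1 - y\<^sup>2 / (3 * Y\<^sup>2))" if "0 < y" "y \<le> Y" for y
  proof -
    have "p y * y * (- J y) \<le> p y * y * (y - y ^ 3 / (3 * Y\<^sup>2))"
      using J_ge[of y] p_pos[of y] that by (intro mult_left_mono) auto
    also have "\<dots> = p y * y\<^sup>2 * (1 - y\<^sup>2 / (3 * Y\<^sup>2))"
      by (simp add: algebra_simps power2_eq_square power3_eq_cube)
    finally show ?thesis by (simp add: mult_ac)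
  qed
  have q0: "0 \<le> 1 - y\<^sup>2 / (3 * Y\<^sup>2)" if "0 < y" "y \<le> Y" for y
  proof -
    have "y\<^sup>2 \<le> Y\<^sup>2" using that by (intro power_mono) auto
    then have "y\<^sup>2 \<le> 3 * Y\<^sup>2" using zero_le_power2[of Y] by linarith
    then show ?thesis using Y by simp
  qed
  \<comment> \<open>The integral of \<open>- y p J\<close> is cut where the available bounds change:
    \<open>p \<le> 1\<close> up to \<open>1 / c\<close> and \<open>p \<le> (c y)^-4\<close>
    afterwards, the cubic bound for \<open>J\<close> up to \<open>Y\<close> and
    \<open>J \<ge> - j\<close> afterwards. \<open>H1\<close>, \<open>H2\<close>, \<open>H3\<close>
    are the three pieces.\<close>
  have H1: "H (1 / c) \<le> (1 / c) ^ 3 / 3 - (1 / c) ^ 5 / (15 * Y\<^sup>2)"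
  proof -
    have "(0 ^ 3 / 3 - 0 ^ 5 / (15 * Y\<^sup>2)) - H 0 \<le> ((1 / c) ^ 3 / 3 - (1 / c) ^ 5 / (15 * Y\<^sup>2)) - H (1 / c)"
    proof (rule mono_from_deriv[where T = "{0..}" and a = 0 and b = "1 / c" and
          F = "\<lambda>y. (y ^ 3 / 3 - y ^ 5 / (15 * Y\<^sup>2)) - H y" and
          F' = "\<lambda>y. y\<^sup>2 * (1 - y\<^sup>2 / (3 * Y\<^sup>2)) - (- y * (p y * J y))"])
      fix y assume y: "0 < y" "y < 1 / c"
      then have yY: "y \<le> Y" using cY by simp
      have "p y * (y\<^sup>2 * (1 - y\<^sup>2 / (3 * Y\<^sup>2))) \<le> 1 * (y\<^sup>2 * (1 - y\<^sup>2 / (3 * Y\<^sup>2)))"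
        using fb(5)[of y] y yY q0[of y] by (intro mult_right_mono) auto
      then show "0 \<le> y\<^sup>2 * (1 - y\<^sup>2 / (3 * Y\<^sup>2)) - (- y * (p y * J y))"
        using H'[of y] y yY unfolding mult.assoc mult_1_left by linarith
    next
      fix y assume "0 \<le> y" "y \<le> 1 / c"
      then show "((\<lambda>y. (y ^ 3 / 3 - y ^ 5 / (15 * Y\<^sup>2)) - H y) has_real_derivative
          y\<^sup>2 * (1 - y\<^sup>2 / (3 * Y\<^sup>2)) - (- y * (p y * J y))) (at y within {0..})"
        using Y by (auto intro!: derivative_eq_intros dH)
          (simp add: field_simps power2_eq_square power4_eq_xxxx)
    qed (use c in auto)
    then show ?thesis by (simp add: H0)
  qed
  have H2: "H Y - H (1 / c) \<le> (1 / c ^ 4) * (c - 1 / Y - (Y - 1 / c) / (3 * Y\<^sup>2))"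
  proof -
    have "1 / c ^ 4 * (- 1 / (1 / c) - (1 / c) / (3 * Y\<^sup>2)) - H (1 / c)
        \<le> 1 / c ^ 4 * (- 1 / Y - Y / (3 * Y\<^sup>2)) - H Y"
    proof (rule mono_from_deriv[OF cY, where T = "{0..}" and
          F' = "\<lambda>y. 1 / c ^ 4 * (1 / y\<^sup>2 - 1 / (3 * Y\<^sup>2)) - (- y * (p y * J y))"])
      fix y assume "1 / c \<le> y" "y \<le> Y"
      moreover have "0 < 1 / c" using c by simp
      ultimately have y: "0 < y" by linarith
      then have d: "((\<lambda>y. - 1 / y - y / (3 * Y\<^sup>2)) has_real_derivative
          1 / y\<^sup>2 - 1 / (3 * Y\<^sup>2)) (at y within {0..})"
        using Y by (auto intro!: derivative_eq_intros simp: power2_eq_square)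
      show "((\<lambda>y. 1 / c ^ 4 * (- 1 / y - y / (3 * Y\<^sup>2)) - H y) has_real_derivative
          1 / c ^ 4 * (1 / y\<^sup>2 - 1 / (3 * Y\<^sup>2)) - (- y * (p y * J y))) (at y within {0..})"
        using y by (intro DERIV_diff[OF DERIV_cmult[OF d] dH]) auto
    next
      fix y assume y: "1 / c < y" "y < Y"
      moreover have "0 < 1 / c" using c by simp
      ultimately have y0: "0 < y" by linarith
      have "p y * y\<^sup>2 * (1 - y\<^sup>2 / (3 * Y\<^sup>2)) \<le> 1 / c ^ 4 / y\<^sup>2 * (1 - y\<^sup>2 / (3 * Y\<^sup>2))"
        using pw(1)[of y] u_low[of y] y y0 q0[of y] by (intro mult_right_mono) auto
      also have "\<dots> = 1 / c ^ 4 * (1 / y\<^sup>2 - 1 / (3 * Y\<^sup>2))"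
        using y0 Y c by (simp add: right_diff_distrib)
      finally show "0 \<le> 1 / c ^ 4 * (1 / y\<^sup>2 - 1 / (3 * Y\<^sup>2)) - (- y * (p y * J y))"
        using H'[of y] y y0 by simp
    qed (use c in auto)
    moreover have "1 / c ^ 4 * (- 1 / Y - Y / (3 * Y\<^sup>2)) - 1 / c ^ 4 * (- 1 / (1 / c) - (1 / c) / (3 * Y\<^sup>2))
       = (1 / c ^ 4) * (c - 1 / Y - (Y - 1 / c) / (3 * Y\<^sup>2))"
      by (simp add: algebra_simps diff_divide_distrib)
    ultimately show ?thesis by linarith
  qed
  have H3: "H z - H Y \<le> (1 / c ^ 4) * (1 / (3 * Y))"
    if zY: "Y \<le> z" and z: "\<And>x. Y \<le> x \<Longrightarrow> x < z \<Longrightarrow> 0 < g x" for z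
  proof -
    have "1 / c ^ 4 * (- (Y / (3 * Y\<^sup>2))) - H Y \<le> 1 / c ^ 4 * (- (Y / (3 * z\<^sup>2))) - H z"
    proof (rule mono_from_deriv[OF zY, where T = "{0..}" and
          F = "\<lambda>y. 1 / c ^ 4 * (- (Y / (3 * y\<^sup>2))) - H y" and
          F' = "\<lambda>y. 1 / c ^ 4 * (2 * Y / (3 * y ^ 3)) - (- y * (p y * J y))"])
      fix y assume "Y \<le> y" "y \<le> z"
      then have y: "0 < y" using Y by simp
      then show "((\<lambda>y. 1 / c ^ 4 * (- (Y / (3 * y\<^sup>2))) - H y) has_real_derivative
         1 / c ^ 4 * (2 * Y / (3 * y ^ 3)) - (- y * (p y * J y))) (at y within {0..})"
        using c by (auto intro!: derivative_eq_intros dH)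
          (simp add: field_simps power2_eq_square power3_eq_cube power4_eq_xxxx)
    next
      fix y assume y: "Y < y" "y < z"
      then have y0: "0 < y" using Y by simp
      note s = second[of z y, OF z y]
      have "p y * (y * (- J y)) \<le> p y * (y * (2 * Y / 3))"
        using s j p_pos[of y] y0 by (intro mult_left_mono) auto
      also have "\<dots> \<le> 1 / c ^ 4 / y ^ 4 * (y * (2 * Y / 3))"
        using pw(2)[of y] s y0 Y by (intro mult_right_mono) auto
      also have "\<dots> = 1 / c ^ 4 * (2 * Y / (3 * y ^ 3))"
        using y0 by (simp add: power4_eq_xxxx power3_eq_cube)
      finally show "0 \<le> 1 / c ^ 4 * (2 * Y / (3 * y ^ 3)) - (- y * (p y * J y))"
        by (simp add: mult_ac)
    qed (use Y in auto)
    moreover have "0 \<le> 1 / c ^ 4 * (Y / (3 * z\<^sup>2))" using c Y zY by simp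
    moreover have "Y / (3 * Y\<^sup>2) = 1 / (3 * Y)" using Y by (simp add: power2_eq_square)
    ultimately show ?thesis by simp
  qed
  define t where "t = 1 / (c * Y)"
  have t: "0 < t" "t \<le> 1 / 2" using c Y X2 by (auto simp: t_def field_simps)
  have tc: "1 / Y = c * t" using c Y by (simp add: t_def)
  \<comment> \<open>\<open>T\<close> is the sum of the three pieces. Up to \<open>e\<close>,
    \<open>c = v Y \<le> v z = H z + z g z \<le> T\<close>, since \<open>v\<close> increases while
    \<open>g > 0\<close>. Multiplied by \<open>c^3\<close> the sum depends on \<open>t\<close>
    alone.\<close>
  have four: "c ^ 4 \<le> 4 / 3 - t + 4 / 15 * t\<^sup>2"
  proof -
    define T where "T = ((1 / c) ^ 3 / 3 - (1 / c) ^ 5 / (15 * Y\<^sup>2))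
        + (1 / c ^ 4) * (c - 1 / Y - (Y - 1 / c) / (3 * Y\<^sup>2)) + (1 / c ^ 4) * (1 / (3 * Y))"
    have "c \<le> T"
    proof (rule le_of_le_add_eps)
      fix e :: real assume "0 < e"
      then obtain z where z: "Y \<le> z" "z * g z \<le> e" "\<And>y. Y \<le> y \<Longrightarrow> y < z \<Longrightarrow> 0 < g y"
        using small_curvature[OF _ Y(1)] by metis
      have "v Y \<le> v z"
        by (rule mono_from_deriv[OF z(1) dv]) (use z(3) Y in \<open>auto simp: less_imp_le\<close>)
      then show "c \<le> T + 1 * e"
        using H1 H2 H3[OF z(1) z(3)] z(2) vY unfolding T_def H_def by linarith
    qed
    moreover have "T * c ^ 3 = 4 / 3 - t + 4 / 15 * t\<^sup>2"
      using c Y unfolding T_def t_def by (simp add: field_simps power2_eq_square eval_nat_numeral)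
    moreover have "c * c ^ 3 \<le> T * c ^ 3" using c \<open>c \<le> T\<close> by (intro mult_right_mono) auto
    ultimately show ?thesis by (simp add: power4_eq_xxxx power3_eq_cube)
  qed
  \<comment> \<open>By Young's inequality \<open>G l\<close> decreases, even with the dissipation to
    spare. Since \<open>- l E \<ge> 0\<close>, it dominates \<open>u\<close>, so each of its values
    is an upper bound for the slope.\<close>
  define G where "G l y = u y - l * E y + 1 / (2 * l * y)" for l y
  have dG: "(G l has_real_derivative
      w y / y\<^sup>2 - l * (p y * (J y)\<^sup>2 + (w y)\<^sup>2 / (2 * y\<^sup>2)) - 1 / (2 * l * y\<^sup>2)) (at y within {0..})"
    if "0 < y" "0 < l" for l y
    unfolding G_def[abs_def] using that
    by (auto intro!: derivative_eq_intros du dE simp: power2_eq_square)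
  have G': "w y / y\<^sup>2 - l * (p y * (J y)\<^sup>2 + (w y)\<^sup>2 / (2 * y\<^sup>2)) - 1 / (2 * l * y\<^sup>2) \<le> - l * (p y * (J y)\<^sup>2)"
    if "0 < y" "0 < l" for l y
  proof -
    have "\<bar>w y / y\<bar> * (1 / y) \<le> l * (w y / y)\<^sup>2 / 2 + (1 / y)\<^sup>2 / (2 * l)" by (rule abs_le_weighted[OF that(2)])
    moreover have "w y / y\<^sup>2 \<le> \<bar>w y / y\<bar> * (1 / y)"
      using that by (simp add: power2_eq_square divide_right_mono)
    ultimately show ?thesis by (simp add: power_divide algebra_simps)
  qed
  have G_mono: "G l y \<le> G l x" if "0 < x" "x \<le> y" "0 < l" for x y l
  proof -
    have "- G l x \<le> - G l y"
    proof (rule mono_from_deriv[OF that(2) DERIV_minus[OF dG]])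
      fix z assume "x < z" "z < y"
      then have "0 < z" using that by simp
      moreover have "0 \<le> l * (p z * (J z)\<^sup>2)" using that p_pos[of z] \<open>0 < z\<close> by simp
      ultimately show "0 \<le> - (w z / z\<^sup>2 - l * (p z * (J z)\<^sup>2 + (w z)\<^sup>2 / (2 * z\<^sup>2)) - 1 / (2 * l * z\<^sup>2))"
        using G'[of z l] that by simp
    qed (use that in auto)
    then show ?thesis by simp
  qed
  have slope_G: "slope \<le> G l x" if "0 < x" "0 < l" for l x
  proof (rule tendsto_upperbound[OF slope])
    show "\<forall>\<^sub>F y in at_top. u y \<le> G l x"
      using eventually_ge_at_top[of x]
    proof eventually_elim
      case (elim y)
      then have "0 \<le> - l * E y" "0 \<le> 1 / (2 * l * y)"
        using E_le[of y] that by (auto simp: mult_nonneg_nonpos)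
      then have "u y \<le> G l y" unfolding G_def by linarith
      also have "\<dots> \<le> G l x" by (rule G_mono[OF that(1) elim that(2)])
      finally show ?case .
    qed
  qed simp
  have GY: "G l Y = c + l * (g Y * j) + 1 / (2 * l * Y)" for l
    using Y by (simp add: G_def E_def c_def j_def)
  \<comment> \<open>\<open>b1\<close> is needed only to keep \<open>c\<close> away from \<open>0\<close> in \<open>b2\<close>; the value of \<open>l\<close> is nearly optimal in each case\<close>
  have b1: "slope \<le> c + 49 / 30 * c * t"
  proof -
    have "g Y * j \<le> 2 / Y\<^sup>2 * (2 * Y / 3)"
      using mult_mono[OF gY j(2) _ j(1)] by simp
    then have "slope \<le> c + 3 / 5 * (2 / Y\<^sup>2 * (2 * Y / 3)) + 1 / (2 * (3 / 5) * Y)"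
      using slope_G[OF Y(1), of "3 / 5"] GY[of "3 / 5"] by simp
    also have "\<dots> = c + 49 / 30 * (1 / Y)" using Y by (simp add: power2_eq_square)
    finally show ?thesis unfolding tc by simp
  qed
  have b2: "slope \<le> c + 2722 / 10000 * t / c"
  proof -
    define l where "l = 11 / 3 * c\<^sup>2"
    have l: "0 < l" using c by (simp add: l_def)
    have s1: "slope \<le> c + 1 / (2 * l * Y) + l / (27 * c ^ 4 * Y)"
    proof (rule le_of_le_add_eps)
      fix e :: real assume e: "0 < e"
      then obtain z where z: "Y \<le> z" "z * g z \<le> e" "\<And>y. Y \<le> y \<Longrightarrow> y < z \<Longrightarrow> 0 < g y"
        using small_curvature[OF _ Y(1)] by metis
      \<comment> \<open>At \<open>Y\<close> the subtracted \<open>l j g\<close> cancels the energy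
        term of \<open>G l Y\<close>, and at \<open>z\<close> it is negligible. The price is the
        last summand, the primitive of the error \<open>l j^2 / (4 c^4 y^4)\<close> made along the
        way.\<close>
      have "G l z - l * j * g z + l * (j\<^sup>2 / (12 * c ^ 4)) / z ^ 3
          \<le> G l Y - l * j * g Y + l * (j\<^sup>2 / (12 * c ^ 4)) / Y ^ 3"
      proof -
        have "- (G l Y - l * j * g Y + l * (j\<^sup>2 / (12 * c ^ 4)) / Y ^ 3)
          \<le> - (G l z - l * j * g z + l * (j\<^sup>2 / (12 * c ^ 4)) / z ^ 3)"
        proof (rule mono_from_deriv[OF z(1), where T = "{0..}" and F' = "\<lambda>y.
            - (w y / y\<^sup>2 - l * (p y * (J y)\<^sup>2 + (w y)\<^sup>2 / (2 * y\<^sup>2)) - 1 / (2 * l * y\<^sup>2)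
               - l * j * (p y * J y) - l * (j\<^sup>2 / (4 * c ^ 4)) / y ^ 4)"])
          fix y assume "Y \<le> y" "y \<le> z"
          then have y: "0 < y" using Y by simp
          have d1: "((\<lambda>y. l * (j\<^sup>2 / (12 * c ^ 4)) / y ^ 3) has_real_derivative
              - (l * (j\<^sup>2 / (4 * c ^ 4)) / y ^ 4)) (at y within {0..})"
            using y c by (auto intro!: derivative_eq_intros)
              (simp add: field_simps power2_eq_square eval_nat_numeral)
          show "((\<lambda>y. - (G l y - l * j * g y + l * (j\<^sup>2 / (12 * c ^ 4)) / y ^ 3)) has_real_derivative
            - (w y / y\<^sup>2 - l * (p y * (J y)\<^sup>2 + (w y)\<^sup>2 / (2 * y\<^sup>2)) - 1 / (2 * l * y\<^sup>2)
               - l * j * (p y * J y) - l * (j\<^sup>2 / (4 * c ^ 4)) / y ^ 4)) (at y within {0..})"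
            using DERIV_minus[OF DERIV_add[OF DERIV_diff[OF dG[OF y l] DERIV_cmult[OF dg[of y], of "l * j"]] d1]] y
            by simp
        next
          fix y assume y: "Y < y" "y < z"
          then have y0: "0 < y" using Y by simp
          note s = second[of z y, OF z(3) y]
          \<comment> \<open>the dissipation \<open>p J\<^sup>2\<close> absorbs part of \<open>-E(Y) = g(Y) j\<close>, which halves the error\<close>
          have "0 \<le> p y * (J y + j / 2)\<^sup>2" using p_pos[of y] y0 by simp
          then have "- (p y * (J y)\<^sup>2) - j * (p y * J y) \<le> p y * (j\<^sup>2 / 4)"
            by (simp add: power2_eq_square algebra_simps)
          also have "\<dots> \<le> 1 / c ^ 4 / y ^ 4 * (j\<^sup>2 / 4)"
            using pw(2)[of y] s y0 by (intro mult_right_mono) auto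
          finally have "l * (- (p y * (J y)\<^sup>2) - j * (p y * J y)) \<le> l * (1 / c ^ 4 / y ^ 4 * (j\<^sup>2 / 4))"
            using l by (intro mult_left_mono) auto
          then have "- l * (p y * (J y)\<^sup>2) - l * j * (p y * J y) \<le> l * (j\<^sup>2 / (4 * c ^ 4)) / y ^ 4"
            by (simp add: algebra_simps)
          then show "0 \<le> - (w y / y\<^sup>2 - l * (p y * (J y)\<^sup>2 + (w y)\<^sup>2 / (2 * y\<^sup>2)) - 1 / (2 * l * y\<^sup>2)
               - l * j * (p y * J y) - l * (j\<^sup>2 / (4 * c ^ 4)) / y ^ 4)"
            using G'[OF y0 l] by linarith
        qed (use Y in auto)
        then show ?thesis by linarith
      qed
      moreover have "0 \<le> l * (j\<^sup>2 / (12 * c ^ 4)) / z ^ 3" using l c Y z(1) by simp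
      moreover have "l * (j\<^sup>2 / (12 * c ^ 4)) / Y ^ 3 \<le> l / (27 * c ^ 4 * Y)"
      proof -
        have "j\<^sup>2 \<le> (2 * Y / 3)\<^sup>2" using j by (intro power_mono) auto
        then have "l * (j\<^sup>2 / (12 * c ^ 4)) / Y ^ 3 \<le> l * ((2 * Y / 3)\<^sup>2 / (12 * c ^ 4)) / Y ^ 3"
          using l c Y by (intro divide_right_mono mult_left_mono) auto
        also have "\<dots> = l / (27 * c ^ 4 * Y)"
          using c Y by (simp add: field_simps power2_eq_square eval_nat_numeral)
        finally show ?thesis .
      qed
      moreover have "l * j * g z \<le> l * (2 / 3) * e"
      proof -
        have "Y * g z \<le> e"
        proof (cases "0 \<le> g z")
          case True
          then have "Y * g z \<le> z * g z" using z(1) by (intro mult_right_mono) auto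
          then show ?thesis using z(2) by simp
        next
          case False
          then show ?thesis using Y e by (smt (verit) mult_pos_neg)
        qed
        then have "j * g z \<le> 2 / 3 * e"
        proof (cases "0 \<le> g z")
          case True
          then have "j * g z \<le> 2 * Y / 3 * g z" using j by (intro mult_right_mono) auto
          then show ?thesis using \<open>Y * g z \<le> e\<close> by simp
        next
          case False
          then have "j * g z \<le> 0" using j by (simp add: mult_nonneg_nonpos)
          then show ?thesis using e by simp
        qed
        then have "l * (j * g z) \<le> l * (2 / 3 * e)" using l by (intro mult_left_mono) auto
        then show ?thesis by (simp add: mult_ac)
      qed
      moreover have "slope \<le> G l z" using z(1) Y by (intro slope_G l) auto
      moreover have "G l Y - l * j * g Y = c + 1 / (2 * l * Y)" by (simp add: GY algebra_simps)
      ultimately show "slope \<le> c + 1 / (2 * l * Y) + l / (27 * c ^ 4 * Y) + l * (2 / 3) * e"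
        by linarith
    qed
    have "1 / (2 * l * Y) + l / (27 * c ^ 4 * Y) = (3 / 22 + 11 / 81) * t / c"
      unfolding l_def t_def using c Y by (simp add: field_simps power2_eq_square eval_nat_numeral)
    with s1 have "slope \<le> c + (3 / 22 + 11 / 81) * t / c" by linarith
    also have "\<dots> \<le> c + 2722 / 10000 * t / c"
      using c t by (intro add_left_mono divide_right_mono mult_right_mono) auto
    finally show ?thesis .
  qed
  show ?thesis by (rule slope_bound_arith[OF c t four b1 b2])
qed

text \<open>The cubic \<open>\<mu> (\<mu> - 2) (\<mu> + 1) = A\<close> has a double root for \<open>A = 0.6311\<dots>\<close>; the bound keeps
  \<open>A = 1 / slope\<^sup>4\<close> above \<open>0.635\<close>.\<close>
lemma slope_bound: "slope \<le> 28 / 25"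
proof (cases "\<forall>y\<ge>0. w y < 0")
  case True
  show ?thesis
  proof (rule ccontr)
    assume "\<not> ?thesis"
    then have "(28 / 25) ^ 4 \<le> slope ^ 4" by (intro power_mono) auto
    then show False using slope_bound_no_zero True by (auto simp: power_divide)
  qed
next
  case False
  then obtain b where b: "0 \<le> b" "0 \<le> w b" by (auto simp: not_less)
  define S where "S = {0..b} \<inter> (\<lambda>y. - w y) -` {..0}"
  have "compact S" unfolding S_def
    by (intro compact_sublevel continuous_intros continuous_on_subset[OF cont(5)]) auto
  moreover have "b \<in> S" using b by (simp add: S_def)
  ultimately obtain Y where Y: "Y \<in> S" "\<And>t. t \<in> S \<Longrightarrow> Y \<le> t"
    using compact_attains_inf[of S] by blast
  have neg: "w y < 0" if "0 \<le> y" "y < Y" for y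
  proof (rule ccontr)
    assume "\<not> w y < 0"
    then have "y \<in> S" using Y(1) that by (auto simp: S_def)
    then show False using Y(2) that by fastforce
  qed
  have Y0: "0 < Y" using Y(1) w0 by (cases "Y = 0") (auto simp: S_def)
  have "w Y = 0"
  proof (rule ccontr)
    assume "w Y \<noteq> 0"
    then have "0 < w Y" using Y(1) by (auto simp: S_def)
    moreover have "\<exists>x\<ge>0. x \<le> Y \<and> w x = 0"
      by (rule IVT') (use w0 Y0 \<open>0 < w Y\<close> in \<open>auto intro: continuous_on_subset[OF cont(5)]\<close>)
    ultimately obtain x where "0 \<le> x" "x \<le> Y" "w x = 0" by blast
    then show False using neg[of x] \<open>0 < w Y\<close> by (cases "x = Y") auto
  qed
  then show ?thesis using slope_bound_zero[OF Y0 _ neg] by blast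
qed

end

section \<open>Perturbed linear equations\<close>

lemma scaled_has_vector_derivative:
  fixes Z :: "real \<Rightarrow> complex"
  assumes "(Z has_vector_derivative \<mu> * Z s + F s) (at s)"
  shows "((\<lambda>s. exp (- \<mu> * of_real s) * Z s) has_vector_derivative exp (- \<mu> * of_real s) * F s) (at s)"
proof -
  have "((\<lambda>s. exp (- \<mu> * of_real s)) has_vector_derivative (- \<mu> * exp (- \<mu> * of_real s))) (at s)"
    by (rule has_vector_derivative_real_field) (auto intro!: derivative_eq_intros)
  from has_vector_derivative_mult[OF this assms] show ?thesis
    by (simp add: algebra_simps)
qed

text \<open>Variation of constants in differential form: \<open>exp (- \<mu> s) Z\<close> has
  derivative \<open>exp (- \<mu> s) F\<close>, and \<open>\<phi>\<close> is any function whose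
  derivative majorizes its norm.\<close>

lemma scaled_diff_bound:
  fixes Z :: "real \<Rightarrow> complex"
  assumes Z: "\<And>s. 0 \<le> s \<Longrightarrow> (Z has_vector_derivative \<mu> * Z s + F s) (at s)"
    and F: "\<And>s. 0 \<le> s \<Longrightarrow> norm (F s) \<le> C * exp (- \<theta> * s)"
    and xy: "0 \<le> x" "x \<le> y"
    and D: "\<And>s. x \<le> s \<Longrightarrow> s \<le> y \<Longrightarrow> (\<phi> has_real_derivative D s) (at s)"
    and le: "\<And>s. x < s \<Longrightarrow> s < y \<Longrightarrow> C * exp (- (Re \<mu> + \<theta>) * s) \<le> D s"
  shows "norm (exp (- \<mu> * of_real y) * Z y - exp (- \<mu> * of_real x) * Z x) \<le> \<phi> y - \<phi> x"
proof (cases "x = y")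
  case False
  then have "x < y" using xy by simp
  let ?G = "\<lambda>s. exp (- \<mu> * of_real s) * Z s"
  have d: "(?G has_vector_derivative exp (- \<mu> * of_real s) * F s) (at s)" if "0 \<le> s" for s
    by (rule scaled_has_vector_derivative[where F = F and \<mu> = \<mu>]) (rule Z[OF that])
  show ?thesis
  proof (rule differentiable_bound_general[OF \<open>x < y\<close>])
    show "continuous_on {x..y} ?G"
      by (rule continuous_on_vector_derivative, rule has_vector_derivative_at_within, rule d) (use xy in auto)
    show "continuous_on {x..y} \<phi>"
      by (rule DERIV_continuous_on, rule has_field_derivative_at_within, rule D) auto
    fix s assume s: "x < s" "s < y"
    show "(?G has_vector_derivative exp (- \<mu> * of_real s) * F s) (at s)" using d s xy by simp
    show "(\<phi> has_vector_derivative D s) (at s)"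
      using D[of s] s by (simp add: has_real_derivative_iff_has_vector_derivative)
    have "norm (exp (- \<mu> * of_real s) * F s) \<le> exp (- Re \<mu> * s) * (C * exp (- \<theta> * s))"
      unfolding norm_mult using F[of s] s xy by (intro mult_mono) auto
    also have "\<dots> = C * exp (- (Re \<mu> + \<theta>) * s)"
      by (simp add: exp_add[symmetric] algebra_simps)
    also have "\<dots> \<le> D s" by (rule le[OF s])
    finally show "norm (exp (- \<mu> * of_real s) * F s) \<le> D s" .
  qed
qed simp

text \<open>The solution decays like the slower of its own mode and the forcing. The inequality
  \<open>\<sigma> < \<theta>\<close> is strict because of resonance: for
  \<open>\<theta> = - Re \<mu>\<close> a factor \<open>s\<close> may appear.\<close>

lemma stable_bound:
  fixes Z :: "real \<Rightarrow> complex"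
  assumes Z: "\<And>s. 0 \<le> s \<Longrightarrow> (Z has_vector_derivative \<mu> * Z s + F s) (at s)"
    and F: "\<And>s. 0 \<le> s \<Longrightarrow> norm (F s) \<le> C * exp (- \<theta> * s)"
    and \<sigma>: "\<sigma> < \<theta>" "\<sigma> \<le> - Re \<mu>"
  shows "\<exists>C'. \<forall>s\<ge>0. norm (Z s) \<le> C' * exp (- \<sigma> * s)"
proof (intro exI[of _ "norm (Z 0) + C / (\<theta> - \<sigma>)"] allI impI)
  fix s :: real assume s: "0 \<le> s"
  have C: "0 \<le> C" using F[of 0] norm_ge_zero[of "F 0"] by (simp del: norm_ge_zero)
  define c where "c = - Re \<mu> - \<sigma>"
  have c: "0 \<le> c" "Re \<mu> = - c - \<sigma>" using \<sigma> by (auto simp: c_def)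
  define k where "k = \<theta> - \<sigma>"
  have k: "0 < k" "\<theta> = \<sigma> + k" using \<sigma> by (auto simp: k_def)
  let ?\<phi> = "\<lambda>r. - (C * exp (c * s) / k * exp (- k * r))"
  have "norm (exp (- \<mu> * of_real s) * Z s - exp (- \<mu> * of_real 0) * Z 0) \<le> ?\<phi> s - ?\<phi> 0"
  proof (rule scaled_diff_bound[OF Z F _ s])
    fix r
    show "(?\<phi> has_real_derivative C * exp (c * s) * exp (- k * r)) (at r)"
      using k by (auto intro!: derivative_eq_intros)
    assume r: "0 < r" "r < s"
    have "C * exp (- (Re \<mu> + \<theta>) * r) = C * (exp (c * r) * exp (- k * r))"
      by (simp add: exp_add[symmetric] c(2) k(2) algebra_simps)
    also have "\<dots> \<le> C * (exp (c * s) * exp (- k * r))"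
      using C c r by (intro mult_left_mono mult_right_mono) (auto intro: mult_left_mono)
    finally show "C * exp (- (Re \<mu> + \<theta>) * r) \<le> C * exp (c * s) * exp (- k * r)"
      by (simp add: mult_ac)
  qed auto
  also have "\<dots> \<le> C / k * exp (c * s)"
    using C k by simp
  finally have "norm (exp (- \<mu> * of_real s) * Z s) \<le> norm (Z 0) + C / k * exp (c * s)"
    using norm_triangle_sub[of "exp (- \<mu> * of_real s) * Z s" "Z 0"] by simp
  moreover have "norm (Z 0) \<le> norm (Z 0) * exp (c * s)"
    using c s mult_left_mono[of 1 "exp (c * s)" "norm (Z 0)"] by simp
  ultimately have "norm (exp (- \<mu> * of_real s) * Z s) \<le> (norm (Z 0) + C / k) * exp (c * s)"
    by (simp add: algebra_simps)
  then have "exp (Re \<mu> * s) * norm (exp (- \<mu> * of_real s) * Z s)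
      \<le> exp (Re \<mu> * s) * ((norm (Z 0) + C / k) * exp (c * s))"
    by (intro mult_left_mono) auto
  also have "exp (Re \<mu> * s) * norm (exp (- \<mu> * of_real s) * Z s) = norm (Z s)"
    using exp_add[of "Re \<mu> * s" "- Re \<mu> * s"] by (simp add: norm_mult mult.assoc[symmetric])
  also have "exp (Re \<mu> * s) * ((norm (Z 0) + C / k) * exp (c * s))
      = (norm (Z 0) + C / k) * (exp (Re \<mu> * s) * exp (c * s))" by (simp only: mult_ac)
  also have "exp (Re \<mu> * s) * exp (c * s) = exp (- \<sigma> * s)"
    by (simp add: exp_add[symmetric] c(2) algebra_simps)
  finally show "norm (Z s) \<le> (norm (Z 0) + C / (\<theta> - \<sigma>)) * exp (- \<sigma> * s)"
    by (simp add: k_def)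
qed

text \<open>If the forcing decays faster than the mode, \<open>exp (- \<mu> s) Z\<close> converges,
  and its tail becomes the remainder. With \<open>\<mu>\<close> in the right half plane this
  isolates the growing mode; with \<open>\<mu> = 0\<close> it gives a limit together with a
  rate.\<close>

lemma leading_coefficient:
  fixes Z :: "real \<Rightarrow> complex"
  assumes Z: "\<And>s. 0 \<le> s \<Longrightarrow> (Z has_vector_derivative \<mu> * Z s + F s) (at s)"
    and F: "\<And>s. 0 \<le> s \<Longrightarrow> norm (F s) \<le> C * exp (- \<theta> * s)"
    and \<theta>: "- Re \<mu> < \<theta>"
  shows "\<exists>k C'. \<forall>s\<ge>0. norm (Z s - k * exp (\<mu> * of_real s)) \<le> C' * exp (- \<theta> * s)"
proof -
  define c where "c = Re \<mu> + \<theta>"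
  have c: "0 < c" using \<theta> by (simp add: c_def)
  have C: "0 \<le> C" using F[of 0] norm_ge_zero[of "F 0"] by (simp del: norm_ge_zero)
  let ?G = "\<lambda>s. exp (- \<mu> * of_real s) * Z s"
  have diff: "norm (?G y - ?G x) \<le> C / c * exp (- c * x)" if "0 \<le> x" "x \<le> y" for x y
  proof -
    have "norm (?G y - ?G x) \<le> - (C / c * exp (- c * y)) - - (C / c * exp (- c * x))"
    proof (rule scaled_diff_bound[OF Z F that])
      fix s
      show "((\<lambda>s. - (C / c * exp (- c * s))) has_real_derivative C * exp (- c * s)) (at s)"
        using c by (auto intro!: derivative_eq_intros)
    qed (auto simp: c_def)
    moreover have "0 \<le> C / c * exp (- c * y)" using C c by simp
    ultimately show ?thesis by linarith
  qed
  have "((\<lambda>x. C / c * exp (- c * x)) \<longlongrightarrow> C / c * 0) at_top"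
    using c by (intro tendsto_mult tendsto_const filterlim_compose[OF exp_at_bot])
      (auto intro!: filterlim_tendsto_pos_mult_at_top[OF tendsto_const _ filterlim_ident]
        simp: filterlim_uminus_at_bot)
  then obtain k where k: "\<And>x. 0 \<le> x \<Longrightarrow> norm (?G x - k) \<le> C / c * exp (- c * x)"
    using tendsto_at_top_with_rate[of "\<lambda>x. C / c * exp (- c * x)" 0 ?G] diff by auto
  have "norm (Z s - k * exp (\<mu> * of_real s)) \<le> C / c * exp (- \<theta> * s)" if "0 \<le> s" for s
  proof -
    have "exp (\<mu> * of_real s) * (?G s - k) = Z s - k * exp (\<mu> * of_real s)"
      by (simp add: algebra_simps exp_minus)
    then have "norm (Z s - k * exp (\<mu> * of_real s)) = exp (Re \<mu> * s) * norm (?G s - k)"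
      using norm_mult[of "exp (\<mu> * of_real s)" "?G s - k"] by simp
    also have "\<dots> \<le> exp (Re \<mu> * s) * (C / c * exp (- c * s))"
      by (intro mult_left_mono k that) auto
    also have "\<dots> = C / c * exp (- \<theta> * s)"
      by (simp add: c_def exp_add[symmetric] algebra_simps)
    finally show ?thesis .
  qed
  then show ?thesis by blast
qed

lemma no_growing_part:
  fixes k :: complex and c :: real
  assumes "\<And>s. 0 \<le> s \<Longrightarrow> norm (k * exp (of_real \<mu> * of_real s)) \<le> C * exp (c * s)" "c < \<mu>"
  shows "k = 0"
proof (rule ccontr)
  assume "k \<noteq> 0"
  have le: "norm k * exp ((\<mu> - c) * s) \<le> C" if "0 \<le> s" for s
  proof -
    have "norm k * exp (\<mu> * s) \<le> C * exp (c * s)" using assms(1)[OF that] by (simp add: norm_mult)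
    then have "norm k * exp (\<mu> * s) / exp (c * s) \<le> C" by (simp add: pos_divide_le_eq)
    then show ?thesis by (simp add: exp_diff algebra_simps)
  qed
  have "filterlim (\<lambda>s. norm k * exp ((\<mu> - c) * s)) at_top at_top"
    using \<open>k \<noteq> 0\<close> assms(2)
    by (intro filterlim_tendsto_pos_mult_at_top[OF tendsto_const] filterlim_compose[OF exp_at_top]
        filterlim_tendsto_pos_mult_at_top[OF tendsto_const _ filterlim_ident]) auto
  then have "\<forall>\<^sub>F s in at_top. C < norm k * exp ((\<mu> - c) * s)"
    by (simp add: filterlim_at_top_dense)
  moreover have "\<forall>\<^sub>F s in at_top. (0::real) \<le> s" by (rule eventually_ge_at_top)
  ultimately have "\<forall>\<^sub>F s in (at_top :: real filter). False"
  proof eventually_elim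
    case (elim s)
    then show ?case using le[of s] by simp
  qed
  then show False by simp
qed

lemma inverse_fourth_diff:
  fixes x y q :: real
  assumes "0 < q" "q \<le> x" "q \<le> y"
  shows "\<bar>1 / x ^ 4 - 1 / y ^ 4\<bar> \<le> 4 / q ^ 5 * \<bar>x - y\<bar>"
proof -
  have xy: "0 < x" "0 < y" using assms by auto
  have i: "1 / x \<le> 1 / q" "1 / y \<le> 1 / q" using assms by (auto intro: divide_left_mono)
  have "1 / x ^ 4 - 1 / y ^ 4 = (y - x) * (1 / x) * (1 / y) * (1 / x + 1 / y) * ((1 / x)\<^sup>2 + (1 / y)\<^sup>2)"
    using xy by (simp add: field_simps power2_eq_square power4_eq_xxxx)
  then have "\<bar>1 / x ^ 4 - 1 / y ^ 4\<bar> = \<bar>x - y\<bar> * ((1 / x) * (1 / y) * (1 / x + 1 / y) * ((1 / x)\<^sup>2 + (1 / y)\<^sup>2))"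
    using xy by (simp add: abs_mult abs_minus_commute mult.assoc)
  also have "\<dots> \<le> \<bar>x - y\<bar> * ((1 / q) * (1 / q) * (1 / q + 1 / q) * ((1 / q)\<^sup>2 + (1 / q)\<^sup>2))"
    using xy i assms by (intro mult_left_mono mult_mono add_mono power_mono) auto
  also have "\<dots> = 4 / q ^ 5 * \<bar>x - y\<bar>"
    using assms by (simp add: field_simps power2_eq_square eval_nat_numeral)
  finally show ?thesis .
qed

section \<open>The characteristic polynomial\<close>

text \<open>Dividing by the real root \<open>m1\<close> leaves a quadratic of discriminant
  \<open>- (3 m1^2 - 2 m1 - 9)\<close>, negative for \<open>m1\<close> beyond
  \<open>(1 + 2 sqrt 7) / 3 = 2.0972...\<close>. The number 839/400 lies just above this, and the
  cubic is still below 127/200 there.\<close>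

lemma char_roots:
  fixes A :: real
  assumes A: "127 / 200 \<le> A"
  obtains m1 :: real and m0 :: complex where
    "2 < m1" "of_real m1 * (of_real m1 - 2) * (of_real m1 + 1) = (of_real A :: complex)"
    "m0 * (m0 - 2) * (m0 + 1) = of_real A" "0 < Im m0" "Re m0 = (1 - m1) / 2" "Re m0 < - 1 / 2"
    "\<And>m :: complex. m * (m - 2) * (m + 1) = of_real A \<Longrightarrow> m = of_real m1 \<or> m = m0 \<or> m = cnj m0"
proof -
  have "\<exists>x\<ge>839/400. x \<le> 3 + A \<and> x * (x - 2) * (x + 1) = A"
  proof (rule IVT')
    show "839/400 * (839/400 - 2) * (839/400 + 1) \<le> A" using A by simp
    have "1 * A \<le> (3 + A) * (3 + A - 2)" using A by (intro mult_mono) auto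
    then have "A * 1 \<le> (3 + A) * (3 + A - 2) * (3 + A + 1)" using A by (intro mult_mono) auto
    then show "A \<le> (3 + A) * (3 + A - 2) * (3 + A + 1)" by simp
  qed (use A in \<open>auto intro!: continuous_intros\<close>)
  then obtain m1 where m1: "839/400 \<le> m1" "m1 * (m1 - 2) * (m1 + 1) = A" by blast
  define d where "d = 3 * m1\<^sup>2 - 2 * m1 - 9"
  have "(839/400 - 1/3)\<^sup>2 \<le> (m1 - 1/3)\<^sup>2" using m1 by (intro power_mono) auto
  then have d: "0 < d" by (simp add: d_def power2_eq_square algebra_simps)
  define m0 where "m0 = Complex ((1 - m1) / 2) (sqrt d / 2)"
  have A_eq: "complex_of_real A = of_real m1 * (of_real m1 - 2) * (of_real m1 + 1)"
    unfolding m1(2)[symmetric] by simp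
  have sum: "m0 + cnj m0 = 1 - of_real m1"
    by (simp add: complex_eq_iff m0_def)
  have "m0 * cnj m0 = of_real ((1 - m1)\<^sup>2 / 4 + d / 4)"
    using d by (simp add: complex_mult_cnj m0_def power_divide)
  also have "(1 - m1)\<^sup>2 / 4 + d / 4 = m1\<^sup>2 - m1 - 2"
    by (simp add: d_def power2_eq_square field_simps)
  finally have prod: "m0 * cnj m0 = of_real m1 ^ 2 - of_real m1 - 2" by simp
  have factor: "m * (m - 2) * (m + 1) - of_real A = (m - of_real m1) * (m - m0) * (m - cnj m0)" for m
  proof -
    have "(m - of_real m1) * (m - m0) * (m - cnj m0)
        = (m - of_real m1) * (m ^ 2 - (m0 + cnj m0) * m + m0 * cnj m0)"
      by (simp add: algebra_simps power2_eq_square)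
    also have "\<dots> = m * (m - 2) * (m + 1) - of_real A"
      unfolding sum prod A_eq by (simp add: algebra_simps power2_eq_square)
    finally show ?thesis by simp
  qed
  show ?thesis
  proof (rule that[of m1 m0])
    show "2 < m1" using m1 by simp
    show "of_real m1 * (of_real m1 - 2) * (of_real m1 + 1) = (of_real A :: complex)" using A_eq by simp
    show "m0 * (m0 - 2) * (m0 + 1) = of_real A" using factor[of m0] by simp
    show "0 < Im m0" using d by (simp add: m0_def)
    show "Re m0 = (1 - m1) / 2" "Re m0 < - 1 / 2" using m1 by (auto simp: m0_def)
    fix m :: complex assume "m * (m - 2) * (m + 1) = of_real A"
    then show "m = of_real m1 \<or> m = m0 \<or> m = cnj m0" using factor[of m] by simp
  qed
qed

text \<open>\<open>Z\<close> is a quadratic polynomial in \<open>m\<close> with leading coefficient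
  \<open>R\<close>, hence \<open>R\<close> is its second divided difference at \<open>a\<close>,
  \<open>b\<close>, \<open>c\<close>. The second divided difference of \<open>(1 + m) Z m\<close> is
  \<open>P\<close>: its cubic term contributes \<open>R (a + b + c) = R\<close>, its quadratic term
  \<open>P - R\<close>.\<close>

lemma lagrange_coefficients:
  fixes a b c :: complex and P Q R :: complex
  assumes "a \<noteq> b" "b \<noteq> c" "a \<noteq> c" "a + b + c = 1"
  defines "Z \<equiv> \<lambda>m. (m - 2) * P + Q + m * (m - 2) * R"
  shows "R = Z a / ((a - b) * (a - c)) + Z b / ((b - a) * (b - c)) + Z c / ((c - a) * (c - b))"
    and "P = (1 + a) * Z a / ((a - b) * (a - c)) + (1 + b) * Z b / ((b - a) * (b - c))
           + (1 + c) * Z c / ((c - a) * (c - b))"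
proof -
  have nz: "a - b \<noteq> 0" "b - c \<noteq> 0" "a - c \<noteq> 0" using assms by auto
  have c: "c = 1 - a - b" using assms(4) by (simp add: algebra_simps)
  define D where "D = (a - b) * (b - c) * (a - c)"
  have D: "D \<noteq> 0" using nz by (simp add: D_def)
  have e: "1 / ((a - b) * (a - c)) = (b - c) / D" "1 / ((b - a) * (b - c)) = - (a - c) / D"
    "1 / ((c - a) * (c - b)) = (a - b) / D"
    using nz unfolding D_def by (auto simp: divide_simps) (auto simp: algebra_simps)
  have "Z a * (b - c) - Z b * (a - c) + Z c * (a - b) = R * D"
    unfolding Z_def D_def by algebra
  then have "R = (Z a * (b - c) - Z b * (a - c) + Z c * (a - b)) / D"
    using D by (simp add: nonzero_eq_divide_eq)
  also have "\<dots> = Z a * ((b - c) / D) + Z b * (- (a - c) / D) + Z c * ((a - b) / D)"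
    by (simp add: divide_inverse algebra_simps)
  finally have "R = \<dots>" .
  then show "R = Z a / ((a - b) * (a - c)) + Z b / ((b - a) * (b - c)) + Z c / ((c - a) * (c - b))"
    unfolding e[symmetric] by simp
  have "(1 + a) * Z a * (b - c) - (1 + b) * Z b * (a - c) + (1 + c) * Z c * (a - b) = P * D"
    unfolding Z_def D_def using assms(4) by algebra
  then have "P = ((1 + a) * Z a * (b - c) - (1 + b) * Z b * (a - c) + (1 + c) * Z c * (a - b)) / D"
    using D by (simp add: nonzero_eq_divide_eq)
  also have "\<dots> = (1 + a) * Z a * ((b - c) / D) + (1 + b) * Z b * (- (a - c) / D) + (1 + c) * Z c * ((a - b) / D)"
    by (simp add: divide_inverse algebra_simps)
  finally have "P = \<dots>" .
  then show "P = (1 + a) * Z a / ((a - b) * (a - c)) + (1 + b) * Z b / ((b - a) * (b - c))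
           + (1 + c) * Z c / ((c - a) * (c - b))"
    unfolding e[symmetric] by simp
qed

section \<open>Expansion of the profile\<close>

lemma exp_decay:
  fixes b c :: real
  assumes "0 < b"
  shows "((\<lambda>s. c * exp (- b * s)) \<longlongrightarrow> 0) at_top"
proof -
  have "((\<lambda>s. c * exp (- b * s)) \<longlongrightarrow> c * 0) at_top"
    using assms by (intro tendsto_mult tendsto_const filterlim_compose[OF exp_at_bot])
      (auto intro!: filterlim_tendsto_pos_mult_at_top[OF tendsto_const _ filterlim_ident]
        simp: filterlim_uminus_at_bot)
  then show ?thesis by simp
qed

section \<open>The profile in the variable \<open>ln y\<close>\<close>

context flow4
begin

definition X1 where "X1 s = w (exp s)"
definition X2 where "X2 s = (exp s)\<^sup>2 * g (exp s)"
definition X3 where "X3 s = J (exp s) / exp s"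
definition U where "U s = u (exp s)"
definition \<delta> where "\<delta> s = 1 / U s ^ 4 - 1 / slope ^ 4"

lemma U_ge: "0 \<le> s \<Longrightarrow> Q 1 \<le> U s"
  using u_ge[of "exp s"] by (simp add: U_def)

lemma at_exp: "at (exp s) within {0..} = at (exp s :: real)"
  by (rule at_within_pos) simp

lemma dX1: "(X1 has_real_derivative X2 s) (at s)"
proof -
  have "(w has_real_derivative exp s * g (exp s)) (at (exp s))"
    using dw[of "exp s"] by (simp add: at_exp)
  from DERIV_chain2[OF this DERIV_exp] show ?thesis
    by (simp add: X1_def[abs_def] X2_def power2_eq_square mult_ac)
qed

lemma dX3: "(X3 has_real_derivative X1 s - X3 s) (at s)"
proof -
  have "(J has_real_derivative w (exp s)) (at (exp s))"
    using dJw[of "exp s"] by (simp add: at_exp)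
  from DERIV_chain2[OF this DERIV_exp]
  have "((\<lambda>s. J (exp s)) has_real_derivative w (exp s) * exp s) (at s)" .
  then have "((\<lambda>s. J (exp s) / exp s) has_real_derivative
      (w (exp s) * exp s * exp s - J (exp s) * exp s) / (exp s * exp s)) (at s)"
    by (intro DERIV_divide DERIV_exp) auto
  then show ?thesis by (simp add: X3_def[abs_def] X1_def diff_divide_distrib)
qed

lemma dX2: "(X2 has_real_derivative 2 * X2 s + X3 s / U s ^ 4) (at s)"
proof -
  have "(g has_real_derivative p (exp s) * J (exp s)) (at (exp s))"
    using dg[of "exp s"] by (simp add: at_exp)
  from DERIV_chain2[OF this DERIV_exp]
  have "((\<lambda>s. g (exp s)) has_real_derivative p (exp s) * J (exp s) * exp s) (at s)" .
  then have "(X2 has_real_derivative 2 * (exp s * exp s * g (exp s))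
      + (exp s)\<^sup>2 * (p (exp s) * J (exp s) * exp s)) (at s)"
    unfolding X2_def[abs_def] by (auto intro!: derivative_eq_intros)
  moreover have "(exp s)\<^sup>2 * (p (exp s) * J (exp s) * exp s) = X3 s / U s ^ 4"
  proof -
    have "f (exp s) \<noteq> 0" using f_ge_half[of "exp s"] by auto
    then show ?thesis
      by (simp add: p4 X3_def U_def u_def field_simps power2_eq_square power4_eq_xxxx)
  qed
  ultimately show ?thesis by (simp add: X2_def power2_eq_square)
qed

lemma dU: "(U has_real_derivative exp (- s) * X1 s) (at s)"
proof -
  have "(u has_real_derivative w (exp s) / (exp s)\<^sup>2) (at (exp s))"
    using du[of "exp s"] by (simp add: at_exp)
  from DERIV_chain2[OF this DERIV_exp]
  have "((\<lambda>s. u (exp s)) has_real_derivative w (exp s) / (exp s)\<^sup>2 * exp s) (at s)" .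
  moreover have "w (exp s) / (exp s)\<^sup>2 * exp s = exp (- s) * X1 s"
    by (simp add: X1_def exp_minus power2_eq_square field_simps)
  ultimately show ?thesis by (simp add: U_def[abs_def])
qed

lemma U_tendsto: "(U \<longlongrightarrow> slope) at_top"
  unfolding U_def[abs_def] by (rule filterlim_compose[OF slope exp_at_top])

lemma delta_bound:
  "\<exists>C\<ge>0. \<forall>s\<ge>0. \<bar>\<delta> s\<bar> \<le> C * \<bar>U s - slope\<bar>"
proof (intro exI conjI allI impI)
  show "0 \<le> 4 / Q 1 ^ 5" using Q1_pos by simp
  show "\<bar>\<delta> s\<bar> \<le> 4 / Q 1 ^ 5 * \<bar>U s - slope\<bar>" if "0 \<le> s" for s
    unfolding \<delta>_def by (rule inverse_fourth_diff[OF Q1_pos U_ge[OF that] slope_ge])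
qed

definition Z :: "complex \<Rightarrow> real \<Rightarrow> complex" where
  "Z m s = (m - 2) * of_real (X1 s) + of_real (X2 s) + m * (m - 2) * of_real (X3 s)"

text \<open>\<open>(m - 2, 1, m (m - 2))\<close> is a left eigenvector of the limiting system.\<close>
lemma dZ:
  assumes m: "m * (m - 2) * (m + 1) = of_real (1 / slope ^ 4)"
  shows "(Z m has_vector_derivative m * Z m s + of_real (\<delta> s * X3 s)) (at s)"
proof -
  have r: "((\<lambda>s. complex_of_real (h s)) has_vector_derivative of_real d) (at s)"
    if "(h has_real_derivative d) (at s)" for h d
    using that by (rule has_vector_derivative_of_real)
  have d: "(Z m has_vector_derivative (m - 2) * of_real (X2 s) + of_real (2 * X2 s + X3 s / U s ^ 4)
      + m * (m - 2) * of_real (X1 s - X3 s)) (at s)"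
    unfolding Z_def[abs_def]
    by (intro has_vector_derivative_add has_vector_derivative_mult_right r dX1 dX2 dX3)
  have "X3 s / U s ^ 4 = \<delta> s * X3 s + 1 / slope ^ 4 * X3 s"
    by (simp add: \<delta>_def algebra_simps)
  then have h: "complex_of_real (2 * X2 s + X3 s / U s ^ 4)
      = 2 * of_real (X2 s) + of_real (\<delta> s * X3 s) + m * (m - 2) * (m + 1) * of_real (X3 s)"
    by (simp add: m)
  have "(m - 2) * of_real (X2 s) + of_real (2 * X2 s + X3 s / U s ^ 4)
      + m * (m - 2) * of_real (X1 s - X3 s) = m * Z m s + of_real (\<delta> s * X3 s)"
    unfolding Z_def of_real_diff h by algebra
  with d show ?thesis by simp
qed

lemma Z_cnj: "Z (cnj m) s = cnj (Z m s)"
  by (simp add: Z_def)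

text \<open>The gain from \<open>\<sigma>\<close> to \<open>1 + 2 \<sigma>\<close> drives the iteration that improves the decay rate.\<close>
lemma perturbation_bound:
  assumes X: "\<And>s. 0 \<le> s \<Longrightarrow> \<bar>X1 s\<bar> \<le> C * exp (- \<sigma> * s)" "\<And>s. 0 \<le> s \<Longrightarrow> \<bar>X3 s\<bar> \<le> C * exp (- \<sigma> * s)"
    and \<sigma>: "- 1 < \<sigma>"
  shows "\<exists>C'. \<forall>s\<ge>0. norm (complex_of_real (\<delta> s * X3 s)) \<le> C' * exp (- (1 + 2 * \<sigma>) * s)"
proof -
  \<comment> \<open>\<open>U' = exp (- s) * X1\<close> is the case \<open>\<mu> = 0\<close>; the
    extra factor \<open>exp (- s)\<close> raises the rate from \<open>\<sigma>\<close> to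
    \<open>1 + \<sigma>\<close>. The product with \<open>X3\<close> adds another
    \<open>\<sigma>\<close>.\<close>
  have "\<exists>k C'. \<forall>s\<ge>0. norm (complex_of_real (U s) - k * exp (0 * of_real s)) \<le> C' * exp (- (1 + \<sigma>) * s)"
  proof (rule leading_coefficient)
    fix s :: real assume s: "0 \<le> s"
    show "((\<lambda>s. complex_of_real (U s)) has_vector_derivative 0 * of_real (U s)
        + of_real (exp (- s) * X1 s)) (at s)"
      using has_vector_derivative_of_real[OF dU[of s]] by simp
    have "norm (complex_of_real (exp (- s) * X1 s)) = exp (- s) * \<bar>X1 s\<bar>" by (simp add: norm_mult abs_mult)
    also have "\<dots> \<le> exp (- s) * (C * exp (- \<sigma> * s))" by (intro mult_left_mono X s) auto
    also have "\<dots> = C * exp (- (1 + \<sigma>) * s)" by (simp add: exp_add[symmetric] algebra_simps)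
    finally show "norm (complex_of_real (exp (- s) * X1 s)) \<le> C * exp (- (1 + \<sigma>) * s)" .
  qed (use \<sigma> in auto)
  then obtain k C1 where k: "\<And>s. 0 \<le> s \<Longrightarrow> norm (complex_of_real (U s) - k) \<le> C1 * exp (- (1 + \<sigma>) * s)"
    by auto
  have "((\<lambda>s. complex_of_real (U s) - k) \<longlongrightarrow> 0) at_top"
    by (rule Lim_null_comparison[OF _ exp_decay[of "1 + \<sigma>" C1]])
       (use k \<sigma> in \<open>auto simp: eventually_at_top_linorder\<close>)
  then have "((\<lambda>s. complex_of_real (U s)) \<longlongrightarrow> k) at_top" by (simp add: LIM_zero_iff)
  moreover have "((\<lambda>s. complex_of_real (U s)) \<longlongrightarrow> of_real slope) at_top"
    by (intro tendsto_of_real U_tendsto)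
  ultimately have "k = of_real slope" using tendsto_unique trivial_limit_at_top_linorder by blast
  then have U1: "\<bar>U s - slope\<bar> \<le> C1 * exp (- (1 + \<sigma>) * s)" if "0 \<le> s" for s
    using k[OF that] by (simp add: of_real_diff[symmetric] del: of_real_diff)
  obtain C2 where C2: "0 \<le> C2" "\<And>s. 0 \<le> s \<Longrightarrow> \<bar>\<delta> s\<bar> \<le> C2 * \<bar>U s - slope\<bar>" using delta_bound by blast
  have "norm (complex_of_real (\<delta> s * X3 s)) \<le> (C2 * C1 * C) * exp (- (1 + 2 * \<sigma>) * s)" if s: "0 \<le> s" for s
  proof -
    have C1: "0 \<le> C1 * exp (- (1 + \<sigma>) * s)" using U1[OF s] by (meson abs_ge_zero order_trans)
    have "\<bar>\<delta> s\<bar> \<le> C2 * \<bar>U s - slope\<bar>" by (rule C2(2)[OF s])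
    also have "\<dots> \<le> C2 * (C1 * exp (- (1 + \<sigma>) * s))" by (intro mult_left_mono U1 s C2)
    finally have "\<bar>\<delta> s\<bar> * \<bar>X3 s\<bar> \<le> C2 * (C1 * exp (- (1 + \<sigma>) * s)) * (C * exp (- \<sigma> * s))"
      using X(2)[OF s] C1 C2(1) by (intro mult_mono) auto
    also have "\<dots> = (C2 * C1 * C) * (exp (- (1 + \<sigma>) * s) * exp (- \<sigma> * s))" by (simp add: mult_ac)
    also have "exp (- (1 + \<sigma>) * s) * exp (- \<sigma> * s) = exp (- (1 + 2 * \<sigma>) * s)"
      by (simp add: exp_add[symmetric] algebra_simps)
    finally show ?thesis by (simp add: norm_mult)
  qed
  then show ?thesis by blast
qed

lemma exp_bound_mono:
  assumes "\<And>s. 0 \<le> s \<Longrightarrow> norm (h s) \<le> C * exp (- \<alpha> * s)" "\<beta> \<le> \<alpha>" "0 \<le> s"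
  shows "norm (h s) \<le> C * exp (- \<beta> * s)"
proof -
  have "0 \<le> C" using assms(1)[of 0] norm_ge_zero[of "h 0"] by (simp del: norm_ge_zero)
  moreover have "\<beta> * s \<le> \<alpha> * s" using assms by (intro mult_right_mono) auto
  ultimately have "C * exp (- \<alpha> * s) \<le> C * exp (- \<beta> * s)" by (intro mult_left_mono) auto
  then show ?thesis using assms(1)[OF assms(3)] by linarith
qed

text \<open>The forcing \<open>\<delta> X3\<close> is quadratic in decaying quantities, so the
  remainder is of the order of the square of the leading correction \<open>exp ((m0 - 1) s)\<close>.
  The growing component is removed first; afterwards the decay of the stable pair and that of the
  forcing improve each other until the rate \<open>- Re m0\<close> is reached.\<close>

lemma expansion_log:
  "\<exists>m0 K C. m0 * (m0 - 2) * (m0 + 1) = of_real (1 / slope ^ 4) \<and> Re m0 < - 1 / 2 \<and> 0 < Im m0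
     \<and> (\<forall>m. m * (m - 2) * (m + 1) = of_real (1 / slope ^ 4) \<longrightarrow> Re m < 1 \<longrightarrow> Re m \<le> Re m0)
     \<and> (\<forall>s\<ge>0. \<bar>U s - slope - Re (K * exp ((m0 - 1) * of_real s))\<bar> \<le> C * exp (2 * (Re m0 - 1) * s))"
proof -
  define A where "A = 1 / slope ^ 4"
  \<comment> \<open>\<open>(25 / 28)^4 = 0.6355...\<close>, which leaves just enough room.\<close>
  have A: "127 / 200 \<le> A"
  proof -
    have "slope ^ 4 \<le> (28 / 25) ^ 4" using slope_bound slope_pos by (intro power_mono) auto
    then have "1 / (28 / 25) ^ 4 \<le> A" unfolding A_def using slope_pos by (intro divide_left_mono) auto
    then show ?thesis by (simp add: power_divide)
  qed
  obtain m1 :: real and m0 :: complex where m: "2 < m1"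
    "of_real m1 * (of_real m1 - 2) * (of_real m1 + 1) = (of_real A :: complex)"
    "m0 * (m0 - 2) * (m0 + 1) = of_real A" "0 < Im m0" "Re m0 = (1 - m1) / 2" "Re m0 < - 1 / 2"
    "\<And>m :: complex. m * (m - 2) * (m + 1) = of_real A \<Longrightarrow> m = of_real m1 \<or> m = m0 \<or> m = cnj m0"
    by (rule char_roots[OF A]) blast
  define \<rho> where "\<rho> = - Re m0"
  have \<rho>: "1 / 2 < \<rho>" using m by (simp add: \<rho>_def)
  let ?M = "complex_of_real m1"
  note dZ1 = dZ[OF m(2)[unfolded A_def]] and dZ0 = dZ[OF m(3)[unfolded A_def]]
  let ?F = "\<lambda>s. complex_of_real (\<delta> s * X3 s)"
  \<comment> \<open>Denominators of the Lagrange formula at \<open>m1\<close> and \<open>m0\<close>.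
    The one at \<open>cnj m0\<close> is conjugate to \<open>D0\<close>, so the complex pair
    contributes twice a real part.\<close>
  define D1 where "D1 = (?M - m0) * (?M - cnj m0)"
  define D0 where "D0 = (m0 - ?M) * (m0 - cnj m0)"
  have dist: "?M \<noteq> m0" "m0 \<noteq> cnj m0" "?M \<noteq> cnj m0" "?M + m0 + cnj m0 = 1"
    using m(4,5) by (auto simp: complex_eq_iff)
  have cnjD: "(cnj m0 - ?M) * (cnj m0 - m0) = cnj D0" by (simp add: D0_def)
  have two_re: "x + cnj x = 2 * of_real (Re x)" for x by (simp add: complex_eq_iff)
  have D1: "D1 \<noteq> 0" using dist by (simp add: D1_def)
  have X3_eq: "complex_of_real (X3 s) = Z ?M s / D1 + 2 * of_real (Re (Z m0 s / D0))" for s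
  proof -
    have "complex_of_real (X3 s) = Z ?M s / D1 + Z m0 s / D0 + Z (cnj m0) s / cnj D0"
      using lagrange_coefficients(1)[OF dist(1,2,3,4), of "of_real (X3 s)" "of_real (X1 s)" "of_real (X2 s)"]
      unfolding Z_def[symmetric] cnjD unfolding D1_def D0_def by blast
    also have "\<dots> = Z ?M s / D1 + (Z m0 s / D0 + cnj (Z m0 s / D0))" by (simp add: Z_cnj)
    finally show ?thesis unfolding two_re .
  qed
  have X1_eq: "complex_of_real (X1 s) = (1 + ?M) * Z ?M s / D1 + 2 * of_real (Re ((1 + m0) * Z m0 s / D0))" for s
  proof -
    have "complex_of_real (X1 s) = (1 + ?M) * Z ?M s / D1 + (1 + m0) * Z m0 s / D0 + (1 + cnj m0) * Z (cnj m0) s / cnj D0"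
      using lagrange_coefficients(2)[OF dist(1,2,3,4), of "of_real (X1 s)" "of_real (X2 s)" "of_real (X3 s)"]
      unfolding Z_def[symmetric] cnjD unfolding D1_def D0_def by blast
    also have "\<dots> = (1 + ?M) * Z ?M s / D1 + ((1 + m0) * Z m0 s / D0 + cnj ((1 + m0) * Z m0 s / D0))"
      by (simp add: Z_cnj)
    finally show ?thesis unfolding two_re .
  qed
  define L where "L = (1 + cmod (1 + ?M)) / cmod D1 + 2 * (1 + cmod (1 + m0)) / cmod D0"
  have combine: "\<bar>X3 s\<bar> \<le> L * B \<and> \<bar>X1 s\<bar> \<le> L * B"
    if "norm (Z ?M s) \<le> B" "norm (Z m0 s) \<le> B" for s B
  proof -
    have B: "0 \<le> B" using that(1) norm_ge_zero order_trans by blast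
    have "\<bar>X3 s\<bar> = norm (complex_of_real (X3 s))" by simp
    also have "\<dots> \<le> norm (Z ?M s / D1) + 2 * norm (Z m0 s / D0)"
      unfolding X3_eq using abs_Re_le_cmod[of "Z m0 s / D0"]
      by (intro order_trans[OF norm_triangle_ineq]) (simp add: norm_mult)
    also have "\<dots> \<le> 1 / cmod D1 * B + 2 * (1 / cmod D0 * B)"
      using that by (auto simp: norm_divide intro!: add_mono divide_right_mono)
    also have "\<dots> \<le> (1 + cmod (1 + ?M)) / cmod D1 * B + 2 * ((1 + cmod (1 + m0)) / cmod D0 * B)"
      using B by (intro add_mono mult_left_mono mult_right_mono divide_right_mono) auto
    also have "\<dots> = L * B" by (simp add: L_def algebra_simps)
    finally have 3: "\<bar>X3 s\<bar> \<le> L * B" .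
    have "\<bar>X1 s\<bar> = norm (complex_of_real (X1 s))" by simp
    also have "\<dots> \<le> norm ((1 + ?M) * Z ?M s / D1) + 2 * norm ((1 + m0) * Z m0 s / D0)"
      unfolding X1_eq using abs_Re_le_cmod[of "(1 + m0) * Z m0 s / D0"]
      by (intro order_trans[OF norm_triangle_ineq]) (simp add: norm_mult)
    also have "\<dots> = cmod (1 + ?M) / cmod D1 * norm (Z ?M s) + 2 * (cmod (1 + m0) / cmod D0 * norm (Z m0 s))"
      by (simp add: norm_mult norm_divide)
    also have "\<dots> \<le> (1 + cmod (1 + ?M)) / cmod D1 * B + 2 * ((1 + cmod (1 + m0)) / cmod D0 * B)"
      using B that by (intro add_mono mult_left_mono mult_mono divide_right_mono) auto
    also have "\<dots> = L * B" by (simp add: L_def algebra_simps)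
    finally show ?thesis using 3 by blast
  qed
  have L0: "0 \<le> L" by (auto simp: L_def intro!: add_nonneg_nonneg divide_nonneg_nonneg mult_nonneg_nonneg)
  \<comment> \<open>the growing mode is absent because \<open>J\<close> grows at most like \<open>y\<^sup>3\<^sup>/\<^sup>2\<close>\<close>
  obtain CJ where CJ: "\<And>s. 0 \<le> s \<Longrightarrow> \<bar>X3 s\<bar> \<le> CJ * exp (1 / 2 * s)"
  proof
    fix s :: real assume s: "0 \<le> s"
    have "\<bar>J (exp s)\<bar> / exp s \<le> (\<bar>J 1\<bar> - E 1 + 1 / 6) * exp s powr (3/2) / exp s"
      using J_growth[of "exp s"] s by (intro divide_right_mono) auto
    also have "\<dots> = (\<bar>J 1\<bar> - E 1 + 1 / 6) * exp (1 / 2 * s)"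
    proof -
      have "exp s powr (3/2) / exp s = exp (1 / 2 * s)" by (simp add: powr_def exp_diff[symmetric])
      then show ?thesis by (simp only: times_divide_eq_right[symmetric])
    qed
    finally show "\<bar>X3 s\<bar> \<le> (\<bar>J 1\<bar> - E 1 + 1 / 6) * exp (1 / 2 * s)" by (simp add: X3_def)
  qed
  \<comment> \<open>The a priori estimates just suffice: \<open>slope_rate\<close> gives
    \<open>\<delta>\<close> the decay \<open>exp (- s / 2)\<close>, which compensates the growth
    \<open>exp (s / 2)\<close> of \<open>X3\<close>.\<close>
  have F0: "\<exists>C. \<forall>s\<ge>0. norm (?F s) \<le> C * exp (- 0 * s)"
  proof -
    obtain C2 where C2: "0 \<le> C2" "\<And>s. 0 \<le> s \<Longrightarrow> \<bar>\<delta> s\<bar> \<le> C2 * \<bar>U s - slope\<bar>" using delta_bound by blast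
    define e where "e = - E 1 + 1 / 2"
    have U1: "\<bar>U s - slope\<bar> \<le> e * exp (- (1 / 2) * s)" if "0 \<le> s" for s
      using slope_rate[of "exp s"] that by (simp add: U_def e_def powr_def)
    have e: "0 \<le> e" using E_le[of 1] by (simp add: e_def)
    have "norm (?F s) \<le> C2 * e * CJ * exp (- 0 * s)" if s: "0 \<le> s" for s
    proof -
      have "\<bar>\<delta> s\<bar> \<le> C2 * \<bar>U s - slope\<bar>" by (rule C2(2)[OF s])
      also have "\<dots> \<le> C2 * (e * exp (- (1 / 2) * s))" by (intro mult_left_mono U1 s C2)
      finally have "\<bar>\<delta> s\<bar> * \<bar>X3 s\<bar> \<le> C2 * (e * exp (- (1 / 2) * s)) * (CJ * exp (1 / 2 * s))"
        using CJ[OF s] e C2(1) by (intro mult_mono) auto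
      also have "\<dots> = C2 * e * CJ * (exp (- (1 / 2) * s) * exp (1 / 2 * s))" by (simp add: mult_ac)
      also have "exp (- (1 / 2) * s) * exp (1 / 2 * s) = 1" by (simp add: exp_add[symmetric])
      finally show ?thesis by (simp add: norm_mult)
    qed
    then show ?thesis by blast
  qed
  then obtain CF where CF: "\<And>s. 0 \<le> s \<Longrightarrow> norm (?F s) \<le> CF * exp (- 0 * s)" by blast
  obtain k1 C1 where k1: "\<And>s. 0 \<le> s \<Longrightarrow> norm (Z ?M s - k1 * exp (?M * of_real s)) \<le> C1 * exp (- 0 * s)"
  proof -
    have "\<exists>k1 C1. \<forall>s\<ge>0. norm (Z ?M s - k1 * exp (?M * of_real s)) \<le> C1 * exp (- 0 * s)"
      by (rule leading_coefficient[OF dZ1 CF]) (use m(1) in auto)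
    then show ?thesis using that by blast
  qed
  \<comment> \<open>The forcing is merely bounded so far, and \<open>stable_bound\<close> wants a
    strictly smaller rate; a growth \<open>exp (s / 4)\<close> is therefore conceded. It is slow
    enough for the iteration to start, as \<open>1 + 2 * (-1/4)\<close> is positive.\<close>
  obtain C0 where C0: "\<And>s. 0 \<le> s \<Longrightarrow> norm (Z m0 s) \<le> C0 * exp (- (-1/4) * s)"
  proof -
    have "\<exists>C0. \<forall>s\<ge>0. norm (Z m0 s) \<le> C0 * exp (- (-1/4) * s)"
      by (rule stable_bound[OF dZ0 CF]) (use m(6) in auto)
    then show ?thesis using that by blast
  qed
  have C01: "0 \<le> C0" "0 \<le> C1"
  proof -
    have "norm (Z m0 0) \<le> C0" using C0[of 0] by simp
    then show "0 \<le> C0" using norm_ge_zero order_trans by blast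
    have "norm (Z ?M 0 - k1) \<le> C1" using k1[of 0] by simp
    then show "0 \<le> C1" using norm_ge_zero order_trans by blast
  qed
  have "k1 = 0"
  proof (rule no_growing_part)
    fix s :: real assume s: "0 \<le> s"
    have "Z ?M s = D1 * (of_real (X3 s) - 2 * of_real (Re (Z m0 s / D0)))"
      using X3_eq[of s] D1 by (simp add: field_simps)
    then have "norm (Z ?M s) = cmod D1 * norm (complex_of_real (X3 s - 2 * Re (Z m0 s / D0)))"
      by (simp add: norm_mult)
    also have "\<dots> \<le> cmod D1 * (\<bar>X3 s\<bar> + 2 * (cmod (Z m0 s) / cmod D0))"
    proof (intro mult_left_mono)
      have "norm (complex_of_real (X3 s - 2 * Re (Z m0 s / D0))) = \<bar>X3 s - 2 * Re (Z m0 s / D0)\<bar>"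
        by (rule norm_of_real)
      also have "\<dots> \<le> \<bar>X3 s\<bar> + 2 * \<bar>Re (Z m0 s / D0)\<bar>" by simp
      also have "\<bar>Re (Z m0 s / D0)\<bar> \<le> cmod (Z m0 s) / cmod D0"
        using abs_Re_le_cmod[of "Z m0 s / D0"] by (simp add: norm_divide)
      finally show "norm (complex_of_real (X3 s - 2 * Re (Z m0 s / D0))) \<le> \<bar>X3 s\<bar> + 2 * (cmod (Z m0 s) / cmod D0)"
        by simp
    qed auto
    also have "\<dots> \<le> cmod D1 * (CJ * exp (1 / 2 * s) + 2 * (C0 / cmod D0 * exp (1 / 2 * s)))"
    proof -
      have "cmod (Z m0 s) \<le> C0 * exp (- (-1/4) * s)" by (rule C0[OF s])
      also have "\<dots> \<le> C0 * exp (1 / 2 * s)" using C01 s by (intro mult_left_mono) auto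
      finally have "cmod (Z m0 s) / cmod D0 \<le> C0 / cmod D0 * exp (1 / 2 * s)"
        by (simp add: divide_right_mono)
      then show ?thesis using CJ[OF s] by (intro mult_left_mono add_mono) auto
    qed
    finally have "norm (Z ?M s) \<le> cmod D1 * (CJ + 2 * (C0 / cmod D0)) * exp (1 / 2 * s)"
      by (simp add: algebra_simps)
    moreover have "C1 \<le> C1 * exp (1 / 2 * s)" using C01 s mult_left_mono[of 1 "exp (1 / 2 * s)" C1] by simp
    moreover have "norm (k1 * exp (?M * of_real s)) \<le> norm (Z ?M s) + norm (Z ?M s - k1 * exp (?M * of_real s))"
      by (metis norm_minus_commute norm_triangle_sub)
    ultimately show "norm (k1 * exp (?M * of_real s)) \<le> (cmod D1 * (CJ + 2 * (C0 / cmod D0)) + C1) * exp (1 / 2 * s)"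
      using k1[OF s] by (simp add: algebra_simps)
  qed (use m in simp)
  then have Z1_bdd: "norm (Z ?M s) \<le> C1 * exp (- 0 * s)" if "0 \<le> s" for s using k1[OF that] by simp
  define P where "P \<sigma> \<longleftrightarrow> (\<exists>C. \<forall>s\<ge>0. \<bar>X1 s\<bar> \<le> C * exp (- \<sigma> * s) \<and> \<bar>X3 s\<bar> \<le> C * exp (- \<sigma> * s))" for \<sigma>
  have combineP: "P \<sigma>" if "\<And>s. 0 \<le> s \<Longrightarrow> norm (Z ?M s) \<le> B1 * exp (- \<sigma> * s)"
    "\<And>s. 0 \<le> s \<Longrightarrow> norm (Z m0 s) \<le> B0 * exp (- \<sigma> * s)" for B1 B0 \<sigma>
  proof -
    have "\<bar>X3 s\<bar> \<le> L * (max B1 B0 * exp (- \<sigma> * s)) \<and> \<bar>X1 s\<bar> \<le> L * (max B1 B0 * exp (- \<sigma> * s))" if "0 \<le> s" for s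
    proof (rule combine)
      show "norm (Z ?M s) \<le> max B1 B0 * exp (- \<sigma> * s)"
        by (rule order_trans[OF \<open>\<And>s. 0 \<le> s \<Longrightarrow> norm (Z ?M s) \<le> B1 * exp (- \<sigma> * s)\<close>[OF that]]) simp
      show "norm (Z m0 s) \<le> max B1 B0 * exp (- \<sigma> * s)"
        by (rule order_trans[OF \<open>\<And>s. 0 \<le> s \<Longrightarrow> norm (Z m0 s) \<le> B0 * exp (- \<sigma> * s)\<close>[OF that]]) simp
    qed
    then show ?thesis unfolding P_def by (intro exI[of _ "L * max B1 B0"]) (simp add: mult.assoc)
  qed
  have base: "P (-1/4)"
    by (rule combineP[OF _ C0]) (rule exp_bound_mono[OF Z1_bdd], auto)
  have Fstep: "\<exists>C. \<forall>s\<ge>0. norm (?F s) \<le> C * exp (- (1 + 2 * \<sigma>) * s)" if "P \<sigma>" "-1/4 \<le> \<sigma>" for \<sigma>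
  proof -
    obtain C where "\<And>s. 0 \<le> s \<Longrightarrow> \<bar>X1 s\<bar> \<le> C * exp (- \<sigma> * s)" "\<And>s. 0 \<le> s \<Longrightarrow> \<bar>X3 s\<bar> \<le> C * exp (- \<sigma> * s)"
      using \<open>P \<sigma>\<close> unfolding P_def by blast
    then show ?thesis by (rule perturbation_bound) (use that(2) in auto)
  qed
  have Z1step: "\<exists>C. \<forall>s\<ge>0. norm (Z ?M s) \<le> C * exp (- (1 + 2 * \<sigma>) * s)" if P: "P \<sigma>" "-1/4 \<le> \<sigma>" for \<sigma>
  proof -
    obtain CF where CF: "\<And>s. 0 \<le> s \<Longrightarrow> norm (?F s) \<le> CF * exp (- (1 + 2 * \<sigma>) * s)" using Fstep[OF P] by blast
    obtain k C where k: "\<And>s. 0 \<le> s \<Longrightarrow> norm (Z ?M s - k * exp (?M * of_real s)) \<le> C * exp (- (1 + 2 * \<sigma>) * s)"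
    proof -
      have "\<exists>k C. \<forall>s\<ge>0. norm (Z ?M s - k * exp (?M * of_real s)) \<le> C * exp (- (1 + 2 * \<sigma>) * s)"
        by (rule leading_coefficient[OF dZ1 CF]) (use m(1) P in auto)
      then show ?thesis using that by blast
    qed
    have "k = 0"
    proof (rule no_growing_part)
      fix s :: real assume s: "0 \<le> s"
      have "norm (Z ?M s - k * exp (?M * of_real s)) \<le> C * exp (- 0 * s)"
        by (rule exp_bound_mono[OF k]) (use s P in auto)
      moreover have "norm (k * exp (?M * of_real s)) \<le> norm (Z ?M s) + norm (Z ?M s - k * exp (?M * of_real s))"
        by (metis norm_minus_commute norm_triangle_sub)
      ultimately show "norm (k * exp (?M * of_real s)) \<le> (C1 + C) * exp (0 * s)"
        using Z1_bdd[OF s] by simp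
    qed (use m in simp)
    then show ?thesis using k by auto
  qed
  \<comment> \<open>For \<open>\<sigma> \<ge> -1/4\<close> the forcing rate
    \<open>1 + 2 \<sigma>\<close> strictly exceeds \<open>\<sigma> + 1/2\<close>, so each round
    gains 1/2 until the stable pair's own rate \<open>\<rho>\<close> is the limit.\<close>
  have step: "P (min \<rho> (\<sigma> + 1 / 2))" if P: "P \<sigma>" "-1/4 \<le> \<sigma>" for \<sigma>
  proof -
    obtain CF where CF: "\<And>s. 0 \<le> s \<Longrightarrow> norm (?F s) \<le> CF * exp (- (1 + 2 * \<sigma>) * s)" using Fstep[OF P] by blast
    obtain B1 where B1: "\<And>s. 0 \<le> s \<Longrightarrow> norm (Z ?M s) \<le> B1 * exp (- (1 + 2 * \<sigma>) * s)" using Z1step[OF P] by blast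
    obtain B0 where B0: "\<And>s. 0 \<le> s \<Longrightarrow> norm (Z m0 s) \<le> B0 * exp (- min \<rho> (\<sigma> + 1 / 2) * s)"
    proof -
      have "\<exists>B0. \<forall>s\<ge>0. norm (Z m0 s) \<le> B0 * exp (- min \<rho> (\<sigma> + 1 / 2) * s)"
        by (rule stable_bound[OF dZ0 CF]) (use P in \<open>auto simp: \<rho>_def\<close>)
      then show ?thesis using that by blast
    qed
    show ?thesis
      by (rule combineP[OF _ B0]) (rule exp_bound_mono[OF B1], use P in auto)
  qed
  have iter: "P (min \<rho> (-1/4 + real n / 2))" for n
  proof (induction n)
    case 0
    then show ?case using base \<rho> by (simp add: min_def)
  next
    case (Suc n)
    have "P (min \<rho> (min \<rho> (-1/4 + real n / 2) + 1 / 2))" by (rule step[OF Suc]) (use \<rho> in auto)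
    moreover have "min \<rho> (min \<rho> (-1/4 + real n / 2) + 1 / 2) = min \<rho> (-1/4 + real (Suc n) / 2)"
      by (auto simp: min_def field_simps)
    ultimately show ?case by simp
  qed
  obtain n :: nat where "2 * (\<rho> + 1) \<le> real n" using real_arch_simple by blast
  then have "min \<rho> (-1/4 + real n / 2) = \<rho>" by auto
  then have P\<rho>: "P \<rho>" using iter[of n] by simp
  obtain CF where CF: "\<And>s. 0 \<le> s \<Longrightarrow> norm (?F s) \<le> CF * exp (- (1 + 2 * \<rho>) * s)"
    using Fstep[OF P\<rho>] \<rho> by force
  obtain B1 where B1: "\<And>s. 0 \<le> s \<Longrightarrow> norm (Z ?M s) \<le> B1 * exp (- (1 + 2 * \<rho>) * s)"
    using Z1step[OF P\<rho>] \<rho> by force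
  obtain k C0 where k: "\<And>s. 0 \<le> s \<Longrightarrow> norm (Z m0 s - k * exp (m0 * of_real s)) \<le> C0 * exp (- (1 + 2 * \<rho>) * s)"
  proof -
    have "\<exists>k C0. \<forall>s\<ge>0. norm (Z m0 s - k * exp (m0 * of_real s)) \<le> C0 * exp (- (1 + 2 * \<rho>) * s)"
      by (rule leading_coefficient[OF dZ0 CF]) (use \<rho> in \<open>auto simp: \<rho>_def\<close>)
    then show ?thesis using that by blast
  qed
  define \<kappa> where "\<kappa> = 2 * (1 + m0) * k / D0"
  define C2 where "C2 = cmod (1 + ?M) / cmod D1 * B1 + 2 * (cmod (1 + m0) / cmod D0 * C0)"
  have X1_exp: "\<bar>X1 s - Re (\<kappa> * exp (m0 * of_real s))\<bar> \<le> C2 * exp (- (1 + 2 * \<rho>) * s)" if s: "0 \<le> s" for s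
  proof -
    have "X1 s = Re ((1 + ?M) * Z ?M s / D1) + 2 * Re ((1 + m0) * Z m0 s / D0)"
      using arg_cong[OF X1_eq[of s], of Re] by simp
    moreover have "Re (\<kappa> * exp (m0 * of_real s)) = 2 * Re ((1 + m0) * (k * exp (m0 * of_real s)) / D0)"
    proof -
      have "\<kappa> * exp (m0 * of_real s) = of_real 2 * ((1 + m0) * (k * exp (m0 * of_real s)) / D0)"
        by (simp add: \<kappa>_def)
      then show ?thesis by (simp only: times_complex.sel complex.sel Re_complex_of_real Im_complex_of_real)
    qed
    moreover have "(1 + m0) / D0 * (Z m0 s - k * exp (m0 * of_real s))
        = (1 + m0) * Z m0 s / D0 - (1 + m0) * (k * exp (m0 * of_real s)) / D0"
      by (simp only: right_diff_distrib times_divide_eq_left)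
    ultimately have eq: "X1 s - Re (\<kappa> * exp (m0 * of_real s)) = Re ((1 + ?M) * Z ?M s / D1)
        + 2 * Re ((1 + m0) / D0 * (Z m0 s - k * exp (m0 * of_real s)))"
      by (simp only: minus_complex.sel) simp
    have "\<bar>x + 2 * y\<bar> \<le> \<bar>x\<bar> + 2 * \<bar>y\<bar>" for x y :: real by linarith
    then have "\<bar>X1 s - Re (\<kappa> * exp (m0 * of_real s))\<bar> \<le> \<bar>Re ((1 + ?M) * Z ?M s / D1)\<bar>
        + 2 * \<bar>Re ((1 + m0) / D0 * (Z m0 s - k * exp (m0 * of_real s)))\<bar>" unfolding eq .
    also have "\<dots> \<le> cmod ((1 + ?M) * Z ?M s / D1)
        + 2 * cmod ((1 + m0) / D0 * (Z m0 s - k * exp (m0 * of_real s)))"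
      by (intro add_mono mult_left_mono abs_Re_le_cmod) auto
    also have "\<dots> = cmod (1 + ?M) / cmod D1 * cmod (Z ?M s)
        + 2 * (cmod (1 + m0) / cmod D0 * cmod (Z m0 s - k * exp (m0 * of_real s)))"
      by (simp add: norm_mult norm_divide)
    also have "\<dots> \<le> cmod (1 + ?M) / cmod D1 * (B1 * exp (- (1 + 2 * \<rho>) * s))
        + 2 * (cmod (1 + m0) / cmod D0 * (C0 * exp (- (1 + 2 * \<rho>) * s)))"
      by (intro add_mono mult_left_mono B1[OF s] k[OF s]) auto
    also have "\<dots> = C2 * exp (- (1 + 2 * \<rho>) * s)" by (simp add: C2_def algebra_simps)
    finally show ?thesis .
  qed
  \<comment> \<open>Integrating \<open>U' = exp (- s) * X1\<close> divides the coefficient of the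
    leading mode by \<open>m0 - 1\<close>. \<open>R\<close> below is \<open>U\<close> without this
    mode, and its limit is the slope.\<close>
  define K where "K = \<kappa> / (m0 - 1)"
  have m01: "m0 - 1 \<noteq> 0" using m(6) by (auto simp: complex_eq_iff)
  define R where "R s = U s - Re (K * exp ((m0 - 1) * of_real s))" for s
  have dR: "(R has_real_derivative exp (- s) * (X1 s - Re (\<kappa> * exp (m0 * of_real s)))) (at s)" for s
  proof -
    have "((\<lambda>s. K * exp ((m0 - 1) * of_real s)) has_vector_derivative K * (exp ((m0 - 1) * of_real s) * (m0 - 1))) (at s)"
      by (rule has_vector_derivative_real_field) (auto intro!: derivative_eq_intros)
    then have "((\<lambda>s. Re (K * exp ((m0 - 1) * of_real s))) has_vector_derivative
        Re (K * (exp ((m0 - 1) * of_real s) * (m0 - 1)))) (at s)"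
      by (rule bounded_linear.has_vector_derivative[OF bounded_linear_Re])
    moreover have "K * (exp ((m0 - 1) * of_real s) * (m0 - 1)) = of_real (exp (- s)) * (\<kappa> * exp (m0 * of_real s))"
    proof -
      have "exp ((m0 - 1) * of_real s) = exp (m0 * of_real s) * of_real (exp (- s))"
        by (simp add: exp_of_real[symmetric] exp_add[symmetric] algebra_simps)
      then show ?thesis using m01 by (simp add: K_def)
    qed
    ultimately have "((\<lambda>s. Re (K * exp ((m0 - 1) * of_real s))) has_real_derivative
        exp (- s) * Re (\<kappa> * exp (m0 * of_real s))) (at s)"
      by (simp add: has_real_derivative_iff_has_vector_derivative)
    from DERIV_diff[OF dU this] show ?thesis unfolding R_def[abs_def] by (simp add: right_diff_distrib)
  qed
  have "\<exists>k C'. \<forall>s\<ge>0. norm (complex_of_real (R s) - k * exp (0 * of_real s)) \<le> C' * exp (- (2 + 2 * \<rho>) * s)"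
  proof (rule leading_coefficient)
    fix s :: real assume s: "0 \<le> s"
    let ?r = "exp (- s) * (X1 s - Re (\<kappa> * exp (m0 * of_real s)))"
    show "((\<lambda>s. complex_of_real (R s)) has_vector_derivative 0 * of_real (R s) + of_real ?r) (at s)"
      using has_vector_derivative_of_real[OF dR[of s]] by simp
    have "norm (complex_of_real ?r) = exp (- s) * \<bar>X1 s - Re (\<kappa> * exp (m0 * of_real s))\<bar>"
      unfolding norm_of_real by (simp add: abs_mult)
    also have "\<dots> \<le> exp (- s) * (C2 * exp (- (1 + 2 * \<rho>) * s))" by (intro mult_left_mono X1_exp s) auto
    also have "\<dots> = C2 * exp (- (2 + 2 * \<rho>) * s)" by (simp add: exp_add[symmetric] algebra_simps)
    finally show "norm (complex_of_real ?r) \<le> C2 * exp (- (2 + 2 * \<rho>) * s)" .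
  qed (use \<rho> in auto)
  then obtain r C3 where r: "\<And>s. 0 \<le> s \<Longrightarrow> norm (complex_of_real (R s) - r) \<le> C3 * exp (- (2 + 2 * \<rho>) * s)"
    by auto
  have "((\<lambda>s. complex_of_real (R s) - r) \<longlongrightarrow> 0) at_top"
    by (rule Lim_null_comparison[OF _ exp_decay[of "2 + 2 * \<rho>" C3]])
       (use r \<rho> in \<open>auto simp: eventually_at_top_linorder\<close>)
  then have lim1: "((\<lambda>s. complex_of_real (R s)) \<longlongrightarrow> r) at_top" by (simp add: LIM_zero_iff)
  have "((\<lambda>s. Re (K * exp ((m0 - 1) * of_real s))) \<longlongrightarrow> 0) at_top"
  proof (rule Lim_null_comparison[OF _ exp_decay[of "1 + \<rho>" "cmod K"]])
    have "norm (Re (K * exp ((m0 - 1) * of_real s))) \<le> cmod K * exp (- (1 + \<rho>) * s)" for s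
      using abs_Re_le_cmod[of "K * exp ((m0 - 1) * of_real s)"]
      by (simp add: norm_mult \<rho>_def algebra_simps del: Re_complex_div_lt_0)
    then show "\<forall>\<^sub>F s in at_top. norm (Re (K * exp ((m0 - 1) * of_real s))) \<le> cmod K * exp (- (1 + \<rho>) * s)" by simp
  qed (use \<rho> in auto)
  from tendsto_diff[OF U_tendsto this]
  have "((\<lambda>s. complex_of_real (R s)) \<longlongrightarrow> of_real slope) at_top"
    unfolding R_def[abs_def] by (intro tendsto_of_real) simp
  then have "r = of_real slope" using tendsto_unique[OF _ lim1] trivial_limit_at_top_linorder by blast
  then have final: "\<bar>U s - slope - Re (K * exp ((m0 - 1) * of_real s))\<bar> \<le> C3 * exp (2 * (Re m0 - 1) * s)"
    if "0 \<le> s" for s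
  proof -
    have "\<bar>R s - slope\<bar> \<le> C3 * exp (- (2 + 2 * \<rho>) * s)"
      using r[OF that] \<open>r = of_real slope\<close> by (simp add: of_real_diff[symmetric] del: of_real_diff)
    then show ?thesis by (simp add: R_def \<rho>_def algebra_simps)
  qed
  have lead: "Re m \<le> Re m0" if "m * (m - 2) * (m + 1) = of_real A" "Re m < 1" for m
    using m(7)[OF that(1)] that(2) m(1) by auto
  show ?thesis
    using m(3,4,6) lead final unfolding A_def by blast
qed

end

section \<open>Test functions and integration\<close>

lemma Ck_real_SucD:
  fixes \<phi> :: "real \<Rightarrow> real"
  assumes "Ck (Suc k) \<phi>"
  shows "(\<phi> has_real_derivative deriv \<phi> x) (at x)" "Ck k (deriv \<phi>)"
proof -
  have d: "\<phi> differentiable (at x)" for x using assms by simp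
  then have D: "(\<phi> has_real_derivative deriv \<phi> x) (at x)" for x
    by (simp add: DERIV_deriv_iff_real_differentiable)
  then show "(\<phi> has_real_derivative deriv \<phi> x) (at x)" .
  have "frechet_derivative \<phi> (at x) 1 = deriv \<phi> x" for x
    using frechet_derivative_at[OF D[of x, unfolded has_field_derivative_def]]
    by (metis mult.right_neutral)
  then have "(\<lambda>x. frechet_derivative \<phi> (at x) 1) = deriv \<phi>" by auto
  then show "Ck k (deriv \<phi>)" using assms by simp
qed

lemma Ck_continuous: "Ck k \<phi> \<Longrightarrow> continuous_on UNIV \<phi>"
proof (cases k)
  case (Suc j)
  assume "Ck k \<phi>"
  then have "\<forall>x. \<phi> differentiable (at x)" using Suc by simp
  then show ?thesis
    by (intro differentiable_imp_continuous_on) (auto simp: differentiable_on_def)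
qed simp

text \<open>The complement of the closed support is open, so every derivative vanishes there as
  well.\<close>

lemma test_function_real:
  fixes \<phi> :: "real \<Rightarrow> real"
  assumes "test_function UNIV \<phi>"
  obtains R where "0 < R" "\<And>n x. ((deriv ^^ n) \<phi> has_real_derivative (deriv ^^ Suc n) \<phi> x) (at x)"
    "\<And>n x. R \<le> \<bar>x\<bar> \<Longrightarrow> (deriv ^^ n) \<phi> x = 0" "\<And>n. continuous_on UNIV ((deriv ^^ n) \<phi>)"
proof -
  have Ck: "\<forall>k. Ck k ((deriv ^^ n) \<phi>)" for n
  proof (induction n)
    case 0 then show ?case using assms by (simp add: test_function_def)
  next
    case (Suc n)
    have "Ck k (deriv ((deriv ^^ n) \<phi>))" for k using Ck_real_SucD(2) Suc by blast
    then show ?case by simp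
  qed
  have D: "((deriv ^^ n) \<phi> has_real_derivative (deriv ^^ Suc n) \<phi> x) (at x)" for n x
    using Ck_real_SucD(1)[of 0 "(deriv ^^ n) \<phi>" x] Ck[of n] by (metis comp_apply funpow.simps(2))
  let ?K = "closure {x. \<phi> x \<noteq> 0}"
  have "bounded ?K" using assms compact_imp_bounded by (auto simp: test_function_def)
  then obtain R0 where R0: "\<And>x. x \<in> ?K \<Longrightarrow> \<bar>x\<bar> \<le> R0" by (auto simp: bounded_iff)
  have zero: "\<forall>x. x \<notin> ?K \<longrightarrow> (deriv ^^ n) \<phi> x = 0" for n
  proof (induction n)
    case 0
    then show ?case using closure_subset[of "{x. \<phi> x \<noteq> 0}"] by auto
  next
    case (Suc n)
    show ?case
    proof (intro allI impI)
      fix x assume x: "x \<notin> ?K"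
      have "((deriv ^^ n) \<phi> has_real_derivative 0) (at x)"
      proof (rule has_field_derivative_transform_within_open[where f = "\<lambda>_. 0"])
        show "open (- ?K)" by auto
        show "\<And>y. y \<in> - ?K \<Longrightarrow> 0 = (deriv ^^ n) \<phi> y" using Suc by auto
      qed (use x in auto)
      then show "(deriv ^^ Suc n) \<phi> x = 0" using DERIV_unique D by blast
    qed
  qed
  show ?thesis
  proof (rule that[of "\<bar>R0\<bar> + 1"])
    fix n x assume "\<bar>R0\<bar> + 1 \<le> \<bar>x\<bar>"
    then have "x \<notin> ?K" using R0 by fastforce
    then show "(deriv ^^ n) \<phi> x = 0" using zero by blast
  qed (use D Ck_continuous[OF Ck[THEN spec]] in auto)
qed

section \<open>Integration by parts against test functions\<close>

lemma integral_of_truncated: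
  fixes F :: "real \<Rightarrow> real"
  assumes c: "continuous_on {a..b} F" and z: "\<And>x. x \<notin> {a..b} \<Longrightarrow> F x = 0"
  shows "integrable lborel F" "(LINT x|lborel. F x) = integral {a..b} F"
proof -
  have i: "set_integrable lborel {a..b} F"
    unfolding set_integrable_def by (rule borel_integrable_compact) (use c in auto)
  have eq: "(\<lambda>x. indicator {a..b} x *\<^sub>R F x) = F"
    using z by (auto simp: indicator_def fun_eq_iff)
  show "integrable lborel F" using i unfolding set_integrable_def eq .
  show "(LINT x|lborel. F x) = integral {a..b} F"
    using set_borel_integral_eq_integral(2)[OF i] unfolding set_lebesgue_integral_def eq .
qed

lemma integral_by_parts_zero:
  fixes U \<phi> :: "real \<Rightarrow> real"
  assumes ab: "a \<le> b"
    and U: "\<And>x. x \<in> {a..b} \<Longrightarrow> (U has_real_derivative U' x) (at x)"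
    and \<phi>: "\<And>x. x \<in> {a..b} \<Longrightarrow> (\<phi> has_real_derivative \<phi>' x) (at x)"
    and c: "continuous_on {a..b} U'" "continuous_on {a..b} \<phi>'"
    and z: "\<phi> a = 0" "\<phi> b = 0"
  shows "integral {a..b} (\<lambda>x. U x * \<phi>' x) = - integral {a..b} (\<lambda>x. U' x * \<phi> x)"
proof -
  have cU: "continuous_on {a..b} U" "continuous_on {a..b} \<phi>"
    by (rule DERIV_continuous_on, rule has_field_derivative_at_within, rule U \<phi>, simp)+
  have "((\<lambda>x. U' x * \<phi> x + U x * \<phi>' x) has_integral (U b * \<phi> b - U a * \<phi> a)) {a..b}"
  proof (rule fundamental_theorem_of_calculus[OF ab])
    fix x assume x: "x \<in> {a..b}"
    have "((\<lambda>x. U x * \<phi> x) has_real_derivative U' x * \<phi> x + U x * \<phi>' x) (at x within {a..b})"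
      by (rule has_field_derivative_at_within, rule derivative_eq_intros U[OF x] \<phi>[OF x])+
        (simp add: mult.commute)
    then show "((\<lambda>x. U x * \<phi> x) has_vector_derivative U' x * \<phi> x + U x * \<phi>' x) (at x within {a..b})"
      by (simp add: has_real_derivative_iff_has_vector_derivative)
  qed
  then have "integral {a..b} (\<lambda>x. U' x * \<phi> x + U x * \<phi>' x) = 0" using z by (simp add: integral_unique)
  moreover have "integral {a..b} (\<lambda>x. U' x * \<phi> x + U x * \<phi>' x)
      = integral {a..b} (\<lambda>x. U' x * \<phi> x) + integral {a..b} (\<lambda>x. U x * \<phi>' x)"
    by (rule integral_add) (auto intro!: integrable_continuous_real continuous_intros c cU)
  ultimately show ?thesis by simp
qed

lemma continuous_on_DERIV: "(\<And>x. (U has_real_derivative U' x) (at x)) \<Longrightarrow> continuous_on A U"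
  by (rule DERIV_continuous_on, rule has_field_derivative_at_within)

lemma weak_by_parts:
  fixes U \<phi> :: "real \<Rightarrow> real"
  assumes U: "\<And>x. (U has_real_derivative U' x) (at x)" "continuous_on UNIV U'"
    and \<phi>: "\<And>x. (\<phi> has_real_derivative \<phi>' x) (at x)" "continuous_on UNIV \<phi>'"
    and R: "0 < R" "\<And>x. R \<le> \<bar>x\<bar> \<Longrightarrow> \<phi> x = 0" "\<And>x. R \<le> \<bar>x\<bar> \<Longrightarrow> \<phi>' x = 0"
  shows "(LINT x|lborel. U x * \<phi>' x) = - (LINT x|lborel. U' x * \<phi> x)"
proof -
  have cU: "continuous_on A U" "continuous_on A \<phi>" "continuous_on A U'" "continuous_on A \<phi>'" for A
    using continuous_on_DERIV[OF U(1)] continuous_on_DERIV[OF \<phi>(1)]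
      continuous_on_subset[OF U(2)] continuous_on_subset[OF \<phi>(2)] by simp_all
  have "(LINT x|lborel. U x * \<phi>' x) = integral {-R..R} (\<lambda>x. U x * \<phi>' x)"
    by (rule integral_of_truncated) (use R in \<open>auto intro!: continuous_intros cU simp: abs_if\<close>)
  moreover have "(LINT x|lborel. U' x * \<phi> x) = integral {-R..R} (\<lambda>x. U' x * \<phi> x)"
    by (rule integral_of_truncated) (use R in \<open>auto intro!: continuous_intros cU simp: abs_if\<close>)
  moreover have "integral {-R..R} (\<lambda>x. U x * \<phi>' x) = - integral {-R..R} (\<lambda>x. U' x * \<phi> x)"
    by (rule integral_by_parts_zero) (use R U \<phi> cU in auto)
  ultimately show ?thesis by simp
qed

lemma set_integrable_continuous:
  fixes U :: "real \<Rightarrow> real"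
  assumes "continuous_on {a..b} U"
  shows "set_integrable lborel {a..b} U"
  unfolding set_integrable_def by (rule borel_integrable_compact) (use assms in auto)

lemma loc_integrable_continuous: "continuous_on UNIV U \<Longrightarrow> loc_integrable U"
  unfolding loc_integrable_def
  by (auto intro!: set_integrable_continuous intro: continuous_on_subset)

lemma weak_deriv_1:
  fixes U U' :: "real \<Rightarrow> real"
  assumes U: "\<And>x. (U has_real_derivative U' x) (at x)" "continuous_on UNIV U'"
  shows "weak_deriv 1 U U'"
  unfolding weak_deriv_def
proof (intro conjI allI impI)
  show "loc_integrable U" "loc_integrable U'"
    using loc_integrable_continuous continuous_on_DERIV[OF U(1)] U by blast+
  fix \<phi> :: "real \<Rightarrow> real" assume "test_function UNIV \<phi>"
  then obtain R where R: "0 < R" "\<And>n x. ((deriv ^^ n) \<phi> has_real_derivative (deriv ^^ Suc n) \<phi> x) (at x)"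
    "\<And>n x. R \<le> \<bar>x\<bar> \<Longrightarrow> (deriv ^^ n) \<phi> x = 0" "\<And>n. continuous_on UNIV ((deriv ^^ n) \<phi>)"
    by (rule test_function_real) blast
  have "(LINT x|lborel. U x * (deriv ^^ Suc 0) \<phi> x) = - (LINT x|lborel. U' x * (deriv ^^ 0) \<phi> x)"
    by (rule weak_by_parts[OF U R(2) R(4) R(1) R(3) R(3)])
  then show "(LINT x|lborel. U x * (deriv ^^ 1) \<phi> x) = (- 1) ^ 1 * (LINT x|lborel. U' x * \<phi> x)" by simp
qed

lemma weak_deriv_3:
  fixes U U1 U2 U3 :: "real \<Rightarrow> real"
  assumes U: "\<And>x. (U has_real_derivative U1 x) (at x)" "\<And>x. (U1 has_real_derivative U2 x) (at x)"
    "\<And>x. (U2 has_real_derivative U3 x) (at x)" "continuous_on UNIV U3"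
  shows "weak_deriv 3 U U3"
  unfolding weak_deriv_def
proof (intro conjI allI impI)
  have c: "continuous_on UNIV U1" "continuous_on UNIV U2"
    using continuous_on_DERIV[OF U(2)] continuous_on_DERIV[OF U(3)] by blast+
  show "loc_integrable U" "loc_integrable U3"
    using loc_integrable_continuous continuous_on_DERIV[OF U(1)] U by blast+
  fix \<phi> :: "real \<Rightarrow> real" assume "test_function UNIV \<phi>"
  then obtain R where R: "0 < R" "\<And>n x. ((deriv ^^ n) \<phi> has_real_derivative (deriv ^^ Suc n) \<phi> x) (at x)"
    "\<And>n x. R \<le> \<bar>x\<bar> \<Longrightarrow> (deriv ^^ n) \<phi> x = 0" "\<And>n. continuous_on UNIV ((deriv ^^ n) \<phi>)"
    by (rule test_function_real) blast
  have "(LINT x|lborel. U x * (deriv ^^ Suc 2) \<phi> x) = - (LINT x|lborel. U1 x * (deriv ^^ 2) \<phi> x)"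
    by (rule weak_by_parts[OF U(1) c(1) R(2) R(4) R(1) R(3) R(3)])
  also have "(LINT x|lborel. U1 x * (deriv ^^ 2) \<phi> x) = - (LINT x|lborel. U2 x * (deriv ^^ Suc 0) \<phi> x)"
    using weak_by_parts[OF U(2) c(2) R(2) R(4) R(1) R(3) R(3), of "Suc 0"] by (simp add: numeral_2_eq_2)
  also have "(LINT x|lborel. U2 x * (deriv ^^ Suc 0) \<phi> x) = - (LINT x|lborel. U3 x * (deriv ^^ 0) \<phi> x)"
    by (rule weak_by_parts[OF U(3,4) R(2) R(4) R(1) R(3) R(3)])
  finally show "(LINT x|lborel. U x * (deriv ^^ 3) \<phi> x) = (- 1) ^ 3 * (LINT x|lborel. U3 x * \<phi> x)"
    by (simp add: numeral_3_eq_3 numeral_2_eq_2)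
qed

text \<open>Monotone convergence along the intervals \<open>[-n, n]\<close>, on which the integral
  is \<open>I n - I (- n) \<le> 2 C\<close>.\<close>

lemma integrable_of_bounded_primitive:
  fixes G I :: "real \<Rightarrow> real"
  assumes G: "continuous_on UNIV G" "\<And>x. 0 \<le> G x"
    and I: "\<And>x. (I has_real_derivative G x) (at x)" "\<And>x. \<bar>I x\<bar> \<le> C"
  shows "integrable lborel G"
proof (rule integrableI_bounded)
  show m: "G \<in> borel_measurable lborel" using G(1) by (simp add: borel_measurable_continuous_onI)
  have C: "0 \<le> C" using I(2)[of 0] by simp
  define T where "T n x = ennreal (indicator {- real n..real n} x *\<^sub>R G x)" for n x
  have "(\<integral>\<^sup>+ x. T n x \<partial>lborel) \<le> ennreal (2 * C)" for n
  proof -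
    have i: "set_integrable lborel {- real n..real n} G"
      unfolding set_integrable_def
      by (rule borel_integrable_compact) (auto intro: continuous_on_subset[OF G(1)])
    have "(\<integral>\<^sup>+ x. T n x \<partial>lborel) = ennreal (LINT x|lborel. indicator {- real n..real n} x *\<^sub>R G x)"
      unfolding T_def using i G(2) by (intro nn_integral_eq_integral) (auto simp: set_integrable_def)
    also have "(LINT x|lborel. indicator {- real n..real n} x *\<^sub>R G x) = integral {- real n..real n} G"
      using set_borel_integral_eq_integral(2)[OF i] by (simp add: set_lebesgue_integral_def)
    also have "\<dots> = I (real n) - I (- real n)"
    proof (rule integral_unique, rule fundamental_theorem_of_calculus)
      fix x
      show "(I has_vector_derivative G x) (at x within {- real n..real n})"
        using has_field_derivative_at_within[OF I(1)]
        by (simp add: has_real_derivative_iff_has_vector_derivative)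
    qed simp
    also have "\<dots> \<le> 2 * C" using I(2)[of "real n"] I(2)[of "- real n"] by simp
    finally show ?thesis using C by (simp add: ennreal_leI)
  qed
  moreover have "(\<integral>\<^sup>+ x. ennreal (norm (G x)) \<partial>lborel) = (SUP n. \<integral>\<^sup>+ x. T n x \<partial>lborel)"
  proof -
    have "(\<lambda>x. ennreal (norm (G x))) = (\<lambda>x. SUP n. T n x)"
    proof
      fix x
      obtain N :: nat where N: "\<bar>x\<bar> \<le> real N" using real_arch_simple by blast
      show "ennreal (norm (G x)) = (SUP n. T n x)"
      proof (rule antisym)
        have "T N x = ennreal (norm (G x))" using N G(2)[of x] by (simp add: T_def abs_le_iff minus_le_iff)
        then show "ennreal (norm (G x)) \<le> (SUP n. T n x)" by (metis SUP_upper UNIV_I)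
        show "(SUP n. T n x) \<le> ennreal (norm (G x))"
          by (rule SUP_least) (use G(2)[of x] in \<open>auto simp: T_def indicator_def\<close>)
      qed
    qed
    moreover have "incseq T"
      unfolding incseq_def le_fun_def T_def using G(2)
      by (auto simp: indicator_def intro!: ennreal_leI)
    moreover have "T n \<in> borel_measurable lborel" for n
      unfolding T_def using m by measurable
    ultimately show ?thesis
      by (simp add: nn_integral_monotone_convergence_SUP)
  qed
  ultimately have "(\<integral>\<^sup>+ x. ennreal (norm (G x)) \<partial>lborel) \<le> ennreal (2 * C)"
    by (simp add: SUP_least)
  then show "(\<integral>\<^sup>+ x. ennreal (norm (G x)) \<partial>lborel) < \<infinity>"
    by (simp add: order_le_less_trans)
qed

text \<open>A compact set inside the open strip of later times keeps a positive distance from the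
  initial time. Everything then lives in a box with \<open>t1\<close> above \<open>t0\<close>, where
  a self-similar solution is smooth.\<close>

lemma test_function_strip:
  fixes \<psi> :: "real \<times> real \<Rightarrow> real"
  assumes \<psi>: "test_function ({t. t0 < ereal t} \<times> UNIV) \<psi>" and t0: "t0 \<noteq> \<infinity>"
  obtains \<psi>t \<psi>x t1 t2 R where
    "t0 < ereal t1" "t1 < t2" "0 < R"
    "\<And>t x. ((\<lambda>s. \<psi> (s, x)) has_real_derivative \<psi>t (t, x)) (at t)"
    "\<And>t x. ((\<lambda>\<xi>. \<psi> (t, \<xi>)) has_real_derivative \<psi>x (t, x)) (at x)"
    "continuous_on UNIV \<psi>" "continuous_on UNIV \<psi>t" "continuous_on UNIV \<psi>x"
    "\<And>t x. \<not> (t1 < t \<and> t < t2 \<and> \<bar>x\<bar> < R) \<Longrightarrow> \<psi> (t, x) = 0 \<and> \<psi>t (t, x) = 0 \<and> \<psi>x (t, x) = 0"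
proof -
  define \<psi>t where "\<psi>t z = frechet_derivative \<psi> (at z) (1, 0)" for z
  define \<psi>x where "\<psi>x z = frechet_derivative \<psi> (at z) (0, 1)" for z
  have C1: "Ck 1 \<psi>" using \<psi> by (auto simp: test_function_def)
  then have D: "(\<psi> has_derivative frechet_derivative \<psi> (at z)) (at z)" for z
    by (cases z) (simp add: frechet_derivative_works[symmetric])
  have B: "(1, 0) \<in> (Basis :: (real \<times> real) set)" "(0, 1) \<in> (Basis :: (real \<times> real) set)"
    by (auto simp: Basis_prod_def)
  have ct: "continuous_on UNIV \<psi>t" "continuous_on UNIV \<psi>x"
  proof -
    have "\<forall>e\<in>Basis. continuous_on UNIV (\<lambda>z. frechet_derivative \<psi> (at z) e)" using C1 by simp
    then show "continuous_on UNIV \<psi>t" "continuous_on UNIV \<psi>x"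
      unfolding \<psi>t_def[abs_def] \<psi>x_def[abs_def] using B by blast+
  qed
  have cp: "continuous_on UNIV \<psi>" using C1 Ck_continuous by blast
  have lin: "linear (frechet_derivative \<psi> (at z))" for z
    using has_derivative_linear[OF D] .
  have dt: "((\<lambda>s. \<psi> (s, x)) has_real_derivative \<psi>t (t, x)) (at t)" for t x
  proof -
    have "((\<lambda>s. (s, x)) has_derivative (\<lambda>d. (d, 0))) (at t)"
      by (rule has_derivative_Pair[OF has_derivative_ident has_derivative_const])
    from has_derivative_compose[OF this D[of "(t, x)"]]
    have "((\<lambda>s. \<psi> (s, x)) has_derivative (\<lambda>d. frechet_derivative \<psi> (at (t, x)) (d, 0))) (at t)" .
    moreover have "frechet_derivative \<psi> (at (t, x)) (d, 0) = \<psi>t (t, x) * d" for d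
      using linear_scale[OF lin, of "(t, x)" d "(1, 0)"] by (simp add: \<psi>t_def)
    ultimately show ?thesis by (simp add: has_field_derivative_def)
  qed
  have dx: "((\<lambda>\<xi>. \<psi> (t, \<xi>)) has_real_derivative \<psi>x (t, x)) (at x)" for t x
  proof -
    have "((\<lambda>s. (t, s)) has_derivative (\<lambda>d. (0, d))) (at x)"
      by (rule has_derivative_Pair[OF has_derivative_const has_derivative_ident])
    from has_derivative_compose[OF this D[of "(t, x)"]]
    have "((\<lambda>s. \<psi> (t, s)) has_derivative (\<lambda>d. frechet_derivative \<psi> (at (t, x)) (0, d))) (at x)" .
    moreover have "frechet_derivative \<psi> (at (t, x)) (0, d) = \<psi>x (t, x) * d" for d
      using linear_scale[OF lin, of "(t, x)" d "(0, 1)"] by (simp add: \<psi>x_def)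
    ultimately show ?thesis by (simp add: has_field_derivative_def)
  qed
  let ?K = "closure {z. \<psi> z \<noteq> 0}"
  have K: "compact ?K" "?K \<subseteq> {t. t0 < ereal t} \<times> UNIV"
    using \<psi> unfolding test_function_def by blast+
  have z0: "\<psi> z = 0" if "z \<notin> ?K" for z
    using that closure_subset[of "{z. \<psi> z \<noteq> 0}"] by blast
  have zD: "frechet_derivative \<psi> (at z) = (\<lambda>_. 0)" if "z \<notin> ?K" for z
  proof -
    have "(\<psi> has_derivative (\<lambda>_. 0)) (at z)"
    proof (rule has_derivative_transform_within_open[where f = "\<lambda>_. 0" and s = "- ?K"])
      show "open (- ?K)" by (rule open_Compl) (rule closed_closure)
      show "0 = \<psi> y" if "y \<in> - ?K" for y
        by (rule z0[symmetric]) (use that in blast)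
      show "z \<in> - ?K" using that by blast
      show "((\<lambda>_. 0) has_derivative (\<lambda>_. 0)) (at z)" by (rule has_derivative_const)
    qed
    then show ?thesis by (rule frechet_derivative_at[symmetric])
  qed
  obtain R0 where R0: "\<And>z. z \<in> ?K \<Longrightarrow> norm z \<le> R0"
    using compact_imp_bounded[OF K(1)] unfolding bounded_iff by blast
  have "\<exists>t1. t0 < ereal t1 \<and> (\<forall>z\<in>?K. t1 < fst z)"
  proof (cases "?K = {}")
    case True
    \<comment> \<open>An empty support has no earliest time; any real number above \<open>t0\<close>
      serves, and there is one because \<open>t0\<close> is not \<open>\<infinity>\<close>.\<close>
    have "t0 < \<infinity>" using t0 by simp
    then obtain r where "t0 < ereal r" using ereal_dense2 by blast
    then show ?thesis unfolding True by blast
  next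
    case False
    have "compact (fst ` ?K)" by (intro compact_continuous_image K continuous_intros)
    then obtain s where s: "s \<in> fst ` ?K" "\<And>t. t \<in> fst ` ?K \<Longrightarrow> s \<le> t"
      using compact_attains_inf[of "fst ` ?K"] False by auto
    then have "t0 < ereal s" using K(2) by auto
    then obtain r where "t0 < ereal r" "ereal r < ereal s" using ereal_dense2 by blast
    moreover have "r < fst z" if "z \<in> ?K" for z
      using s(2)[of "fst z"] that \<open>ereal r < ereal s\<close> by auto
    ultimately show ?thesis by blast
  qed
  then obtain t1 where t1: "t0 < ereal t1" "\<And>z. z \<in> ?K \<Longrightarrow> t1 < fst z" by blast
  show ?thesis
  proof (rule that[OF t1(1) _ _ dt dx cp ct])
    show "t1 < max t1 R0 + 1" "0 < \<bar>R0\<bar> + 1" by auto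
    fix t x assume n: "\<not> (t1 < t \<and> t < max t1 R0 + 1 \<and> \<bar>x\<bar> < \<bar>R0\<bar> + 1)"
    have "(t, x) \<notin> ?K"
    proof
      assume "(t, x) \<in> ?K"
      moreover from this have "\<bar>t\<bar> \<le> R0" "\<bar>x\<bar> \<le> R0"
        using R0[of "(t, x)"] norm_fst_le[of t x] norm_snd_le[of x t] by auto
      ultimately show False using n t1(2)[of "(t, x)"] by auto
    qed
    from z0[OF this] zD[OF this] show "\<psi> (t, x) = 0 \<and> \<psi>t (t, x) = 0 \<and> \<psi>x (t, x) = 0"
      by (simp add: \<psi>t_def \<psi>x_def)
  qed
qed

section \<open>Self-similar weak solutions\<close>

text \<open>\<open>f0, \<dots>, f3\<close> are the even extension of the profile and its derivatives, \<open>j\<close> is the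
  profile of the flux, and \<open>I1\<close>, \<open>I2\<close> are primitives that encode the integral bounds.\<close>
locale self_similar =
  fixes t0 :: ereal and m \<beta> :: real and S f0 f1 f2 f3 j I1 I2 :: "real \<Rightarrow> real"
    and C0 C1 C2 :: real and h :: "real \<Rightarrow> real \<Rightarrow> real"
  assumes t0: "t0 \<noteq> \<infinity>"
    and S_pos: "\<And>t. t0 < ereal t \<Longrightarrow> 0 < S t"
    and dS: "\<And>t. t0 < ereal t \<Longrightarrow> (S has_real_derivative \<beta> * S t powr (m - 3)) (at t)"
    and S_bdd: "\<And>T. \<exists>B. \<forall>t. t0 < ereal t \<and> t \<le> T \<longrightarrow> S t \<le> B"
    and d0: "\<And>y. (f0 has_real_derivative f1 y) (at y)"
    and d1: "\<And>y. (f1 has_real_derivative f2 y) (at y)"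
    and d2: "\<And>y. (f2 has_real_derivative f3 y) (at y)"
    and dj: "\<And>y. (j has_real_derivative \<beta> * (y * f1 y - f0 y)) (at y)"
    and c3: "continuous_on UNIV f3"
    and f0_pos: "\<And>y. 0 < f0 y"
    and j_eq: "\<And>y. j y = f0 y powr m * f3 y"
    and f0_le: "\<And>y. f0 y \<le> C0 * (1 + \<bar>y\<bar>)"
    and dI1: "\<And>y. (I1 has_real_derivative (f1 y)\<^sup>2) (at y)"
    and I1_le: "\<And>y. 0 \<le> y \<Longrightarrow> I1 y - I1 (- y) \<le> C1 * (1 + y)"
    and dI2: "\<And>y. (I2 has_real_derivative f0 y powr m * (f3 y)\<^sup>2) (at y)"
    and I2_le: "\<And>y. \<bar>I2 y\<bar> \<le> C2"
    and h_eq: "\<And>t x. t0 < ereal t \<Longrightarrow> h t x = S t * f0 (x / S t)"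
    and h_nonneg: "\<And>t x. t0 \<le> ereal t \<Longrightarrow> 0 \<le> h t x"
    and h_cont: "continuous_on ({t. t0 \<le> ereal t} \<times> UNIV) (\<lambda>(t, x). h t x)"
begin

text \<open>\<open>H\<close> is the self-similar formula alone; \<open>h\<close> agrees with it
  after \<open>t0\<close> but may be given differently at \<open>t0\<close> itself. \<open>q\<close>
  is the flux and \<open>ht\<close> the time derivative.\<close>

definition H where "H t x = S t * f0 (x / S t)"
definition h3 where "h3 t x = f3 (x / S t) / (S t)\<^sup>2"
definition q where "q t x = S t powr (m - 2) * j (x / S t)"
definition ht where "ht t x = \<beta> * S t powr (m - 3) * (f0 (x / S t) - x / S t * f1 (x / S t))"

lemma cont: "continuous_on A f0" "continuous_on A f1" "continuous_on A f2" "continuous_on A f3" "continuous_on A j"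
  using continuous_on_DERIV[OF d0] continuous_on_DERIV[OF d1] continuous_on_DERIV[OF d2]
    continuous_on_DERIV[OF dj] continuous_on_subset[OF c3] by simp_all

lemma h_pos: "t0 < ereal t \<Longrightarrow> 0 < h t x"
  using S_pos f0_pos by (simp add: h_eq)

lemma flux_eq:
  assumes "t0 < ereal t" shows "h t x powr m * h3 t x = q t x"
proof -
  note S = S_pos[OF assms]
  have "h t x powr m = S t powr m * f0 (x / S t) powr m"
    using S f0_pos[of "x / S t"] by (simp add: h_eq[OF assms] powr_mult)
  moreover have "S t powr (m - 2) = S t powr m / (S t)\<^sup>2"
    using S by (simp add: powr_diff)
  ultimately show ?thesis by (simp add: q_def h3_def j_eq)
qed

lemma dH_x:
  assumes "t0 < ereal t" shows "(H t has_real_derivative f1 (x / S t)) (at x)"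
proof -
  note S = S_pos[OF assms]
  have "((\<lambda>x. x / S t) has_real_derivative 1 / S t) (at x)"
    using S by (auto intro!: derivative_eq_intros)
  from DERIV_cmult[OF DERIV_chain2[OF d0 this], of "S t"] show ?thesis
    using S unfolding H_def[abs_def] by simp
qed

lemma d_scaled:
  assumes t: "t0 < ereal t" and F: "\<And>y. (F has_real_derivative F' y) (at y)"
  shows "((\<lambda>x. c * F (x / S t)) has_real_derivative c * F' (x / S t) / S t) (at x)"
proof -
  have "((\<lambda>x. x / S t) has_real_derivative 1 / S t) (at x)"
    using S_pos[OF t] by (auto intro!: derivative_eq_intros)
  from DERIV_cmult[OF DERIV_chain2[OF F this], of c] show ?thesis by simp
qed

text \<open>Together with \<open>dH_t\<close> this is \<open>h_t + q_x = 0\<close> pointwise. The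
  factor \<open>S powr (m - 2) / S\<close> from the flux matches \<open>S'\<close> by the law
  \<open>dS\<close>.\<close>

lemma dq_x:
  assumes "t0 < ereal t" shows "(q t has_real_derivative - ht t x) (at x)"
proof -
  note S = S_pos[OF assms]
  have "(q t has_real_derivative S t powr (m - 2) * (\<beta> * (x / S t * f1 (x / S t) - f0 (x / S t))) / S t) (at x)"
    unfolding q_def[abs_def] by (rule d_scaled[OF assms dj])
  moreover have "S t powr (m - 3) = S t powr (m - 2) / S t"
    using S powr_diff[of "S t" "m - 2" 1] by simp
  then have "S t powr (m - 2) * (\<beta> * (x / S t * f1 (x / S t) - f0 (x / S t))) / S t = - ht t x"
    unfolding ht_def by (simp add: algebra_simps diff_divide_distrib)
  ultimately show ?thesis by simp
qed

lemma dH_t: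
  assumes "t0 < ereal t" shows "((\<lambda>t. H t x) has_real_derivative ht t x) (at t)"
proof -
  note S = S_pos[OF assms]
  let ?D = "\<beta> * S t powr (m - 3)"
  have "((\<lambda>t. x / S t) has_real_derivative - (x * ?D) / (S t * S t)) (at t)"
    using S by (auto intro!: derivative_eq_intros dS[OF assms])
  from DERIV_mult[OF dS[OF assms] DERIV_chain2[OF d0 this]]
  have "((\<lambda>t. H t x) has_real_derivative
      ?D * f0 (x / S t) + f1 (x / S t) * (- (x * ?D) / (S t * S t)) * S t) (at t)"
    unfolding H_def[abs_def] .
  moreover have "?D * f0 (x / S t) + f1 (x / S t) * (- (x * ?D) / (S t * S t)) * S t = ht t x"
    using S unfolding ht_def by (simp add: field_simps)
  ultimately show ?thesis by simp
qed

lemma cont_box: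
  assumes "t0 < ereal t1"
  shows "continuous_on (cbox (t1, a) (t2, b)) (\<lambda>(t, x). H t x)"
    "continuous_on (cbox (t1, a) (t2, b)) (\<lambda>(t, x). q t x)"
    "continuous_on (cbox (t1, a) (t2, b)) (\<lambda>(t, x). ht t x)"
proof -
  let ?B = "cbox (t1, a) (t2, b)"
  have t: "t0 < ereal (fst z)" if "z \<in> ?B" for z
    using that less_le_trans[OF assms] by (auto simp: cbox_Pair_eq)
  have "continuous_on {t1..t2} S"
    by (rule DERIV_continuous_on, rule has_field_derivative_at_within, rule dS)
       (use less_le_trans[OF assms] in auto)
  then have cS: "continuous_on ?B (\<lambda>z. S (fst z))"
    by (rule continuous_on_compose2) (auto intro!: continuous_intros simp: cbox_Pair_eq)
  have nz: "S (fst z) \<noteq> 0" "0 < S (fst z)" if "z \<in> ?B" for z using S_pos[OF t[OF that]] by auto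
  have cy: "continuous_on ?B (\<lambda>z. snd z / S (fst z))"
    by (intro continuous_intros cS) (use nz in auto)
  have comp: "continuous_on ?B (\<lambda>z. F (snd z / S (fst z)))" if "continuous_on UNIV F" for F :: "real \<Rightarrow> real"
    by (rule continuous_on_compose2[OF that cy]) auto
  have cp: "continuous_on ?B (\<lambda>z. S (fst z) powr c)" for c
    by (intro continuous_on_powr cS continuous_on_const) (use nz in auto)
  show "continuous_on ?B (\<lambda>(t, x). H t x)" "continuous_on ?B (\<lambda>(t, x). q t x)"
    "continuous_on ?B (\<lambda>(t, x). ht t x)"
    unfolding H_def q_def ht_def case_prod_beta
    by (intro continuous_intros cS cy cp comp cont)+
qed

text \<open>Both double integrals reduce to a box on which all is continuous. The first is
  integrated by parts in time after an exchange of the order of integration, the second in space;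
  the results are the integral of \<open>ht \<psi>\<close> with opposite signs, and the boundary
  terms vanish with \<open>\<psi>\<close>.\<close>

lemma weak_identity:
  assumes "test_function ({t. t0 < ereal t} \<times> UNIV) \<psi>"
  shows "set_integrable (lborel :: (real \<times> real) measure) {(t, x). t0 \<le> ereal t \<and> 0 < h t x}
             (\<lambda>(t, x). h t x powr m * h3 t x * deriv (\<lambda>\<xi>. \<psi> (t, \<xi>)) x)" (is ?int)
    and "(LINT t:{t. t0 \<le> ereal t}|lborel. LINT x|lborel. h t x * deriv (\<lambda>s. \<psi> (s, x)) t) +
           (LINT t:{t. t0 \<le> ereal t}|lborel. LINT x:{x. 0 < h t x}|lborel.
               h t x powr m * h3 t x * deriv (\<lambda>\<xi>. \<psi> (t, \<xi>)) x) = 0" (is "?L1 + ?L2 = 0")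
proof -
  obtain \<psi>t \<psi>x t1 t2 R where
    t: "t0 < ereal t1" "t1 < t2" and R: "0 < R" and
    dt: "\<And>t x. ((\<lambda>s. \<psi> (s, x)) has_real_derivative \<psi>t (t, x)) (at t)" and
    dx: "\<And>t x. ((\<lambda>\<xi>. \<psi> (t, \<xi>)) has_real_derivative \<psi>x (t, x)) (at x)" and
    c\<psi>: "continuous_on UNIV \<psi>" "continuous_on UNIV \<psi>t" "continuous_on UNIV \<psi>x" and
    z: "\<And>t x. \<not> (t1 < t \<and> t < t2 \<and> \<bar>x\<bar> < R) \<Longrightarrow> \<psi> (t, x) = 0 \<and> \<psi>t (t, x) = 0 \<and> \<psi>x (t, x) = 0"
    by (rule test_function_strip[OF assms t0]) blast
  have deriv: "deriv (\<lambda>s. \<psi> (s, x)) t = \<psi>t (t, x)" "deriv (\<lambda>\<xi>. \<psi> (t, \<xi>)) x = \<psi>x (t, x)" for t x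
    using DERIV_imp_deriv[OF dt] DERIV_imp_deriv[OF dx] by auto
  let ?B = "cbox (t1, -R) (t2, R)"
  have c: "continuous_on ?B (\<lambda>(t, x). H t x * \<psi>t (t, x))"
    "continuous_on ?B (\<lambda>(t, x). q t x * \<psi>x (t, x))" "continuous_on ?B (\<lambda>(t, x). ht t x * \<psi> (t, x))"
    using cont_box[OF t(1), of "-R" t2 R] c\<psi>[THEN continuous_on_subset, of ?B]
    unfolding case_prod_beta by (auto intro!: continuous_on_mult)
  have pos: "t0 < ereal s" if "t1 \<le> s" for s
    using that t(1) less_le_trans[of t0 "ereal t1" "ereal s"] by simp
  show ?int
  proof -
    have "indicator {(t, x). t0 \<le> ereal t \<and> 0 < h t x} z *\<^sub>R (case z of (t, x) \<Rightarrow> h t x powr m * h3 t x * deriv (\<lambda>\<xi>. \<psi> (t, \<xi>)) x)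
        = indicator ?B z *\<^sub>R (case z of (t, x) \<Rightarrow> q t x * \<psi>x (t, x))" for z
    proof (cases z)
      case (Pair s x)
      show ?thesis
      proof (cases "t1 < s \<and> s < t2 \<and> \<bar>x\<bar> < R")
        case True
        then have "z \<in> ?B" using Pair by (auto simp: cbox_Pair_eq)
        with True show ?thesis
          using pos[of s] h_pos[of s x] flux_eq[of s x] Pair by (simp add: deriv)
      next
        case False
        then show ?thesis using z[of s x] Pair by (simp add: deriv)
      qed
    qed
    moreover have "integrable lborel (\<lambda>z. indicator ?B z *\<^sub>R (case z of (t, x) \<Rightarrow> q t x * \<psi>x (t, x)))"
      by (rule borel_integrable_compact[OF compact_cbox c(2)])
    ultimately show ?thesis unfolding set_integrable_def by simp
  qed
  have slice: "continuous_on {-R..R} (\<lambda>x. F s x)" if "continuous_on ?B (\<lambda>(t, x). F t x)" "s \<in> {t1..t2}"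
    for F :: "real \<Rightarrow> real \<Rightarrow> real" and s
  proof -
    have "continuous_on {-R..R} (\<lambda>x. case (s, x) of (t, x) \<Rightarrow> F t x)"
      by (rule continuous_on_compose2[OF that(1)], intro continuous_on_Pair continuous_on_const continuous_on_id)
         (use that(2) in \<open>auto simp: cbox_Pair_eq\<close>)
    then show ?thesis by simp
  qed
  have slice': "continuous_on {t1..t2} (\<lambda>s. F s x)" if "continuous_on ?B (\<lambda>(t, x). F t x)" "x \<in> {-R..R}"
    for F :: "real \<Rightarrow> real \<Rightarrow> real" and x
  proof -
    have "continuous_on {t1..t2} (\<lambda>s. case (s, x) of (t, x) \<Rightarrow> F t x)"
      by (rule continuous_on_compose2[OF that(1)], intro continuous_on_Pair continuous_on_const continuous_on_id)
         (use that(2) in \<open>auto simp: cbox_Pair_eq\<close>)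
    then show ?thesis by simp
  qed
  have param: "continuous_on {t1..t2} (\<lambda>s. integral {-R..R} (F s))" if "continuous_on ?B (\<lambda>(t, x). F t x)"
    for F :: "real \<Rightarrow> real \<Rightarrow> real"
    using integral_continuous_on_param[of "{t1..t2}" "-R" R F] that by (simp add: cbox_Pair_eq)
  have zt: "\<psi>t (s, x) = 0" "\<psi>x (s, x) = 0" if "\<not> (t1 < s \<and> s < t2)" for s x
    using z[of s x] that by blast+
  \<comment> \<open>The support lies after the initial time, so the restriction to
    \<open>t0 \<le> t\<close> disappears and a compact time interval is left.\<close>
  have outer: "(LINT t:{t. t0 \<le> ereal t}|lborel. G t) = integral {t1..t2} (\<lambda>s. integral {-R..R} (F s))"
    if F: "continuous_on ?B (\<lambda>(t, x). F t x)" and G: "\<And>s. t1 < s \<Longrightarrow> s < t2 \<Longrightarrow> G s = integral {-R..R} (F s)"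
      and G0: "\<And>s. \<not> (t1 < s \<and> s < t2) \<Longrightarrow> G s = 0" and F0: "\<And>s x. \<not> (t1 < s \<and> s < t2) \<Longrightarrow> F s x = 0"
    for F :: "real \<Rightarrow> real \<Rightarrow> real" and G
  proof -
    let ?G = "\<lambda>s. indicator {t. t0 \<le> ereal t} s *\<^sub>R G s"
    have eq: "?G s = integral {-R..R} (F s)" if "s \<in> {t1..t2}" for s
    proof (cases "t1 < s \<and> s < t2")
      case True
      then show ?thesis using G pos[of s] by auto
    next
      case False
      then have "F s = (\<lambda>_. 0)" using F0 by auto
      then show ?thesis using G0[OF False] by simp
    qed
    have "(LINT s|lborel. ?G s) = integral {t1..t2} ?G"
    proof (rule integral_of_truncated)
      show "continuous_on {t1..t2} ?G"
        using param[OF F] by (rule continuous_on_eq) (use eq in auto)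
      show "?G s = 0" if "s \<notin> {t1..t2}" for s
        using G0[of s] that by auto
    qed
    also have "\<dots> = integral {t1..t2} (\<lambda>s. integral {-R..R} (F s))"
      by (rule integral_cong) (rule eq)
    finally show ?thesis by (simp add: set_lebesgue_integral_def)
  qed
  have "?L1 = integral {t1..t2} (\<lambda>s. integral {-R..R} (\<lambda>x. H s x * \<psi>t (s, x)))"
  proof (rule outer[OF c(1)])
    fix s assume s: "t1 < s" "s < t2"
    have "(LINT x|lborel. h s x * deriv (\<lambda>s. \<psi> (s, x)) s) = (LINT x|lborel. H s x * \<psi>t (s, x))"
      using pos[of s] s by (simp add: deriv h_eq H_def)
    also have "\<dots> = integral {-R..R} (\<lambda>x. H s x * \<psi>t (s, x))"
    proof (rule integral_of_truncated[OF slice[OF c(1)]])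
      show "H s x * \<psi>t (s, x) = 0" if "x \<notin> {-R..R}" for x
      proof -
        have "\<not> \<bar>x\<bar> < R" using that by auto
        then show ?thesis using z[of s x] by simp
      qed
    qed (use s in auto)
    finally show "(LINT x|lborel. h s x * deriv (\<lambda>s. \<psi> (s, x)) s) = integral {-R..R} (\<lambda>x. H s x * \<psi>t (s, x))" .
  qed (simp_all add: deriv zt)
  also have "\<dots> = integral {-R..R} (\<lambda>x. integral {t1..t2} (\<lambda>s. H s x * \<psi>t (s, x)))"
    using integral_swap_continuous[OF c(1)] by simp
  also have "\<dots> = integral {-R..R} (\<lambda>x. - integral {t1..t2} (\<lambda>s. ht s x * \<psi> (s, x)))"
  proof (rule integral_cong)
    fix x assume x: "x \<in> {-R..R}"
    show "integral {t1..t2} (\<lambda>s. H s x * \<psi>t (s, x)) = - integral {t1..t2} (\<lambda>s. ht s x * \<psi> (s, x))"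
    proof (rule integral_by_parts_zero)
      show "((\<lambda>s. H s x) has_real_derivative ht s x) (at s)" if "s \<in> {t1..t2}" for s
        by (rule dH_t, rule pos) (use that in auto)
      show "continuous_on {t1..t2} (\<lambda>s. ht s x)"
        using slice'[OF cont_box(3)[OF t(1)] x] .
      show "continuous_on {t1..t2} (\<lambda>s. \<psi>t (s, x))"
        by (rule continuous_on_compose2[OF c\<psi>(2)]) (auto intro!: continuous_intros)
      show "\<psi> (t1, x) = 0" "\<psi> (t2, x) = 0" using z[of t1 x] z[of t2 x] by simp_all
    qed (use t dt in auto)
  qed
  also have "\<dots> = - integral {-R..R} (\<lambda>x. integral {t1..t2} (\<lambda>s. ht s x * \<psi> (s, x)))"
    by simp
  also have "\<dots> = - integral {t1..t2} (\<lambda>s. integral {-R..R} (\<lambda>x. ht s x * \<psi> (s, x)))"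
    using integral_swap_continuous[OF c(3)] by simp
  finally have L1: "?L1 = - integral {t1..t2} (\<lambda>s. integral {-R..R} (\<lambda>x. ht s x * \<psi> (s, x)))" .
  have "?L2 = integral {t1..t2} (\<lambda>s. integral {-R..R} (\<lambda>x. q s x * \<psi>x (s, x)))"
  proof (rule outer[OF c(2)])
    fix s assume s: "t1 < s" "s < t2"
    have "{x. 0 < h s x} = UNIV" using h_pos pos[of s] s by auto
    then have "(LINT x:{x. 0 < h s x}|lborel. h s x powr m * h3 s x * deriv (\<lambda>\<xi>. \<psi> (s, \<xi>)) x)
        = (LINT x|lborel. q s x * \<psi>x (s, x))"
      using pos[of s] s by (simp add: deriv flux_eq set_lebesgue_integral_def)
    also have "\<dots> = integral {-R..R} (\<lambda>x. q s x * \<psi>x (s, x))"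
    proof (rule integral_of_truncated[OF slice[OF c(2)]])
      show "q s x * \<psi>x (s, x) = 0" if "x \<notin> {-R..R}" for x
      proof -
        have "\<not> \<bar>x\<bar> < R" using that by auto
        then show ?thesis using z[of s x] by simp
      qed
    qed (use s in auto)
    finally show "(LINT x:{x. 0 < h s x}|lborel. h s x powr m * h3 s x * deriv (\<lambda>\<xi>. \<psi> (s, \<xi>)) x)
      = integral {-R..R} (\<lambda>x. q s x * \<psi>x (s, x))" .
  qed (simp_all add: deriv zt set_lebesgue_integral_def)
  also have "\<dots> = integral {t1..t2} (\<lambda>s. integral {-R..R} (\<lambda>x. ht s x * \<psi> (s, x)))"
  proof (rule integral_cong)
    fix s assume s: "s \<in> {t1..t2}"
    have "integral {-R..R} (\<lambda>x. q s x * \<psi>x (s, x)) = - integral {-R..R} (\<lambda>x. - ht s x * \<psi> (s, x))"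
    proof (rule integral_by_parts_zero)
      show "((\<lambda>x. q s x) has_real_derivative - ht s x) (at x)" for x
        using dq_x[of s x] pos[of s] s by simp
      show "continuous_on {-R..R} (\<lambda>x. - ht s x)"
        using slice[OF cont_box(3)[OF t(1)] s] by (intro continuous_intros)
      show "continuous_on {-R..R} (\<lambda>x. \<psi>x (s, x))"
        by (rule continuous_on_compose2[OF c\<psi>(3)]) (auto intro!: continuous_intros)
      show "\<psi> (s, - R) = 0" "\<psi> (s, R) = 0" using z[of s "-R"] z[of s R] R by simp_all
    qed (use R dx in auto)
    then show "integral {-R..R} (\<lambda>x. q s x * \<psi>x (s, x)) = integral {-R..R} (\<lambda>x. ht s x * \<psi> (s, x))"
      by simp
  qed
  finally show "?L1 + ?L2 = 0" using L1 by simp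
qed

text \<open>Substituting \<open>x = S y\<close>, the gradient term is \<open>S\<close> times an
  increment of \<open>I1\<close> over \<open>[- R / S, R / S]\<close>, at most
  \<open>C1 (S + R)\<close>. It remains bounded as \<open>S\<close> tends to 0, which gives
  uniformity down to the initial time.\<close>

lemma H1_bound:
  assumes R: "0 < R" and t: "t0 < ereal t" and B: "S t \<le> B"
  shows "set_integrable lborel {-R..R} (\<lambda>x. (h t x)\<^sup>2 + (f1 (x / S t))\<^sup>2)" (is ?int)
    and "(LINT x:{-R..R}|lborel. (h t x)\<^sup>2 + (f1 (x / S t))\<^sup>2)
      \<le> 2 * R * (C0 * (B + R))\<^sup>2 + \<bar>C1\<bar> * (B + R)"
proof -
  note S = S_pos[OF t]
  have cy: "continuous_on A (\<lambda>x. x / S t)" for A using S by (intro continuous_intros) auto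
  have ch: "continuous_on A (h t)" for A
  proof -
    have "h t = (\<lambda>x. S t * f0 (x / S t))" using h_eq[OF t] by auto
    then show ?thesis by (auto intro!: continuous_intros continuous_on_compose2[OF cont(1) cy])
  qed
  have cf: "continuous_on A (\<lambda>x. f1 (x / S t))" for A
    by (rule continuous_on_compose2[OF cont(2)[of UNIV] cy]) auto
  show i: ?int by (intro set_integrable_continuous continuous_intros ch cf)
  have C0: "0 \<le> C0" using f0_le[of 0] f0_pos[of 0] by simp
  have hb: "(h t x)\<^sup>2 \<le> (C0 * (B + R))\<^sup>2" if "x \<in> {-R..R}" for x
  proof -
    have "h t x \<le> S t * (C0 * (1 + \<bar>x / S t\<bar>))"
      unfolding h_eq[OF t] using S by (intro mult_left_mono f0_le) auto
    also have "\<dots> = C0 * (S t + \<bar>x\<bar>)" using S by (simp add: field_simps)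
    also have "\<dots> \<le> C0 * (B + R)" using C0 B that by (intro mult_left_mono add_mono) auto
    finally show ?thesis using h_pos[OF t, of x] by (intro power_mono) auto
  qed
  have "((\<lambda>x. (f1 (x / S t))\<^sup>2) has_integral (S t * I1 (R / S t) - S t * I1 (- R / S t))) {-R..R}"
  proof (rule fundamental_theorem_of_calculus)
    fix x
    show "((\<lambda>x. S t * I1 (x / S t)) has_vector_derivative (f1 (x / S t))\<^sup>2) (at x within {-R..R})"
      using has_field_derivative_at_within[OF d_scaled[OF t dI1, of "S t"]] S
      by (simp add: has_real_derivative_iff_has_vector_derivative)
  qed (use R in simp)
  then have "integral {-R..R} (\<lambda>x. (f1 (x / S t))\<^sup>2) = S t * (I1 (R / S t) - I1 (- (R / S t)))"
    by (simp add: integral_unique right_diff_distrib)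
  also have "\<dots> \<le> S t * (C1 * (1 + R / S t))" using S R by (intro mult_left_mono I1_le) auto
  also have "\<dots> = C1 * (S t + R)" using S by (simp add: field_simps)
  also have "\<dots> \<le> \<bar>C1\<bar> * (B + R)" using S B R by (intro mult_mono) auto
  finally have f: "integral {-R..R} (\<lambda>x. (f1 (x / S t))\<^sup>2) \<le> \<bar>C1\<bar> * (B + R)" .
  have "integral {-R..R} (\<lambda>x. (h t x)\<^sup>2) \<le> integral {-R..R} (\<lambda>x. (C0 * (B + R))\<^sup>2)"
    by (rule integral_le) (use hb in \<open>auto intro!: integrable_continuous_real continuous_intros ch\<close>)
  also have "\<dots> = 2 * R * (C0 * (B + R))\<^sup>2" using R by simp
  finally have "integral {-R..R} (\<lambda>x. (h t x)\<^sup>2) \<le> 2 * R * (C0 * (B + R))\<^sup>2" .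
  moreover have "integral {-R..R} (\<lambda>x. (h t x)\<^sup>2 + (f1 (x / S t))\<^sup>2)
      = integral {-R..R} (\<lambda>x. (h t x)\<^sup>2) + integral {-R..R} (\<lambda>x. (f1 (x / S t))\<^sup>2)"
    by (rule integral_add) (auto intro!: integrable_continuous_real continuous_intros ch cf)
  ultimately show "(LINT x:{-R..R}|lborel. (h t x)\<^sup>2 + (f1 (x / S t))\<^sup>2)
      \<le> 2 * R * (C0 * (B + R))\<^sup>2 + \<bar>C1\<bar> * (B + R)"
    using f set_borel_integral_eq_integral(2)[OF i] by simp
qed

lemma dissipation_integrable:
  assumes t: "t0 < ereal t"
  shows "integrable lborel (\<lambda>x. \<bar>h t x powr (m / 2) * h3 t x\<bar>\<^sup>2)"
proof -
  note S = S_pos[OF t]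
  let ?c = "S t powr m / S t ^ 4"
  have eq: "\<bar>h t x powr (m / 2) * h3 t x\<bar>\<^sup>2 = ?c * (f0 (x / S t) powr m * (f3 (x / S t))\<^sup>2)" for x
  proof -
    have "(h t x powr (m / 2))\<^sup>2 = h t x powr m"
      by (simp add: power2_eq_square powr_add[symmetric])
    also have "\<dots> = S t powr m * f0 (x / S t) powr m"
      using S f0_pos[of "x / S t"] by (simp add: h_eq[OF t] powr_mult)
    finally show ?thesis
      by (simp add: h3_def power_mult_distrib power_divide flip: power_mult)
  qed
  have cy: "continuous_on UNIV (\<lambda>x. x / S t)" using S by (intro continuous_intros) auto
  have cp: "continuous_on UNIV (\<lambda>x. f0 (x / S t) powr m)"
    by (intro continuous_on_powr continuous_on_compose2[OF cont(1)[of UNIV] cy] continuous_on_const)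
       (use f0_pos in \<open>auto simp: less_le\<close>)
  show ?thesis
  proof (rule integrable_of_bounded_primitive)
    show "continuous_on UNIV (\<lambda>x. \<bar>h t x powr (m / 2) * h3 t x\<bar>\<^sup>2)"
      unfolding eq by (intro continuous_intros cp continuous_on_compose2[OF cont(4)[of UNIV] cy]) auto
    show "((\<lambda>x. ?c * S t * I2 (x / S t)) has_real_derivative \<bar>h t x powr (m / 2) * h3 t x\<bar>\<^sup>2) (at x)" for x
      using d_scaled[OF t dI2, of "?c * S t" x] S unfolding eq by simp
    show "\<bar>?c * S t * I2 (x / S t)\<bar> \<le> ?c * S t * C2" for x
    proof -
      have "?c * S t * \<bar>I2 (x / S t)\<bar> \<le> ?c * S t * C2"
        by (intro mult_left_mono I2_le) (use S in auto)
      then show ?thesis using S by (simp add: abs_mult)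
    qed
  qed simp
qed

theorem is_weak_solution: "weak_solution t0 m h"
  unfolding weak_solution_def
proof (intro conjI allI impI)
  show "continuous_on ({t. t0 \<le> ereal t} \<times> UNIV) (\<lambda>(t, x). h t x)" by (rule h_cont)
  show "\<And>t x. t0 \<le> ereal t \<Longrightarrow> 0 \<le> h t x" by (rule h_nonneg)
  \<comment> \<open>The initial time is a null set. For \<open>t0 = -\<infinity>\<close> the default
    value \<open>real_of_ereal t0 = 0\<close> merely discards one further harmless time.\<close>
  have ae: "AE t in lborel. t0 \<le> ereal t \<longrightarrow> t0 < ereal t"
    using AE_lborel_singleton[of "real_of_ereal t0"]
    by eventually_elim (auto simp: order.order_iff_strict)
  have h_fun: "h t = H t" if "t0 < ereal t" for t using h_eq[OF that] by (auto simp: H_def)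
  fix T
  show "Linf_H1loc {t. t0 \<le> ereal t \<and> t \<le> T} h"
    unfolding Linf_H1loc_def
  proof (intro exI[of _ "\<lambda>t x. f1 (x / S t)"] conjI allI impI)
    show "AE t in lborel. t \<in> {t. t0 \<le> ereal t \<and> t \<le> T} \<longrightarrow> weak_deriv 1 (h t) (\<lambda>x. f1 (x / S t))"
      using ae
    proof eventually_elim
      case (elim t)
      show ?case
      proof
        assume "t \<in> {t. t0 \<le> ereal t \<and> t \<le> T}"
        then have t: "t0 < ereal t" using elim by simp
        have "continuous_on UNIV (\<lambda>x. f1 (x / S t))"
          by (rule continuous_on_compose2[OF cont(2)[of UNIV]]) (use S_pos[OF t] in \<open>auto intro!: continuous_intros\<close>)
        then show "weak_deriv 1 (h t) (\<lambda>x. f1 (x / S t))"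
          unfolding h_fun[OF t] by (intro weak_deriv_1 dH_x[OF t])
      qed
    qed
    fix R :: real assume R: "0 < R"
    obtain B where B: "\<And>t. t0 < ereal t \<Longrightarrow> t \<le> T \<Longrightarrow> S t \<le> B" using S_bdd[of T] by blast
    show "\<exists>C. AE t in lborel. t \<in> {t. t0 \<le> ereal t \<and> t \<le> T} \<longrightarrow>
        set_integrable lborel {-R..R} (\<lambda>x. (h t x)\<^sup>2 + (f1 (x / S t))\<^sup>2) \<and>
        (LINT x:{-R..R}|lborel. (h t x)\<^sup>2 + (f1 (x / S t))\<^sup>2) \<le> C"
    proof (rule exI, rule eventually_mono[OF ae])
      fix t assume "t0 \<le> ereal t \<longrightarrow> t0 < ereal t"
      then show "t \<in> {t. t0 \<le> ereal t \<and> t \<le> T} \<longrightarrow>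
        set_integrable lborel {-R..R} (\<lambda>x. (h t x)\<^sup>2 + (f1 (x / S t))\<^sup>2) \<and>
        (LINT x:{-R..R}|lborel. (h t x)\<^sup>2 + (f1 (x / S t))\<^sup>2)
          \<le> 2 * R * (C0 * (B + R))\<^sup>2 + \<bar>C1\<bar> * (B + R)"
        using H1_bound[OF R _ B] by blast
    qed
  qed
next
  have h_fun: "h t = H t" if "t0 < ereal t" for t using h_eq[OF that] by (auto simp: H_def)
  show "\<exists>h3.
        (AE t in lborel. t0 < ereal t \<longrightarrow>
           weak_deriv 3 (h t) (h3 t) \<and>
           integrable lborel (\<lambda>x. \<bar>h t x powr (m/2) * h3 t x\<bar>\<^sup>2)) \<and>
        (\<forall>\<psi>. test_function ({t. t0 < ereal t} \<times> UNIV) \<psi> \<longrightarrow>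
           set_integrable (lborel :: (real \<times> real) measure) {(t, x). t0 \<le> ereal t \<and> 0 < h t x}
             (\<lambda>(t, x). h t x powr m * h3 t x * deriv (\<lambda>\<xi>. \<psi> (t, \<xi>)) x) \<and>
           (LINT t:{t. t0 \<le> ereal t}|lborel. LINT x|lborel.
               h t x * deriv (\<lambda>s. \<psi> (s, x)) t) +
           (LINT t:{t. t0 \<le> ereal t}|lborel. LINT x:{x. 0 < h t x}|lborel.
               h t x powr m * h3 t x * deriv (\<lambda>\<xi>. \<psi> (t, \<xi>)) x) = 0)"
  proof (intro exI[of _ h3] conjI allI impI AE_I2)
    fix t assume t: "t0 < ereal t"
    note S = S_pos[OF t]
    show "weak_deriv 3 (h t) (h3 t)"
      unfolding h_fun[OF t]
    proof (rule weak_deriv_3)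
      show "(H t has_real_derivative f1 (x / S t)) (at x)" for x by (rule dH_x[OF t])
      show "((\<lambda>x. f1 (x / S t)) has_real_derivative f2 (x / S t) / S t) (at x)" for x
        using d_scaled[OF t d1, of 1] by simp
      show "((\<lambda>x. f2 (x / S t) / S t) has_real_derivative h3 t x) (at x)" for x
        using d_scaled[OF t d2, of "1 / S t"] by (simp add: h3_def power2_eq_square)
      show "continuous_on UNIV (h3 t)"
        unfolding h3_def[abs_def] using S
        by (intro continuous_intros continuous_on_compose2[OF cont(4)[of UNIV]]) auto
    qed
    show "integrable lborel (\<lambda>x. \<bar>h t x powr (m / 2) * h3 t x\<bar>\<^sup>2)" by (rule dissipation_integrable[OF t])
  qed (rule weak_identity; assumption)+
qed

end

section \<open>Even extension of the profile\<close>

lemma has_real_derivative_glue: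
  fixes F D :: "real \<Rightarrow> real"
  assumes r: "\<And>x. 0 \<le> x \<Longrightarrow> (F has_real_derivative D x) (at x within {0..})"
    and l: "\<And>x. x \<le> 0 \<Longrightarrow> (F has_real_derivative D x) (at x within {..0})"
  shows "(F has_real_derivative D x) (at x)"
proof -
  consider "0 < x" | "x < 0" | "x = 0" by linarith
  then show ?thesis
  proof cases
    case 1
    then show ?thesis using r[of x] at_within_pos[of x] by simp
  next
    case 2
    then have "at x within {..0} = at x" by (intro at_within_open_subset[of _ "{..<0}"]) auto
    then show ?thesis using l[of x] 2 by simp
  next
    case 3
    have "((\<lambda>y. (F y - F 0) / (y - 0)) \<longlongrightarrow> D 0) (at_right 0)"
      using r[of 0] by (auto simp: has_field_derivative_iff intro: tendsto_within_subset)
    moreover have "((\<lambda>y. (F y - F 0) / (y - 0)) \<longlongrightarrow> D 0) (at_left 0)"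
      using l[of 0] by (auto simp: has_field_derivative_iff intro: tendsto_within_subset)
    ultimately show ?thesis
      unfolding 3 has_field_derivative_iff by (intro filterlim_split_at)
  qed
qed

lemma reflect_derivative:
  fixes F F' :: "real \<Rightarrow> real"
  assumes r: "\<And>x. 0 \<le> x \<Longrightarrow> (F has_real_derivative F' x) (at x within {0..})" and x: "x \<le> 0"
  shows "((\<lambda>x. F (- x)) has_real_derivative - F' (- x)) (at x within {..0})"
proof -
  have "((F \<circ> uminus) has_real_derivative F' (- x) * (- 1)) (at x within {..0})"
  proof (rule DERIV_image_chain)
    have "uminus ` {..0} = {0::real..}" by (auto simp: image_iff intro: bexI[of _ "- y" for y])
    then show "(F has_real_derivative F' (- x)) (at (- x) within uminus ` {..0})" using r[of "- x"] x by simp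
    show "(uminus has_real_derivative - 1) (at x within {..0})"
      by (auto intro!: derivative_eq_intros)
  qed
  then show ?thesis by (simp add: comp_def)
qed

lemma even_extension_derivative:
  fixes F F' :: "real \<Rightarrow> real"
  assumes r: "\<And>x. 0 \<le> x \<Longrightarrow> (F has_real_derivative F' x) (at x within {0..})" and 0: "F' 0 = 0"
  shows "((\<lambda>x. F \<bar>x\<bar>) has_real_derivative sgn x * F' \<bar>x\<bar>) (at x)"
proof (rule has_real_derivative_glue)
  fix x :: real assume x: "0 \<le> x"
  have "((\<lambda>x. F \<bar>x\<bar>) has_real_derivative F' x) (at x within {0..})"
    by (rule has_field_derivative_transform_within[OF r[OF x] zero_less_one]) (use x in auto)
  moreover have "sgn x * F' \<bar>x\<bar> = F' x" using x 0 by (cases "x = 0") auto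
  ultimately show "((\<lambda>x. F \<bar>x\<bar>) has_real_derivative sgn x * F' \<bar>x\<bar>) (at x within {0..})" by simp
next
  fix x :: real assume x: "x \<le> 0"
  have "((\<lambda>x. F \<bar>x\<bar>) has_real_derivative - F' (- x)) (at x within {..0})"
    by (rule has_field_derivative_transform_within[OF reflect_derivative[OF r x] zero_less_one]) (use x in auto)
  moreover have "sgn x * F' \<bar>x\<bar> = - F' (- x)" using x 0 by (cases "x = 0") auto
  ultimately show "((\<lambda>x. F \<bar>x\<bar>) has_real_derivative sgn x * F' \<bar>x\<bar>) (at x within {..0})" by simp
qed

lemma odd_extension_derivative:
  fixes F F' :: "real \<Rightarrow> real"
  assumes r: "\<And>x. 0 \<le> x \<Longrightarrow> (F has_real_derivative F' x) (at x within {0..})" and 0: "F 0 = 0"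
  shows "((\<lambda>x. sgn x * F \<bar>x\<bar>) has_real_derivative F' \<bar>x\<bar>) (at x)"
proof (rule has_real_derivative_glue)
  fix x :: real assume x: "0 \<le> x"
  have "((\<lambda>x. sgn x * F \<bar>x\<bar>) has_real_derivative F' x) (at x within {0..})"
  proof (rule has_field_derivative_transform_within[OF r[OF x] zero_less_one])
    show "F y = sgn y * F \<bar>y\<bar>" if "y \<in> {0..}" for y using that 0 by (cases "y = 0") auto
  qed (use x in auto)
  then show "((\<lambda>x. sgn x * F \<bar>x\<bar>) has_real_derivative F' \<bar>x\<bar>) (at x within {0..})" using x by simp
next
  fix x :: real assume x: "x \<le> 0"
  have "((\<lambda>x. sgn x * F \<bar>x\<bar>) has_real_derivative - (- F' (- x))) (at x within {..0})"
  proof (rule has_field_derivative_transform_within[OF DERIV_minus[OF reflect_derivative[OF r x]] zero_less_one])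
    show "- F (- y) = sgn y * F \<bar>y\<bar>" if "y \<in> {..0}" for y using that 0 by (cases "y = 0") auto
  qed (use x in auto)
  then show "((\<lambda>x. sgn x * F \<bar>x\<bar>) has_real_derivative F' \<bar>x\<bar>) (at x within {..0})" using x by simp
qed

lemma dilation_derivative:
  fixes F F' :: "real \<Rightarrow> real"
  assumes "\<And>x. (F has_real_derivative F' x) (at x)"
  shows "((\<lambda>x. c * F (x / \<mu>)) has_real_derivative c * F' (x / \<mu>) / \<mu>) (at x)"
proof (cases "\<mu> = 0")
  case False
  have "((\<lambda>x. x / \<mu>) has_real_derivative 1 / \<mu>) (at x)"
    using False by (auto intro!: derivative_eq_intros)
  from DERIV_cmult[OF DERIV_chain2[OF assms this], of c] show ?thesis by simp
qed simp

section \<open>Symmetric extension of a solution of the flow, and its dilations\<close>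

locale power_flow = flow_decay +
  fixes m :: real
  assumes p_eq: "\<And>y. 0 \<le> y \<Longrightarrow> p y = f y powr (- m)"
begin

text \<open>The conditions \<open>v 0 = 0\<close> and \<open>J 0 = 0\<close> make the even extension
  three times continuously differentiable, so that \<open>h_xxx\<close> exists across
  \<open>x = 0\<close> at positive height.\<close>

definition F0 where "F0 y = f \<bar>y\<bar>"
definition F1 where "F1 y = sgn y * v \<bar>y\<bar>"
definition F2 where "F2 y = g \<bar>y\<bar>"
definition F3 where "F3 y = sgn y * (p \<bar>y\<bar> * J \<bar>y\<bar>)"
definition FJ where "FJ y = sgn y * J \<bar>y\<bar>"

lemma dF0: "(F0 has_real_derivative F1 y) (at y)"
  unfolding F0_def[abs_def] F1_def by (rule even_extension_derivative[OF df]) (auto simp: init)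

lemma dF1: "(F1 has_real_derivative F2 y) (at y)"
  unfolding F1_def[abs_def] F2_def by (rule odd_extension_derivative[OF dv]) (auto simp: init)

lemma dF2: "(F2 has_real_derivative F3 y) (at y)"
  unfolding F2_def[abs_def] F3_def by (rule even_extension_derivative[OF dg]) (auto simp: init)

lemma dFJ: "(FJ has_real_derivative y * F1 y - F0 y) (at y)"
proof -
  have "(FJ has_real_derivative \<bar>y\<bar> * v \<bar>y\<bar> - f \<bar>y\<bar>) (at y)"
    unfolding FJ_def[abs_def] by (rule odd_extension_derivative[OF dJ]) (auto simp: init)
  moreover have "\<bar>y\<bar> * v \<bar>y\<bar> = y * F1 y" by (simp add: F1_def abs_sgn mult_ac)
  ultimately show ?thesis by (simp add: F0_def)
qed

lemma F0_ge: "1 / 2 \<le> F0 y" using f_ge_half by (simp add: F0_def)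

lemma FJ_eq: "FJ y = F0 y powr m * F3 y"
proof -
  have "F0 y powr m * p \<bar>y\<bar> = 1" using F0_ge[of y] by (simp add: F0_def p_eq powr_add[symmetric])
  moreover have "F0 y powr m * F3 y = sgn y * J \<bar>y\<bar> * (F0 y powr m * p \<bar>y\<bar>)" by (simp add: F3_def)
  ultimately show ?thesis by (simp add: FJ_def)
qed

text \<open>The sign factor obscures continuity at 0; it is inherited from the differentiable
  \<open>FJ\<close> after division by the mobility.\<close>

lemma cont_F3: "continuous_on UNIV F3"
proof -
  have "F0 y \<noteq> 0" for y using F0_ge[of y] by auto
  then have "continuous_on UNIV (\<lambda>y. FJ y * F0 y powr (- m))"
    using continuous_on_DERIV[OF dFJ] continuous_on_DERIV[OF dF0]
    by (intro continuous_intros) auto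
  moreover have "FJ y * F0 y powr (- m) = F3 y" for y
    using F0_ge[of y] by (simp add: FJ_eq powr_minus)
  ultimately show ?thesis by (simp cong: continuous_on_cong)
qed

lemma f_linear_bound: "\<exists>C. \<forall>y\<ge>0. f y \<le> C * (1 + y)"
proof -
  have "compact (f ` {0..1})"
    by (intro compact_continuous_image continuous_on_subset[OF cont(1)]) auto
  then obtain B where "\<forall>z\<in>f ` {0..1}. norm z \<le> B"
    using compact_imp_bounded bounded_iff by metis
  then have B: "f y \<le> B" if "0 \<le> y" "y \<le> 1" for y using that by force
  define e where "e = slope + (- E 1 + 1 / 2)"
  have e: "0 \<le> e" using slope_pos E_le[of 1] by (simp add: e_def)
  have "f y \<le> (\<bar>B\<bar> + e) * (1 + y)" if y: "0 \<le> y" for y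
  proof (cases "y \<le> 1")
    case True
    have "f y \<le> (\<bar>B\<bar> + e) * 1" using B[OF y True] e by simp
    also have "\<dots> \<le> (\<bar>B\<bar> + e) * (1 + y)" using e y by (intro mult_left_mono) auto
    finally show ?thesis .
  next
    case False
    have "y powr (-1/2) \<le> 1" using powr_mono[of "-1/2" 0 y] False by simp
    then have "(- E 1 + 1 / 2) * y powr (-1/2) \<le> (- E 1 + 1 / 2) * 1"
      using E_le[of 1] by (intro mult_left_mono) auto
    then have "u y \<le> e" using slope_rate[of y] False by (simp add: e_def)
    then have "f y \<le> e * y" using False by (simp add: u_def field_simps)
    also have "\<dots> \<le> (\<bar>B\<bar> + e) * (1 + y)" using e y by (intro mult_mono) auto
    finally show ?thesis .
  qed
  then show ?thesis by blast
qed

text \<open>The scaled profile \<open>l f(y / \<mu>)\<close> solves the profile equation with \<open>\<beta> = l\<^sup>m / \<mu>\<^sup>4\<close>.\<close>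
definition fs where "fs l \<mu> y = l * F0 (y / \<mu>)"

lemma scaled_weak_solution:
  assumes l: "0 < l" and \<mu>: "0 < \<mu>" and \<beta>: "\<beta> = l powr m / \<mu> ^ 4"
    and t0: "t0 \<noteq> \<infinity>"
    and S_pos: "\<And>t. t0 < ereal t \<Longrightarrow> 0 < S t"
    and dS: "\<And>t. t0 < ereal t \<Longrightarrow> (S has_real_derivative \<beta> * S t powr (m - 3)) (at t)"
    and S_bdd: "\<And>T. \<exists>B. \<forall>t. t0 < ereal t \<and> t \<le> T \<longrightarrow> S t \<le> B"
    and h_eq: "\<And>t x. t0 < ereal t \<Longrightarrow> h t x = S t * fs l \<mu> (x / S t)"
    and h_nonneg: "\<And>t x. t0 \<le> ereal t \<Longrightarrow> 0 \<le> h t x"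
    and h_cont: "continuous_on ({t. t0 \<le> ereal t} \<times> UNIV) (\<lambda>(t, x). h t x)"
  shows "weak_solution t0 m h"
proof -
  obtain Cf where Cf: "\<And>y. 0 \<le> y \<Longrightarrow> f y \<le> Cf * (1 + y)" using f_linear_bound by blast
  obtain Cg where Cg: "\<And>Y. 0 \<le> Y \<Longrightarrow> integral {0..Y} (\<lambda>y. (v y)\<^sup>2) \<le> Cg * (1 + Y)" using gradient_bound by blast
  obtain Cd where Cd: "\<And>Y. 0 \<le> Y \<Longrightarrow> integral {0..Y} (\<lambda>y. p y * (J y)\<^sup>2) \<le> Cd" using dissipation_bound by blast
  define W1 where "W1 Y = integral {0..Y} (\<lambda>y. (v y)\<^sup>2)" for Y
  define W2 where "W2 Y = integral {0..Y} (\<lambda>y. p y * (J y)\<^sup>2)" for Y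
  have dW1: "(W1 has_real_derivative (v y)\<^sup>2) (at y within {0..})" if "0 \<le> y" for y
    unfolding W1_def[abs_def] by (rule integral_half_line_deriv) (use that in \<open>auto intro!: continuous_intros cont\<close>)
  have dW2: "(W2 has_real_derivative p y * (J y)\<^sup>2) (at y within {0..})" if "0 \<le> y" for y
    unfolding W2_def[abs_def]
    by (rule integral_half_line_deriv) (use that in \<open>auto intro!: continuous_intros cont p_cont\<close>)
  have W0: "W1 0 = 0" "W2 0 = 0" by (simp_all add: W1_def W2_def)
  \<comment> \<open>Odd extensions turn the one-sided integrals into primitives on the whole line; a
    symmetric increment is then twice the one-sided value.\<close>
  define V1 where "V1 y = sgn y * W1 \<bar>y\<bar>" for y
  define V2 where "V2 y = sgn y * W2 \<bar>y\<bar>" for y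
  have dV1: "(V1 has_real_derivative (F1 y)\<^sup>2) (at y)" for y
  proof -
    have "(V1 has_real_derivative (v \<bar>y\<bar>)\<^sup>2) (at y)"
      unfolding V1_def[abs_def] by (rule odd_extension_derivative[OF dW1 W0(1)])
    moreover have "(v \<bar>y\<bar>)\<^sup>2 = (F1 y)\<^sup>2"
      by (cases "y = 0") (auto simp: F1_def init power_mult_distrib sgn_if)
    ultimately show ?thesis by simp
  qed
  have dV2: "(V2 has_real_derivative F0 y powr m * (F3 y)\<^sup>2) (at y)" for y
  proof -
    have "(V2 has_real_derivative p \<bar>y\<bar> * (J \<bar>y\<bar>)\<^sup>2) (at y)"
      unfolding V2_def[abs_def] by (rule odd_extension_derivative[OF dW2 W0(2)])
    moreover have "p \<bar>y\<bar> * (J \<bar>y\<bar>)\<^sup>2 = F0 y powr m * (F3 y)\<^sup>2"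
    proof -
      have "F0 y powr m * (F3 y)\<^sup>2 = FJ y * F3 y" by (simp add: FJ_eq power2_eq_square)
      also have "\<dots> = p \<bar>y\<bar> * (J \<bar>y\<bar>)\<^sup>2"
        by (cases "y = 0") (auto simp: FJ_def F3_def init sgn_if power2_eq_square)
      finally show ?thesis by simp
    qed
    ultimately show ?thesis by simp
  qed
  have "self_similar t0 m \<beta> S (fs l \<mu>) (\<lambda>y. l / \<mu> * F1 (y / \<mu>)) (\<lambda>y. l / \<mu>\<^sup>2 * F2 (y / \<mu>))
     (\<lambda>y. l / \<mu> ^ 3 * F3 (y / \<mu>)) (\<lambda>y. l powr m * l / \<mu> ^ 3 * FJ (y / \<mu>))
     (\<lambda>y. l\<^sup>2 / \<mu> * V1 (y / \<mu>)) (\<lambda>y. l powr m * l\<^sup>2 / \<mu> ^ 5 * V2 (y / \<mu>))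
     (l * \<bar>Cf\<bar> * (1 + 1 / \<mu>)) (2 * l\<^sup>2 / \<mu> * \<bar>Cg\<bar> * (1 + 1 / \<mu>)) (l powr m * l\<^sup>2 / \<mu> ^ 5 * \<bar>Cd\<bar>) h"
  proof
    have scale: "1 + y / \<mu> \<le> (1 + 1 / \<mu>) * (1 + y)" if "0 \<le> y" for y
      using that \<mu> by (simp add: algebra_simps add_divide_distrib)
    fix y
    show "(fs l \<mu> has_real_derivative l / \<mu> * F1 (y / \<mu>)) (at y)"
      using dilation_derivative[OF dF0, of l \<mu> y] by (simp add: fs_def[abs_def])
    show "((\<lambda>y. l / \<mu> * F1 (y / \<mu>)) has_real_derivative l / \<mu>\<^sup>2 * F2 (y / \<mu>)) (at y)"
      using dilation_derivative[OF dF1, of "l / \<mu>" \<mu> y] by (simp add: power2_eq_square)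
    show "((\<lambda>y. l / \<mu>\<^sup>2 * F2 (y / \<mu>)) has_real_derivative l / \<mu> ^ 3 * F3 (y / \<mu>)) (at y)"
      using dilation_derivative[OF dF2, of "l / \<mu>\<^sup>2" \<mu> y] by (simp add: power2_eq_square power3_eq_cube)
    have "l powr m * l / \<mu> ^ 3 * (y / \<mu> * F1 (y / \<mu>) - F0 (y / \<mu>)) / \<mu>
        = \<beta> * (y * (l / \<mu> * F1 (y / \<mu>)) - fs l \<mu> y)"
      using \<mu> unfolding \<beta> fs_def by (simp add: field_simps power3_eq_cube power4_eq_xxxx)
    then show "((\<lambda>y. l powr m * l / \<mu> ^ 3 * FJ (y / \<mu>)) has_real_derivative
        \<beta> * (y * (l / \<mu> * F1 (y / \<mu>)) - fs l \<mu> y)) (at y)"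
      using dilation_derivative[OF dFJ, of "l powr m * l / \<mu> ^ 3" \<mu> y] by simp
    show "continuous_on UNIV (\<lambda>y. l / \<mu> ^ 3 * F3 (y / \<mu>))"
      using \<mu> by (intro continuous_intros continuous_on_compose2[OF cont_F3]) auto
    have F0p: "0 < F0 z" for z using F0_ge[of z] by simp
    show "0 < fs l \<mu> y" using F0p l by (simp add: fs_def)
    have fsp: "fs l \<mu> y powr m = l powr m * F0 (y / \<mu>) powr m"
      using F0p[of "y / \<mu>"] l by (simp add: fs_def powr_mult)
    show "l powr m * l / \<mu> ^ 3 * FJ (y / \<mu>) = fs l \<mu> y powr m * (l / \<mu> ^ 3 * F3 (y / \<mu>))"
      unfolding fsp FJ_eq by simp
    show "fs l \<mu> y \<le> l * \<bar>Cf\<bar> * (1 + 1 / \<mu>) * (1 + \<bar>y\<bar>)"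
    proof -
      have "F0 (y / \<mu>) \<le> Cf * (1 + \<bar>y\<bar> / \<mu>)" using Cf[of "\<bar>y / \<mu>\<bar>"] \<mu> by (simp add: F0_def)
      also have "\<dots> \<le> \<bar>Cf\<bar> * ((1 + 1 / \<mu>) * (1 + \<bar>y\<bar>))"
        using scale[of "\<bar>y\<bar>"] \<mu> by (intro mult_mono) auto
      finally have "l * F0 (y / \<mu>) \<le> l * (\<bar>Cf\<bar> * ((1 + 1 / \<mu>) * (1 + \<bar>y\<bar>)))"
        using l by (intro mult_left_mono) auto
      then show ?thesis by (simp add: fs_def mult_ac)
    qed
    show "((\<lambda>y. l\<^sup>2 / \<mu> * V1 (y / \<mu>)) has_real_derivative (l / \<mu> * F1 (y / \<mu>))\<^sup>2) (at y)"
      using dilation_derivative[OF dV1, of "l\<^sup>2 / \<mu>" \<mu> y] by (simp add: power2_eq_square mult_ac)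
    show "((\<lambda>y. l powr m * l\<^sup>2 / \<mu> ^ 5 * V2 (y / \<mu>)) has_real_derivative
        fs l \<mu> y powr m * (l / \<mu> ^ 3 * F3 (y / \<mu>))\<^sup>2) (at y)"
    proof -
      have "l powr m * l\<^sup>2 / \<mu> ^ 5 * (F0 (y / \<mu>) powr m * (F3 (y / \<mu>))\<^sup>2) / \<mu>
          = fs l \<mu> y powr m * (l / \<mu> ^ 3 * F3 (y / \<mu>))\<^sup>2"
        unfolding fsp by (simp add: power2_eq_square eval_nat_numeral mult_ac)
      then show ?thesis
        using dilation_derivative[OF dV2, of "l powr m * l\<^sup>2 / \<mu> ^ 5" \<mu> y] by simp
    qed
    show "\<bar>l powr m * l\<^sup>2 / \<mu> ^ 5 * V2 (y / \<mu>)\<bar> \<le> l powr m * l\<^sup>2 / \<mu> ^ 5 * \<bar>Cd\<bar>"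
    proof -
      have W2_nonneg: "0 \<le> W2 z" if "0 \<le> z" for z
      proof -
        have "W2 0 \<le> W2 z"
          by (rule mono_from_deriv[OF that dW2]) (auto simp: less_imp_le[OF p_pos])
        then show ?thesis using W0 by simp
      qed
      have "\<bar>V2 z\<bar> \<le> \<bar>Cd\<bar>" for z
      proof -
        have "\<bar>V2 z\<bar> \<le> \<bar>W2 \<bar>z\<bar>\<bar>" by (auto simp: V2_def abs_mult sgn_if)
        also have "\<bar>W2 \<bar>z\<bar>\<bar> = W2 \<bar>z\<bar>" using W2_nonneg[of "\<bar>z\<bar>"] by simp
        also have "\<dots> \<le> Cd" unfolding W2_def by (rule Cd) simp
        finally show ?thesis by linarith
      qed
      then have "l powr m * l\<^sup>2 / \<mu> ^ 5 * \<bar>V2 (y / \<mu>)\<bar> \<le> l powr m * l\<^sup>2 / \<mu> ^ 5 * \<bar>Cd\<bar>"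
        using l \<mu> by (intro mult_left_mono) auto
      then show ?thesis using l \<mu> by (simp add: abs_mult)
    qed
    show "l\<^sup>2 / \<mu> * V1 (y / \<mu>) - l\<^sup>2 / \<mu> * V1 (- y / \<mu>) \<le> 2 * l\<^sup>2 / \<mu> * \<bar>Cg\<bar> * (1 + 1 / \<mu>) * (1 + y)"
      if "0 \<le> y"
    proof -
      have "V1 (- y / \<mu>) = - V1 (y / \<mu>)" by (simp add: V1_def sgn_minus)
      moreover have "V1 (y / \<mu>) \<le> \<bar>Cg\<bar> * ((1 + 1 / \<mu>) * (1 + y))"
      proof -
        have "V1 (y / \<mu>) = W1 (y / \<mu>)" using that \<mu> W0 by (cases "y = 0") (auto simp: V1_def)
        also have "\<dots> \<le> Cg * (1 + y / \<mu>)" using Cg[of "y / \<mu>"] that \<mu> by (simp add: W1_def)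
        also have "\<dots> \<le> \<bar>Cg\<bar> * ((1 + 1 / \<mu>) * (1 + y))"
          using scale[OF that] that \<mu> by (intro mult_mono) auto
        finally show ?thesis .
      qed
      then have "2 * (l\<^sup>2 / \<mu>) * V1 (y / \<mu>) \<le> 2 * (l\<^sup>2 / \<mu>) * (\<bar>Cg\<bar> * ((1 + 1 / \<mu>) * (1 + y)))"
        using l \<mu> by (intro mult_left_mono) auto
      ultimately show ?thesis by (simp add: mult_ac)
    qed
  qed (use assms in auto)
  then show ?thesis by (rule self_similar.is_weak_solution)
qed

lemma fs_even: "fs l \<mu> \<bar>y\<bar> = fs l \<mu> y" if "0 < \<mu>"
  using that by (simp add: fs_def F0_def)

lemma fs_slope:
  assumes "0 < l" "0 < \<mu>"
  shows "((\<lambda>y. fs l \<mu> y / y) \<longlongrightarrow> l * slope / \<mu>) at_top"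
proof -
  have "filterlim (\<lambda>y. y / \<mu>) at_top at_top"
    using filterlim_tendsto_pos_mult_at_top[OF tendsto_const _ filterlim_ident, of "1 / \<mu>"] assms by simp
  from filterlim_compose[OF slope this]
  have "((\<lambda>y. l / \<mu> * u (y / \<mu>)) \<longlongrightarrow> l / \<mu> * slope) at_top" by (intro tendsto_intros)
  moreover have "\<forall>\<^sub>F y in at_top. l / \<mu> * u (y / \<mu>) = fs l \<mu> y / y"
    using eventually_gt_at_top[of 0]
    by eventually_elim (use assms in \<open>simp add: u_def fs_def F0_def\<close>)
  ultimately have "((\<lambda>y. fs l \<mu> y / y) \<longlongrightarrow> l / \<mu> * slope) at_top" by (rule Lim_transform_eventually)
  then show ?thesis by simp
qed

lemma cont_fs: "continuous_on A (fs l \<mu>)"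
proof -
  have "continuous_on UNIV F0" by (rule continuous_on_DERIV[OF dF0])
  then have "continuous_on A (\<lambda>y. F0 (y * inverse \<mu>))"
    by (rule continuous_on_compose2) (auto intro!: continuous_intros)
  then show ?thesis unfolding fs_def[abs_def] divide_inverse by (intro continuous_intros)
qed

lemma fs_pos: "0 < l \<Longrightarrow> 0 < fs l \<mu> y"
  using F0_ge[of "y / \<mu>"] by (simp add: fs_def)

end

section \<open>Existence of the profile\<close>

text \<open>For arguments at least 1/2 and \<open>m \<le> 4\<close> the value is at most
  \<open>2^4 = 16\<close>, and the derivative at most \<open>m 2^(m+1) \<le> 4 * 32 = 128\<close>.
  These are the constants of the shooting.\<close>

lemma truncated_mobility:
  fixes m :: real
  assumes m: "0 < m" "m \<le> 4"
  defines "P \<equiv> \<lambda>x. max x (1 / 2) powr (- m)"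
  shows "0 < P x" "P x \<le> 16" "\<bar>P x - P y\<bar> \<le> 128 * \<bar>x - y\<bar>"
proof -
  show "0 < P x" by (simp add: P_def max_def)
  have le: "z powr (- c) \<le> 2 powr c" if "1 / 2 \<le> z" "0 \<le> c" for z c :: real
  proof -
    have "z powr (- c) \<le> (1 / 2) powr (- c)" using that by (intro powr_mono2') auto
    also have "\<dots> = 2 powr c" by (simp add: powr_minus powr_divide)
    finally show ?thesis .
  qed
  have "P x \<le> 2 powr m" unfolding P_def using m by (intro le) auto
  also have "\<dots> \<le> 2 powr 4" using m by (intro powr_mono) auto
  finally show "P x \<le> 16" by simp
  have "norm (max x (1/2) powr (- m) - max y (1/2) powr (- m)) \<le> 128 * norm (max x (1/2) - max y (1/2))"
  proof (rule field_differentiable_bound)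
    show "convex {1 / 2 :: real..}" by simp
    fix z :: real assume z: "z \<in> {1 / 2..}"
    then show "((\<lambda>z. z powr (- m)) has_field_derivative - m * z powr (- m - 1)) (at z within {1 / 2..})"
      by (auto intro!: derivative_eq_intros)
    have "z powr (- m - 1) \<le> 2 powr (m + 1)" using le[of z "m + 1"] z m by simp
    also have "\<dots> \<le> 2 powr 5" using m by (intro powr_mono) auto
    finally have "m * z powr (- m - 1) \<le> 4 * 32" using m by (intro mult_mono) auto
    then show "norm (- m * z powr (- m - 1)) \<le> 128" using m by (simp add: abs_mult)
  qed auto
  also have "\<dots> \<le> 128 * \<bar>x - y\<bar>" by (auto simp: max_def)
  finally show "\<bar>P x - P y\<bar> \<le> 128 * \<bar>x - y\<bar>" by (simp add: P_def)
qed

lemma power_flow_exists: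
  fixes m :: real
  assumes m: "0 < m" "m \<le> 4"
  shows "\<exists>f v g J p k. power_flow f v g J p k m"
proof -
  define P where "P x = max x (1 / 2) powr (- m)" for x :: real
  note P = truncated_mobility[OF m, folded P_def]
  obtain f v g J k where fl: "flow f v g J (\<lambda>y. P (f y)) k" and E: "\<forall>y>0. flow.E f v g J y \<le> 0"
    using shooting[OF P] by blast
  interpret flow f v g J "\<lambda>y. P (f y)" k by (rule fl)
  have cP: "continuous_on UNIV P"
  proof -
    have "128-lipschitz_on UNIV P"
      by (rule lipschitz_onI) (use P(3) in \<open>auto simp: dist_real_def\<close>)
    then show ?thesis by (rule lipschitz_on_continuous_on)
  qed
  interpret flow_decay f v g J "\<lambda>y. P (f y)" k
    by unfold_locales (use E in \<open>auto intro: continuous_on_compose2[OF cP cont(1)]\<close>)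
  have "power_flow f v g J (\<lambda>y. P (f y)) k m"
  proof
    fix y :: real assume "0 \<le> y"
    then have "max (f y) (1 / 2) = f y" using f_ge_half[of y] by (intro max_absorb1)
    then show "P (f y) = f y powr (- m)" by (simp add: P_def)
  qed
  then show ?thesis by blast
qed

context power_flow
begin

text \<open>From \<open>f / y \<rightarrow> a\<close> alone, \<open>f - a y\<close> need not be
  bounded, hence the slack \<open>e \<bar>y\<bar>\<close>. After scaling the bound reads
  \<open>K S + e \<bar>x\<bar>\<close>, which gives locally uniform convergence to the wedge as
  \<open>S\<close> tends to 0.\<close>

lemma fs_near_wedge:
  assumes "0 < l" "0 < \<mu>" "0 < e"
  shows "\<exists>K\<ge>0. \<forall>y. \<bar>fs l \<mu> y - l * slope / \<mu> * \<bar>y\<bar>\<bar> \<le> K + e * \<bar>y\<bar>"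
proof -
  let ?a = "l * slope / \<mu>"
  have "\<forall>\<^sub>F y in at_top. dist (fs l \<mu> y / y) ?a < e"
    using fs_slope[OF assms(1,2)] assms(3) by (rule tendstoD)
  then obtain Y where Y: "\<And>y. Y \<le> y \<Longrightarrow> dist (fs l \<mu> y / y) ?a < e"
    by (auto simp: eventually_at_top_linorder)
  define Z where "Z = max 1 Y"
  have "compact ((\<lambda>y. fs l \<mu> y - ?a * \<bar>y\<bar>) ` {0..Z})"
    by (intro compact_continuous_image continuous_intros cont_fs) auto
  then obtain B where "\<forall>z\<in>(\<lambda>y. fs l \<mu> y - ?a * \<bar>y\<bar>) ` {0..Z}. norm z \<le> B"
    using compact_imp_bounded bounded_iff by metis
  then have B: "\<bar>fs l \<mu> y - ?a * \<bar>y\<bar>\<bar> \<le> B" if "0 \<le> y" "y \<le> Z" for y using that by force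
  have "\<bar>fs l \<mu> y - ?a * \<bar>y\<bar>\<bar> \<le> \<bar>B\<bar> + e * \<bar>y\<bar>" for y
  proof -
    have "\<bar>fs l \<mu> z - ?a * z\<bar> \<le> \<bar>B\<bar> + e * z" if z: "0 \<le> z" for z
    proof (cases "z \<le> Z")
      case True
      then have "\<bar>fs l \<mu> z - ?a * z\<bar> \<le> B" using B[OF z] z by simp
      moreover have "0 \<le> e * z" using assms z by simp
      ultimately show ?thesis by linarith
    next
      case False
      then have zp: "0 < z" "Y \<le> z" by (auto simp: Z_def)
      have "\<bar>fs l \<mu> z / z - ?a\<bar> * z \<le> e * z"
        using Y[OF zp(2)] zp by (intro mult_right_mono) (auto simp: dist_real_def)
      moreover have "\<bar>fs l \<mu> z / z - ?a\<bar> * z = \<bar>fs l \<mu> z - ?a * z\<bar>"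
      proof -
        have "fs l \<mu> z - ?a * z = (fs l \<mu> z / z - ?a) * z"
          using zp by (simp add: algebra_simps)
        then show ?thesis using zp by (simp add: abs_mult)
      qed
      ultimately show ?thesis by simp
    qed
    from this[of "\<bar>y\<bar>"] show ?thesis using fs_even[OF assms(2)] by simp
  qed
  then show ?thesis by (intro exI[of _ "\<bar>B\<bar>"]) auto
qed

end

section \<open>Subcritical exponents\<close>

lemma wedge_solution:
  fixes m a :: real
  assumes m: "0 < m" "m < 4" and a: "0 < a"
  shows "\<exists>(h :: real \<Rightarrow> real \<Rightarrow> real) (f :: real \<Rightarrow> real).
         weak_solution 0 m h \<and>
         has_initial_data 0 h (\<lambda>x. a * \<bar>x\<bar>) \<and>
         (\<forall>t>0. \<forall>x. h t x = t powr (1 / (4 - m)) * f (\<bar>x\<bar> / t powr (1 / (4 - m))))"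
proof -
  obtain f v g J p k where "power_flow f v g J p k m"
    using power_flow_exists[OF m(1)] m(2) by auto
  then interpret power_flow f v g J p k m .
  define \<alpha> where "\<alpha> = 1 / (4 - m)"
  have \<alpha>: "0 < \<alpha>" "(4 - m) * \<alpha> = 1" using m by (auto simp: \<alpha>_def)
  \<comment> \<open>The slope requires \<open>l = a \<mu> / slope\<close>, and the rate
    \<open>l^m / \<mu>^4\<close> must equal \<open>\<alpha>\<close> because
    \<open>S = t^\<alpha>\<close>. Together this means
    \<open>\<mu>^(4-m) = (a / slope)^m / \<alpha>\<close>, solvable since
    \<open>m < 4\<close>.\<close>
  define \<mu> where "\<mu> = ((a / slope) powr m / \<alpha>) powr \<alpha>"
  define l where "l = a * \<mu> / slope"
  note sp = slope_pos
  have \<mu>: "0 < \<mu>" using sp a \<alpha> by (simp add: \<mu>_def)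
  have l: "0 < l" using sp a \<mu> by (simp add: l_def)
  have slope: "l * slope / \<mu> = a" using sp \<mu> by (simp add: l_def)
  have \<beta>: "\<alpha> = l powr m / \<mu> ^ 4"
  proof -
    have "\<mu> powr (4 - m) = (a / slope) powr m / \<alpha>"
      unfolding \<mu>_def powr_powr using \<alpha> sp a by (simp add: mult.commute)
    moreover have "\<mu> powr (4 - m) = \<mu> ^ 4 / \<mu> powr m"
      using \<mu> by (simp add: powr_diff)
    ultimately have "\<mu> ^ 4 = \<mu> powr m * (a / slope) powr m / \<alpha>" using \<mu> by (simp add: field_simps)
    also have "\<mu> powr m * (a / slope) powr m = l powr m"
      unfolding l_def using \<mu> a sp by (subst powr_mult[symmetric]) (auto simp: mult.commute)
    finally show ?thesis using \<alpha> \<mu> by (simp add: field_simps)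
  qed
  define S where "S t = t powr \<alpha>" for t :: real
  \<comment> \<open>The self-similar formula degenerates at \<open>t = 0\<close>, where the wedge is
    put in by hand; \<open>near\<close> provides the continuity there.\<close>
  define h where "h t x = (if t \<le> 0 then a * \<bar>x\<bar> else S t * fs l \<mu> (x / S t))" for t x :: real
  have near: "\<exists>K\<ge>0. \<forall>t x. 0 \<le> t \<longrightarrow> \<bar>h t x - a * \<bar>x\<bar>\<bar> \<le> K * S t + e * \<bar>x\<bar>" if e: "0 < e" for e
  proof -
    obtain K where K: "0 \<le> K" "\<And>y. \<bar>fs l \<mu> y - a * \<bar>y\<bar>\<bar> \<le> K + e * \<bar>y\<bar>"
      using fs_near_wedge[OF l \<mu> e] unfolding slope by blast
    have "\<bar>h t x - a * \<bar>x\<bar>\<bar> \<le> K * S t + e * \<bar>x\<bar>" if t: "0 \<le> t" for t x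
    proof (cases "t = 0")
      case True
      then show ?thesis using e by (simp add: h_def S_def)
    next
      case False
      then have S: "0 < S t" using t by (simp add: S_def)
      have "h t x - a * \<bar>x\<bar> = S t * (fs l \<mu> (x / S t) - a * \<bar>x / S t\<bar>)"
        using S False t by (simp add: h_def algebra_simps)
      then have "\<bar>h t x - a * \<bar>x\<bar>\<bar> = S t * \<bar>fs l \<mu> (x / S t) - a * \<bar>x / S t\<bar>\<bar>"
        using S by (simp add: abs_mult)
      also have "\<dots> \<le> S t * (K + e * \<bar>x / S t\<bar>)" using S by (intro mult_left_mono K) auto
      also have "\<dots> = K * S t + e * \<bar>x\<bar>" using S by (simp add: algebra_simps)
      finally show ?thesis .
    qed
    then show ?thesis using K(1) by blast
  qed
  have contS: "continuous_on {0..} S"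
    unfolding S_def by (intro continuous_on_powr' continuous_intros) (use \<alpha> in auto)
  have cont_h: "continuous_on ({0..} \<times> UNIV) (\<lambda>(t, x). h t x)"
    unfolding continuous_on_eq_continuous_within
  proof
    fix z :: "real \<times> real" assume "z \<in> {0..} \<times> UNIV"
    then obtain t0 x0 where z: "z = (t0, x0)" "0 \<le> t0" by auto
    show "continuous (at z within {0..} \<times> UNIV) (\<lambda>(t, x). h t x)"
    proof (cases "t0 = 0")
      case False
      let ?A = "{(0::real)<..} \<times> (UNIV :: real set)"
      have cS: "continuous_on ?A (\<lambda>z. S (fst z))"
        by (rule continuous_on_compose2[OF contS]) (auto intro!: continuous_intros)
      have "continuous_on ?A (\<lambda>z. S (fst z) * fs l \<mu> (snd z / S (fst z)))"
        by (intro continuous_intros cS continuous_on_compose2[OF cont_fs[of UNIV]]) (auto simp: S_def)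
      then have "continuous_on ?A (\<lambda>(t, x). h t x)"
        by (rule continuous_on_eq) (auto simp: h_def)
      moreover have "open ?A" by (intro open_Times) auto
      ultimately have "continuous (at z) (\<lambda>(t, x). h t x)"
        using z False by (auto simp: continuous_on_eq_continuous_at)
      then show ?thesis by (rule continuous_at_imp_continuous_at_within)
    next
      case True
      let ?F = "at z within {0..} \<times> (UNIV :: real set)"
      have zF: "\<forall>\<^sub>F p in ?F. p \<in> {0..} \<times> UNIV" by (simp add: eventually_at_filter)
      have fst0: "(fst \<longlongrightarrow> 0) ?F" and sndx: "(snd \<longlongrightarrow> x0) ?F"
        using tendsto_fst[OF tendsto_ident_at, of z] tendsto_snd[OF tendsto_ident_at, of z] z True by auto
      have "((\<lambda>p. S (fst p)) \<longlongrightarrow> S 0) ?F"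
      proof (rule continuous_on_tendsto_compose[OF contS fst0])
        show "\<forall>\<^sub>F p in ?F. fst p \<in> {0..}" using zF by eventually_elim auto
      qed simp
      then have S0: "((\<lambda>p. S (fst p)) \<longlongrightarrow> 0) ?F" by (simp add: S_def)
      have r0: "((\<lambda>p. h (fst p) (snd p) - a * \<bar>snd p\<bar>) \<longlongrightarrow> 0) ?F"
      proof (rule tendstoI)
        fix e :: real assume e: "0 < e"
        define e1 where "e1 = e / (2 * (\<bar>x0\<bar> + 1))"
        have e1: "0 < e1" "e1 * (\<bar>x0\<bar> + 1) = e / 2" using e by (auto simp: e1_def field_simps)
        obtain K where K: "\<And>t x. 0 \<le> t \<Longrightarrow> \<bar>h t x - a * \<bar>x\<bar>\<bar> \<le> K * S t + e1 * \<bar>x\<bar>"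
          using near[OF e1(1)] by blast
        have "((\<lambda>p. K * S (fst p)) \<longlongrightarrow> K * 0) ?F" by (intro tendsto_intros S0)
        then have "\<forall>\<^sub>F p in ?F. K * S (fst p) < e / 2" by (rule order_tendstoD) (use e in simp)
        moreover have "((\<lambda>p. \<bar>snd p\<bar>) \<longlongrightarrow> \<bar>x0\<bar>) ?F" by (intro tendsto_intros sndx)
        then have "\<forall>\<^sub>F p in ?F. \<bar>snd p\<bar> < \<bar>x0\<bar> + 1" by (rule order_tendstoD) simp
        ultimately show "\<forall>\<^sub>F p in ?F. dist (h (fst p) (snd p) - a * \<bar>snd p\<bar>) 0 < e"
          using zF
        proof eventually_elim
          case (elim p)
          have "\<bar>h (fst p) (snd p) - a * \<bar>snd p\<bar>\<bar> \<le> K * S (fst p) + e1 * \<bar>snd p\<bar>"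
            by (rule K) (use elim in auto)
          also have "e1 * \<bar>snd p\<bar> \<le> e1 * (\<bar>x0\<bar> + 1)" using e1 elim by (intro mult_left_mono) auto
          finally show ?case using elim e1 by (simp add: dist_real_def)
        qed
      qed
      have "((\<lambda>p. (h (fst p) (snd p) - a * \<bar>snd p\<bar>) + a * \<bar>snd p\<bar>) \<longlongrightarrow> 0 + a * \<bar>x0\<bar>) ?F"
        by (intro tendsto_intros r0 sndx)
      then have lim: "((\<lambda>p. h (fst p) (snd p)) \<longlongrightarrow> a * \<bar>x0\<bar>) ?F" by simp
      have "a * \<bar>x0\<bar> = h (fst z) (snd z)" using z True by (simp add: h_def)
      with lim show ?thesis unfolding continuous_within case_prod_beta by simp
    qed
  qed
  have ws: "weak_solution 0 m h"
  proof (rule scaled_weak_solution[OF l \<mu> \<beta>, where S = S])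
    fix t assume "0 < ereal t"
    then have t: "0 < t" by simp
    show "0 < S t" using t by (simp add: S_def)
    have "\<alpha> * (m - 3) = \<alpha> - 1" using \<alpha>(2) by (simp add: algebra_simps)
    then have "S t powr (m - 3) = t powr (\<alpha> - 1)" by (simp add: S_def powr_powr)
    then show "(S has_real_derivative \<alpha> * S t powr (m - 3)) (at t)"
      unfolding S_def[abs_def] using t by (auto intro!: derivative_eq_intros)
    show "h t x = S t * fs l \<mu> (x / S t)" for x using t by (simp add: h_def)
  next
    fix T
    show "\<exists>B. \<forall>t. 0 < ereal t \<and> t \<le> T \<longrightarrow> S t \<le> B"
      unfolding S_def using \<alpha> by (intro exI[of _ "T powr \<alpha>"]) (auto intro: powr_mono2)
  next
    fix t x
    show "0 \<le> h t x" using fs_pos[OF l, of \<mu> "x / S t"] a by (simp add: h_def S_def)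
  next
    have "{t. 0 \<le> ereal t} = {0..}" by auto
    then show "continuous_on ({t. 0 \<le> ereal t} \<times> UNIV) (\<lambda>(t, x). h t x)" using cont_h by simp
  qed simp
  have "has_initial_data 0 h (\<lambda>x. a * \<bar>x\<bar>)"
    unfolding has_initial_data_def
  proof (intro conjI allI)
    show "continuous_on UNIV (\<lambda>x. a * \<bar>x\<bar>)" by (intro continuous_intros)
    fix x :: real
    have "continuous_on {0..} (\<lambda>t. case (t, x) of (t, x) \<Rightarrow> h t x)"
      by (rule continuous_on_compose2[OF cont_h], intro continuous_on_Pair continuous_on_const continuous_on_id) auto
    then have "((\<lambda>t. h t x) \<longlongrightarrow> h 0 x) (at 0 within {0..})" by (simp add: continuous_on)
    then have "((\<lambda>t. h t x) \<longlongrightarrow> a * \<bar>x\<bar>) (at_right 0)"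
      by (auto simp: h_def intro: tendsto_within_subset)
    then have "(((\<lambda>t. h t x) \<circ> real_of_ereal) \<longlongrightarrow> a * \<bar>x\<bar>) (at_right (ereal 0))"
      unfolding ereal_tendsto_simps1 .
    then show "((\<lambda>t. h (real_of_ereal t) x) \<longlongrightarrow> a * \<bar>x\<bar>) (at_right 0)"
      by (simp add: comp_def zero_ereal_def)
  qed
  moreover have "h t x = t powr (1 / (4 - m)) * fs l \<mu> (\<bar>x\<bar> / t powr (1 / (4 - m)))" if "0 < t" for t x
  proof -
    have "fs l \<mu> (x / S t) = fs l \<mu> \<bar>x / S t\<bar>" by (rule fs_even[OF \<mu>, symmetric])
    then show ?thesis using that by (simp add: h_def S_def \<alpha>_def)
  qed
  ultimately show ?thesis using ws by blast
qed

section \<open>The critical exponent\<close>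

lemma critical_solution:
  fixes a :: real
  assumes a: "0 < a"
  shows "\<exists>(b :: real) (\<kappa> :: real) (f :: real \<Rightarrow> real) (K :: complex) (z0 :: complex)
         (h :: real \<Rightarrow> real \<Rightarrow> real).
         0 < b \<and> 0 < \<kappa> \<and> profile a b \<kappa> f \<and>
         leading_root a b z0 \<and> Re z0 < -1 \<and>
         (\<lambda>y. f y - a * y - Re (K * complex_of_real y powr (1 + z0)))
            \<in> o[at_top](\<lambda>y. y powr (1 + Re z0)) \<and>
         weak_solution (-\<infinity>) 4 h \<and>
         (\<forall>t x. h t x = exp (b * t) * f (\<bar>x\<bar> / exp (b * t))) \<and>
         (\<forall>R>0. \<forall>\<epsilon>>0. \<forall>\<^sub>F t in at_bot. \<forall>x\<in>{-R..R} - {0}.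
            \<bar>expansion_error a b K z0 h t x\<bar>
              \<le> \<epsilon> * (\<bar>x\<bar> / exp (b * t)) powr (1 + Re z0)) \<and>
         (\<forall>R>0. \<forall>\<delta>>0. \<forall>\<epsilon>>0. \<forall>\<^sub>F t in at_bot. \<forall>x\<in>{-R..R}. \<delta> \<le> \<bar>x\<bar> \<longrightarrow>
            \<bar>expansion_error a b K z0 h t x\<bar>
              \<le> \<epsilon> * (exp (b * t) * (\<bar>x\<bar> / exp (b * t)) powr (1 + Re z0)))"
proof -
  obtain \<phi> v g J p k where "power_flow \<phi> v g J p k 4"
    using power_flow_exists[of 4] by auto
  then interpret power_flow \<phi> v g J p k 4 .
  interpret flow4 \<phi> v g J p k
  proof
    fix y :: real assume y: "0 \<le> y"
    then have "0 < \<phi> y" using f_ge_half[of y] by simp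
    then show "p y = 1 / \<phi> y ^ 4" using p_eq[OF y] by (simp add: powr_minus_divide)
  qed
  \<comment> \<open>The normalization \<open>f 0 = 1\<close> forces \<open>l = 1\<close>, so
    \<open>\<mu>\<close> alone adjusts the slope, and \<open>b = 1 / \<mu>^4\<close>
    follows.\<close>
  define \<mu> where "\<mu> = slope / a"
  have \<mu>: "0 < \<mu>" using slope_pos a by (simp add: \<mu>_def)
  have slope_\<mu>: "slope / \<mu> = a" using slope_pos a by (simp add: \<mu>_def)
  define b where "b = 1 / \<mu> ^ 4"
  have b: "0 < b" using \<mu> by (simp add: b_def)
  define f where "f = fs 1 \<mu>"
  define h where "h t x = exp (b * t) * f (\<bar>x\<bar> / exp (b * t))" for t x
  obtain m0 K C where m0: "m0 * (m0 - 2) * (m0 + 1) = of_real (1 / slope ^ 4)" "Re m0 < - 1 / 2" "0 < Im m0"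
    "\<And>m. m * (m - 2) * (m + 1) = of_real (1 / slope ^ 4) \<Longrightarrow> Re m < 1 \<Longrightarrow> Re m \<le> Re m0"
    and exp: "\<And>s. 0 \<le> s \<Longrightarrow> \<bar>U s - slope - Re (K * exp ((m0 - 1) * of_real s))\<bar> \<le> C * exp (2 * (Re m0 - 1) * s)"
    using expansion_log by blast
  \<comment> \<open>\<open>f / y\<close> corrects like \<open>y^(m0 - 1)\<close>, so
    \<open>z0 = m0 - 1\<close>. The factor in \<open>K'\<close> comes from the dilation: the
    logarithmic variable is \<open>ln y - ln \<mu>\<close>.\<close>
  define z0 where "z0 = m0 - 1"
  define K' where "K' = K * exp (- m0 * of_real (ln \<mu>))"
  define \<rho> where "\<rho> = Re m0"
  have \<rho>: "\<rho> < - 1 / 2" "\<rho> = 1 + Re z0" using m0 by (auto simp: \<rho>_def z0_def)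
  define r where "r y = f y - a * y - Re (K' * complex_of_real y powr (1 + z0))" for y

  have prof: "profile a b (k / \<mu>\<^sup>2) f"
    unfolding profile_def
  proof (intro conjI exI)
    have "(f has_real_derivative 1 / \<mu> * F1 (y / \<mu>)) (at y)" for y
      using dilation_derivative[OF dF0, of 1 \<mu> y] by (simp add: f_def fs_def[abs_def])
    moreover have "((\<lambda>y. 1 / \<mu> * F1 (y / \<mu>)) has_real_derivative 1 / \<mu>\<^sup>2 * F2 (y / \<mu>)) (at y)" for y
      using dilation_derivative[OF dF1, of "1 / \<mu>" \<mu> y] by (simp add: power2_eq_square)
    moreover have "((\<lambda>y. 1 / \<mu>\<^sup>2 * F2 (y / \<mu>)) has_real_derivative 1 / \<mu> ^ 3 * F3 (y / \<mu>)) (at y)" for y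
      using dilation_derivative[OF dF2, of "1 / \<mu>\<^sup>2" \<mu> y] by (simp add: power2_eq_square power3_eq_cube)
    ultimately show "\<forall>y\<ge>0. (f has_real_derivative 1 / \<mu> * F1 (y / \<mu>)) (at y within {0..}) \<and>
        ((\<lambda>y. 1 / \<mu> * F1 (y / \<mu>)) has_real_derivative 1 / \<mu>\<^sup>2 * F2 (y / \<mu>)) (at y within {0..}) \<and>
        ((\<lambda>y. 1 / \<mu>\<^sup>2 * F2 (y / \<mu>)) has_real_derivative 1 / \<mu> ^ 3 * F3 (y / \<mu>)) (at y within {0..})"
      by (auto intro: has_field_derivative_at_within)
    show "\<forall>y>0. \<exists>D. ((\<lambda>y. f y ^ 4 * (1 / \<mu> ^ 3 * F3 (y / \<mu>))) has_real_derivative D) (at y) \<and>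
        b * (f y - y * (1 / \<mu> * F1 (y / \<mu>))) + D = 0"
    proof (intro allI impI exI conjI)
      fix y :: real
      have eq: "(\<lambda>y. f y ^ 4 * (1 / \<mu> ^ 3 * F3 (y / \<mu>))) = (\<lambda>y. 1 / \<mu> ^ 3 * FJ (y / \<mu>))"
      proof
        fix y
        show "f y ^ 4 * (1 / \<mu> ^ 3 * F3 (y / \<mu>)) = 1 / \<mu> ^ 3 * FJ (y / \<mu>)"
          using FJ_eq[of "y / \<mu>"] F0_ge[of "y / \<mu>"] by (simp add: f_def fs_def)
      qed
      show "((\<lambda>y. f y ^ 4 * (1 / \<mu> ^ 3 * F3 (y / \<mu>))) has_real_derivative
          1 / \<mu> ^ 3 * (y / \<mu> * F1 (y / \<mu>) - F0 (y / \<mu>)) / \<mu>) (at y)"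
        unfolding eq by (rule dilation_derivative[OF dFJ])
      show "b * (f y - y * (1 / \<mu> * F1 (y / \<mu>))) + 1 / \<mu> ^ 3 * (y / \<mu> * F1 (y / \<mu>) - F0 (y / \<mu>)) / \<mu> = 0"
        using \<mu> by (simp add: b_def f_def fs_def field_simps power3_eq_cube power4_eq_xxxx)
    qed
    show "f 0 = 1" "1 / \<mu> * F1 (0 / \<mu>) = 0" "1 / \<mu>\<^sup>2 * F2 (0 / \<mu>) = k / \<mu>\<^sup>2" "1 / \<mu> ^ 3 * F3 (0 / \<mu>) = 0"
      by (simp_all add: f_def fs_def F0_def F1_def F2_def F3_def init)
    show "((\<lambda>y. f y / y) \<longlongrightarrow> a) at_top"
      using fs_slope[of 1 \<mu>] \<mu> slope_\<mu> by (simp add: f_def)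
  qed

  have lead: "leading_root a b z0"
  proof -
    have ba: "b / a ^ 4 = 1 / slope ^ 4"
      using a slope_pos by (simp add: b_def \<mu>_def power_divide)
    \<comment> \<open>The substitution \<open>m = 1 + z\<close> turns
      \<open>m (m - 2) (m + 1)\<close> into \<open>- (1 - z^2) (2 + z)\<close>.\<close>
    have eq: "decay_root a b z \<longleftrightarrow> (1 + z) * (1 + z - 2) * (1 + z + 1) = of_real (1 / slope ^ 4)" for z
    proof -
      have "(1 + z) * (1 + z - 2) * (1 + z + 1) = - ((1 - z\<^sup>2) * (2 + z))"
        by (simp add: algebra_simps power2_eq_square)
      then show ?thesis unfolding decay_root_def ba by (auto simp: add_eq_0_iff2 neg_eq_iff_add_eq_0)
    qed
    have "Re z \<le> Re z0" if "decay_root a b z" "Re z < 0" for z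
      using m0(4)[of "1 + z"] that eq[of z] by (simp add: z0_def)
    then show ?thesis
      unfolding leading_root_def using m0 eq[of z0] by (auto simp: z0_def)
  qed

  have r_bound: "\<bar>r y\<bar> \<le> C * (y / \<mu>) powr (2 * \<rho> - 1)" if y: "\<mu> \<le> y" for y
  proof -
    have y0: "0 < y" "1 \<le> y / \<mu>" using y \<mu> by auto
    define s where "s = ln (y / \<mu>)"
    have s: "0 \<le> s" "exp s = y / \<mu>" using y0 \<mu> by (auto simp: s_def)
    have "U s = \<mu> / y * f y" using y0 \<mu> s by (simp add: U_def u_def f_def fs_def F0_def)
    moreover have "complex_of_real y powr (1 + z0) = exp (m0 * of_real (ln y))"
      using y0 by (simp add: powr_def z0_def Ln_of_real)
    moreover have "exp (m0 * of_real (ln y)) * exp (- m0 * of_real (ln \<mu>)) = exp (m0 * of_real s)"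
      using y0 \<mu> by (simp add: s_def ln_div exp_add[symmetric] algebra_simps)
    moreover have "exp (m0 * of_real s) = of_real (y / \<mu>) * exp ((m0 - 1) * of_real s)"
    proof -
      have "exp ((m0 - 1) * of_real s) * of_real (exp s) = exp (m0 * of_real s)"
        by (simp add: exp_of_real[symmetric] exp_add[symmetric] algebra_simps)
      then show ?thesis unfolding s(2) by (simp add: mult.commute)
    qed
    ultimately have "K' * complex_of_real y powr (1 + z0)
        = of_real (y / \<mu>) * (K * exp ((m0 - 1) * of_real s))" "f y = y / \<mu> * U s"
      using y0 \<mu> by (auto simp: K'_def mult_ac)
    moreover have "a * y = y / \<mu> * slope" unfolding slope_\<mu>[symmetric] by simp
    moreover have "Re (of_real c * z) = c * Re z" for c z by simp
    ultimately have "r y = y / \<mu> * U s - y / \<mu> * slope - y / \<mu> * Re (K * exp ((m0 - 1) * of_real s))"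
      unfolding r_def by (simp only:)
    then have "r y = y / \<mu> * (U s - slope - Re (K * exp ((m0 - 1) * of_real s)))"
      by (simp only: right_diff_distrib)
    then have "\<bar>r y\<bar> = y / \<mu> * \<bar>U s - slope - Re (K * exp ((m0 - 1) * of_real s))\<bar>"
      using y0 \<mu> by (simp add: abs_mult)
    also have "\<dots> \<le> y / \<mu> * (C * exp (2 * (Re m0 - 1) * s))"
      using y0 \<mu> by (intro mult_left_mono exp s) auto
    also have "y / \<mu> * (C * exp (2 * (Re m0 - 1) * s)) = C * (exp s * exp (2 * (Re m0 - 1) * s))"
      by (simp add: s(2) mult_ac)
    also have "exp s * exp (2 * (Re m0 - 1) * s) = exp ((2 * \<rho> - 1) * s)"
      by (simp add: exp_add[symmetric] \<rho>_def algebra_simps)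
    also have "\<dots> = (y / \<mu>) powr (2 * \<rho> - 1)"
      using y0 \<mu> by (simp add: powr_def s_def)
    finally show ?thesis .
  qed

  have C0: "0 \<le> C" using exp[of 0] by simp
  \<comment> \<open>\<open>2 \<rho> - 1 = \<rho> + (\<rho> - 1)\<close>: beside the leading power
    \<open>y^\<rho>\<close> a decaying factor \<open>y^(\<rho> - 1)\<close> remains.\<close>
  have r_small: "\<exists>Y>0. \<forall>y\<ge>Y. \<bar>r y\<bar> \<le> e * y powr \<rho>" if e: "0 < e" for e
  proof -
    have "((\<lambda>y. C * (1 / \<mu>) powr (2 * \<rho> - 1) * y powr (\<rho> - 1)) \<longlongrightarrow> C * (1 / \<mu>) powr (2 * \<rho> - 1) * 0) at_top"
      by (intro tendsto_mult tendsto_const tendsto_neg_powr filterlim_ident) (use \<rho> in simp)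
    then have "\<forall>\<^sub>F y in at_top. C * (1 / \<mu>) powr (2 * \<rho> - 1) * y powr (\<rho> - 1) < e"
      by (rule order_tendstoD) (use e in simp)
    then obtain Y where Y: "\<And>y. Y \<le> y \<Longrightarrow> C * (1 / \<mu>) powr (2 * \<rho> - 1) * y powr (\<rho> - 1) < e"
      by (auto simp: eventually_at_top_linorder)
    have "\<bar>r y\<bar> \<le> e * y powr \<rho>" if y: "max \<mu> Y \<le> y" for y
    proof -
      have y0: "0 < y" "\<mu> \<le> y" "Y \<le> y" using y \<mu> by auto
      have "(y / \<mu>) powr (2 * \<rho> - 1) = (1 / \<mu>) powr (2 * \<rho> - 1) * (y powr (\<rho> - 1) * y powr \<rho>)"
        using y0 \<mu> powr_mult[of "1 / \<mu>" y "2 * \<rho> - 1"] by (simp add: powr_add[symmetric])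
      then have "\<bar>r y\<bar> \<le> (C * (1 / \<mu>) powr (2 * \<rho> - 1) * y powr (\<rho> - 1)) * y powr \<rho>"
        using r_bound[OF y0(2)] by (simp add: mult_ac)
      also have "\<dots> \<le> e * y powr \<rho>" using Y[OF y0(3)] by (intro mult_right_mono) auto
      finally show ?thesis .
    qed
    then show ?thesis using \<mu> by (intro exI[of _ "max \<mu> Y"]) auto
  qed
  have norm_powr: "norm (complex_of_real y powr (1 + z0)) = y powr \<rho>" if "0 < y" for y
    using that norm_powr_real_powr[of "complex_of_real y" "1 + z0"] by (simp add: \<rho>(2))
  \<comment> \<open>For \<open>y\<close> below \<open>Y\<close> the power \<open>y^\<rho>\<close>
    with negative \<open>\<rho>\<close> is at least \<open>Y^\<rho>\<close>, which absorbs the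
    bounded terms. So the order of the leading term is right down to \<open>y = 0\<close>, without
    smallness.\<close>
  have r_global: "\<exists>B\<ge>0. \<forall>y>0. \<bar>r y\<bar> \<le> B * y powr \<rho>"
  proof -
    obtain Y where Y: "0 < Y" "\<And>y. Y \<le> y \<Longrightarrow> \<bar>r y\<bar> \<le> 1 * y powr \<rho>" using r_small[of 1] by auto
    have "compact (f ` {0..Y})"
      unfolding f_def by (intro compact_continuous_image cont_fs) auto
    then obtain M where "\<forall>z\<in>f ` {0..Y}. norm z \<le> M"
      using compact_imp_bounded bounded_iff by metis
    then have M: "\<bar>f y\<bar> \<le> M" if "0 \<le> y" "y \<le> Y" for y using that by force
    define B where "B = (\<bar>M\<bar> + a * Y) / Y powr \<rho> + norm K' + 1"
    have B1: "0 \<le> (\<bar>M\<bar> + a * Y) / Y powr \<rho>" using a Y(1) by simp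
    have "\<bar>r y\<bar> \<le> B * y powr \<rho>" if y: "0 < y" for y
    proof (cases "Y \<le> y")
      case True
      have "1 * y powr \<rho> \<le> B * y powr \<rho>" using B1 by (intro mult_right_mono) (auto simp: B_def)
      then show ?thesis using Y(2)[OF True] by linarith
    next
      case False
      have "\<bar>Re (K' * complex_of_real y powr (1 + z0))\<bar> \<le> norm K' * y powr \<rho>"
        using abs_Re_le_cmod[of "K' * complex_of_real y powr (1 + z0)"] norm_powr[OF y] by (simp add: norm_mult)
      moreover have "a * y \<le> a * Y" "0 \<le> a * y" using a y False by auto
      moreover have "\<bar>f y\<bar> \<le> M" using M[of y] y False by simp
      ultimately have "\<bar>r y\<bar> \<le> (\<bar>M\<bar> + a * Y) + norm K' * y powr \<rho>"
        unfolding r_def by linarith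
      also have "\<bar>M\<bar> + a * Y = (\<bar>M\<bar> + a * Y) / Y powr \<rho> * Y powr \<rho>" using Y(1) by simp
      also have "\<dots> \<le> (\<bar>M\<bar> + a * Y) / Y powr \<rho> * y powr \<rho>"
        using y False \<rho> by (intro mult_left_mono B1 powr_mono2') auto
      finally have "\<bar>r y\<bar> \<le> ((\<bar>M\<bar> + a * Y) / Y powr \<rho> + norm K') * y powr \<rho>"
        by (simp add: ring_distribs)
      also have "\<dots> \<le> B * y powr \<rho>" by (intro mult_right_mono) (auto simp: B_def)
      finally show ?thesis .
    qed
    moreover have "0 \<le> B" using B1 by (simp add: B_def)
    ultimately show ?thesis by blast
  qed

  have err: "expansion_error a b K' z0 h t x = exp (b * t) * r (\<bar>x\<bar> / exp (b * t))" for t x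
    unfolding expansion_error_def h_def r_def by (simp add: right_diff_distrib)
  have small_exp: "\<forall>\<^sub>F t in at_bot. exp (b * t) \<le> c" if "0 < c" for c
    using eventually_le_at_bot[of "ln c / b"]
  proof eventually_elim
    case (elim t)
    then have "b * t \<le> ln c" using b by (simp add: pos_le_divide_eq mult.commute)
    then show ?case using that by (metis exp_le_cancel_iff exp_ln)
  qed

  have ws: "weak_solution (-\<infinity>) 4 h"
  proof (rule scaled_weak_solution[where l = 1 and \<mu> = \<mu> and \<beta> = b and S = "\<lambda>t. exp (b * t)"])
    show "b = 1 powr 4 / \<mu> ^ 4" by (simp add: b_def)
    show "((\<lambda>t. exp (b * t)) has_real_derivative b * exp (b * t) powr (4 - 3)) (at t)" for t
      by (auto intro!: derivative_eq_intros)
    show "\<exists>B. \<forall>t. - \<infinity> < ereal t \<and> t \<le> T \<longrightarrow> exp (b * t) \<le> B" for T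
      using b by (intro exI[of _ "exp (b * T)"]) auto
    have "f \<bar>x / exp (b * t)\<bar> = f (x / exp (b * t))" for x t
      unfolding f_def by (rule fs_even[OF \<mu>])
    then show "h t x = exp (b * t) * fs 1 \<mu> (x / exp (b * t))" for t x
      by (simp add: h_def f_def)
    show "0 \<le> h t x" for t x
      using fs_pos[of 1 \<mu> "\<bar>x\<bar> / exp (b * t)"] by (simp add: h_def f_def)
    have "continuous_on UNIV (\<lambda>z :: real \<times> real. exp (b * fst z) * fs 1 \<mu> (\<bar>snd z\<bar> / exp (b * fst z)))"
      by (intro continuous_intros continuous_on_compose2[OF cont_fs[of UNIV]]) auto
    then show "continuous_on ({t. - \<infinity> \<le> ereal t} \<times> UNIV) (\<lambda>(t, x). h t x)"
      by (simp add: h_def f_def case_prod_beta)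
  qed (use \<mu> in auto)

  have o: "(\<lambda>y. f y - a * y - Re (K' * complex_of_real y powr (1 + z0))) \<in> o[at_top](\<lambda>y. y powr (1 + Re z0))"
  proof (rule landau_o.smallI)
    fix c :: real assume "0 < c"
    then obtain Y where "\<And>y. Y \<le> y \<Longrightarrow> \<bar>r y\<bar> \<le> c * y powr \<rho>" using r_small by blast
    then show "\<forall>\<^sub>F y in at_top. norm (f y - a * y - Re (K' * complex_of_real y powr (1 + z0)))
        \<le> c * norm (y powr (1 + Re z0))"
      unfolding r_def \<rho>(2) by (auto simp: eventually_at_top_linorder)
  qed

  have e1: "\<forall>R>0. \<forall>\<epsilon>>0. \<forall>\<^sub>F t in at_bot. \<forall>x\<in>{-R..R} - {0}.
      \<bar>expansion_error a b K' z0 h t x\<bar> \<le> \<epsilon> * (\<bar>x\<bar> / exp (b * t)) powr (1 + Re z0)"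
  proof (intro allI impI)
    fix R \<epsilon> :: real assume \<epsilon>: "0 < \<epsilon>"
    obtain B where B: "0 \<le> B" "\<And>y. 0 < y \<Longrightarrow> \<bar>r y\<bar> \<le> B * y powr \<rho>" using r_global by blast
    have "0 < \<epsilon> / (B + 1)" using \<epsilon> B by simp
    from small_exp[OF this] show "\<forall>\<^sub>F t in at_bot. \<forall>x\<in>{-R..R} - {0}.
      \<bar>expansion_error a b K' z0 h t x\<bar> \<le> \<epsilon> * (\<bar>x\<bar> / exp (b * t)) powr (1 + Re z0)"
    proof eventually_elim
      case (elim t)
      have "exp (b * t) * B \<le> \<epsilon> / (B + 1) * (B + 1)" using elim B \<epsilon> by (intro mult_mono) auto
      then have le: "exp (b * t) * B \<le> \<epsilon>" using B by simp
      show ?case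
      proof
        fix x assume "x \<in> {-R..R} - {0}"
        then have y: "0 < \<bar>x\<bar> / exp (b * t)" by simp
        have "\<bar>expansion_error a b K' z0 h t x\<bar> = exp (b * t) * \<bar>r (\<bar>x\<bar> / exp (b * t))\<bar>"
          by (simp add: err abs_mult)
        also have "\<dots> \<le> exp (b * t) * (B * (\<bar>x\<bar> / exp (b * t)) powr \<rho>)"
          by (intro mult_left_mono B(2)[OF y]) auto
        also have "\<dots> = (exp (b * t) * B) * (\<bar>x\<bar> / exp (b * t)) powr \<rho>" by (simp only: mult.assoc)
        also have "\<dots> \<le> \<epsilon> * (\<bar>x\<bar> / exp (b * t)) powr \<rho>" by (intro mult_right_mono le) auto
        finally show "\<bar>expansion_error a b K' z0 h t x\<bar> \<le> \<epsilon> * (\<bar>x\<bar> / exp (b * t)) powr (1 + Re z0)"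
          unfolding \<rho>(2) .
      qed
    qed
  qed

  \<comment> \<open>Away from \<open>x = 0\<close> the variable \<open>y\<close> becomes uniformly
    large, so \<open>r_small\<close> applies and the prefactor can be kept on the right.\<close>
  have e2: "\<forall>R>0. \<forall>\<delta>>0. \<forall>\<epsilon>>0. \<forall>\<^sub>F t in at_bot. \<forall>x\<in>{-R..R}. \<delta> \<le> \<bar>x\<bar> \<longrightarrow>
      \<bar>expansion_error a b K' z0 h t x\<bar> \<le> \<epsilon> * (exp (b * t) * (\<bar>x\<bar> / exp (b * t)) powr (1 + Re z0))"
  proof (intro allI impI)
    fix R \<delta> \<epsilon> :: real assume \<delta>: "0 < \<delta>" and \<epsilon>: "0 < \<epsilon>"
    obtain Y where Y: "0 < Y" "\<And>y. Y \<le> y \<Longrightarrow> \<bar>r y\<bar> \<le> \<epsilon> * y powr \<rho>" using r_small[OF \<epsilon>] by blast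
    have "0 < \<delta> / Y" using \<delta> Y by simp
    from small_exp[OF this] show "\<forall>\<^sub>F t in at_bot. \<forall>x\<in>{-R..R}. \<delta> \<le> \<bar>x\<bar> \<longrightarrow>
      \<bar>expansion_error a b K' z0 h t x\<bar> \<le> \<epsilon> * (exp (b * t) * (\<bar>x\<bar> / exp (b * t)) powr (1 + Re z0))"
    proof eventually_elim
      case (elim t)
      show ?case
      proof (intro ballI impI)
        fix x assume x: "\<delta> \<le> \<bar>x\<bar>"
        have "Y * exp (b * t) \<le> \<delta>" using elim Y by (simp add: pos_le_divide_eq mult.commute)
        then have y: "Y \<le> \<bar>x\<bar> / exp (b * t)" using x by (simp add: pos_le_divide_eq)
        have "\<bar>expansion_error a b K' z0 h t x\<bar> = exp (b * t) * \<bar>r (\<bar>x\<bar> / exp (b * t))\<bar>"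
          by (simp add: err abs_mult)
        also have "\<dots> \<le> exp (b * t) * (\<epsilon> * (\<bar>x\<bar> / exp (b * t)) powr \<rho>)"
          by (intro mult_left_mono Y(2)[OF y]) auto
        also have "\<dots> = \<epsilon> * (exp (b * t) * (\<bar>x\<bar> / exp (b * t)) powr \<rho>)" by (simp only: mult.left_commute)
        finally show "\<bar>expansion_error a b K' z0 h t x\<bar>
            \<le> \<epsilon> * (exp (b * t) * (\<bar>x\<bar> / exp (b * t)) powr (1 + Re z0))"
          unfolding \<rho>(2) .
      qed
    qed
  qed

  have "0 < k / \<mu>\<^sup>2" using k_pos \<mu> by simp
  moreover have "Re z0 < -1" using \<rho> by simp
  moreover have "\<forall>t x. h t x = exp (b * t) * f (\<bar>x\<bar> / exp (b * t))" by (simp add: h_def)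
  ultimately show ?thesis
    using b prof lead o ws e1 e2 by blast
qed

theorem corollary2p2:
  "(\<forall>m a::real. 0 < m \<and> m < 4 \<and> 0 < a \<longrightarrow>
      (\<exists>(h :: real \<Rightarrow> real \<Rightarrow> real) (f :: real \<Rightarrow> real).
         weak_solution 0 m h \<and>
         has_initial_data 0 h (\<lambda>x. a * \<bar>x\<bar>) \<and>
         (\<forall>t>0. \<forall>x. h t x = t powr (1 / (4 - m)) * f (\<bar>x\<bar> / t powr (1 / (4 - m))))))
   \<and>
   (\<forall>a::real. 0 < a \<longrightarrow>
      (\<exists>(b :: real) (\<kappa> :: real) (f :: real \<Rightarrow> real) (K :: complex) (z0 :: complex)
         (h :: real \<Rightarrow> real \<Rightarrow> real).
         0 < b \<and> 0 < \<kappa> \<and> profile a b \<kappa> f \<and>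
         leading_root a b z0 \<and> Re z0 < -1 \<and>
         (\<lambda>y. f y - a * y - Re (K * complex_of_real y powr (1 + z0)))
            \<in> o[at_top](\<lambda>y. y powr (1 + Re z0)) \<and>
         weak_solution (-\<infinity>) 4 h \<and>
         (\<forall>t x. h t x = exp (b * t) * f (\<bar>x\<bar> / exp (b * t))) \<and>
         (\<forall>R>0. \<forall>\<epsilon>>0. \<forall>\<^sub>F t in at_bot. \<forall>x\<in>{-R..R} - {0}.
            \<bar>expansion_error a b K z0 h t x\<bar>
              \<le> \<epsilon> * (\<bar>x\<bar> / exp (b * t)) powr (1 + Re z0)) \<and>
         (\<forall>R>0. \<forall>\<delta>>0. \<forall>\<epsilon>>0. \<forall>\<^sub>F t in at_bot. \<forall>x\<in>{-R..R}. \<delta> \<le> \<bar>x\<bar> \<longrightarrow>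
            \<bar>expansion_error a b K z0 h t x\<bar>
              \<le> \<epsilon> * (exp (b * t) * (\<bar>x\<bar> / exp (b * t)) powr (1 + Re z0)))))"
  using wedge_solution critical_solution by blast

end
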